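(* Let $\mathcal{S}=\mathbb{P}\mathbb{C}^{n_1}\times\cdots\times\mathbb{P}\mathbb{C}^{n_d}\subset\mathbb{P}\mathbb{C}^{\Pi}$ be a Segre variety of dimension $\Sigma$. Let $p_1,\ldots,p_r\in\mathcal{S}$ be points such that $\mathrm{H}=\langle\mathrm{T}_{p_1}\mathcal{S},\ldots,\mathrm{T}_{p_r}\mathcal{S}\rangle$ is defined by exactly $\ell=\Pi-r(\Sigma+1)$ independent linear equations, and let $H=[\,H^1\ H^2\ \cdots\ H^\ell\,]$ be the stacked Hessian at $p_1$. If the rank of $H$ is maximal, i.e. equal to $\Sigma$, then $\mathcal{S}$ is (generically) $r$-identifiable.
   Context: $\mathbb{P}\mathbb{C}^N$ is the projective space of lines in $\mathbb{C}^N$; $\Pi=\prod_i n_i$, $\Sigma=\sum_i(n_i-1)$. $\mathcal{S}$ is embedded as the variety of rank-one tensors; $\mathrm{T}_p\mathcal{S}$ is the embedded projective tangent space. Stacked Hessian at a point $p_k$ (relative to $p_1,\ldots,p_r$): choose bases of the spaces $\mathbb{C}^{n_I}$ such that $p_k=\mathbf{e}_1\otimes\cdots\otimes\mathbf{e}_1$. Let $q_l(x)=\sum_{i_1,\ldots,i_d}k_{(i_1,\ldots,i_d),l}\,x_{i_1,\ldots,i_d}$, $l=1,\ldots,\ell$, be a basis of the linear forms on $\mathbb{C}^{n_1\times\cdots\times n_d}$ vanishing on $\mathrm{H}$. Then $H^l$ is the $\Sigma\times\Sigma$ matrix consisting of blocks $H^l_{IJ}$, $1\le I,J\le d$, of size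 $(n_I-1)\times(n_J-1)$, with $H^l_{II}=0$ and, for $I\ne J$, $(H^l_{IJ})_{ij}=k_{(1,\ldots,1,i+1,1,\ldots,1,j+1,1,\ldots,1),l}$, where $i+1$ is in position $I$ and $j+1$ in position $J$; i.e. $H^l$ is the Hessian at $p_k$ of $q_l(\mathbf{a}^1\otimes\cdots\otimes\mathbf{a}^d)$ in the affine coordinates $a^I_{i}$, $i\ge2$ (with $a^I_1=1$). The stacked Hessian is the $\Sigma\times\ell\Sigma$ matrix $H=[H^1\cdots H^\ell]$. $\mathcal{S}$ is generically $r$-identifiable if a general element of $\sigma_r(\mathcal{S})$ (the Zariski closure of the union of spans of $r$ points of $\mathcal{S}$) has a unique representation as a linear combination of $r$ points of $\mathcal{S}$, up to order and scaling of representatives. *)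

theory Defs
  imports
    Complex_Main
    "HOL.Hull"
    "HOL-Library.Function_Algebras"
    "HOL-Combinatorics.Permutations"
    "Jordan_Normal_Form.DL_Rank"
begin

section \<open>Tensors\<close>

text \<open>
  A format \<open>n = [n_1, ..., n_d]\<close> is a list of dimensions. Multi-indices are lists and are
  0-based, so the multi-index \<open>(1,...,1)\<close> of the literature is \<open>replicate d 0\<close>. A tensor of
  format \<open>n\<close> is a function on multi-indices that is zero outside \<open>idx n\<close>.
\<close>

type_synonym tensor = "nat list \<Rightarrow> complex"

definition idx :: "nat list \<Rightarrow> nat list set" where
  "idx n = {i. length i = length n \<and> (\<forall>I<length n. i ! I < n ! I)}"

definition tensors :: "nat list \<Rightarrow> tensor set" where
  "tensors n = {x. \<forall>i. i \<notin> idx n \<longrightarrow> x i = 0}"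

definition smul :: "complex \<Rightarrow> ('i \<Rightarrow> complex) \<Rightarrow> 'i \<Rightarrow> complex" (infixr "*\<^sub>C" 75) where
  "c *\<^sub>C x = (\<lambda>i. c * x i)"

interpretation tensor: vector_space "smul :: complex \<Rightarrow> tensor \<Rightarrow> tensor"
  by unfold_locales (simp_all add: smul_def fun_eq_iff algebra_simps)

definition outer :: "nat list \<Rightarrow> (nat \<Rightarrow> complex vec) \<Rightarrow> tensor" where
  "outer n a = (\<lambda>i. if i \<in> idx n then \<Prod>I<length n. a I $ (i ! I) else 0)"


section \<open>Projective geometry\<close>

text \<open>
  A point of a projective space of tensors is given by a nonzero representative, two
  representatives being identified by \<open>same_point\<close>. A subset of projective space is given by the
  set of all representatives of its points (its affine cone without the origin).
\<close>

definition proj_space :: "nat list \<Rightarrow> tensor set" where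
  "proj_space n = tensors n - {0}"

definition same_point :: "tensor \<Rightarrow> tensor \<Rightarrow> bool" where
  "same_point x y \<longleftrightarrow> (\<exists>c. c \<noteq> 0 \<and> x = c *\<^sub>C y)"

inductive_set poly_funs :: "(tensor \<Rightarrow> complex) set" where
  const: "(\<lambda>x. c) \<in> poly_funs"
| coord: "(\<lambda>x. x i) \<in> poly_funs"
| add: "f \<in> poly_funs \<Longrightarrow> g \<in> poly_funs \<Longrightarrow> (\<lambda>x. f x + g x) \<in> poly_funs"
| mult: "f \<in> poly_funs \<Longrightarrow> g \<in> poly_funs \<Longrightarrow> (\<lambda>x. f x * g x) \<in> poly_funs"

definition homogeneous_polys :: "(tensor \<Rightarrow> complex) set" where
  "homogeneous_polys = {f \<in> poly_funs. \<exists>k::nat. \<forall>c x. f (c *\<^sub>C x) = c ^ k * f x}"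

definition zariski_closed :: "nat list \<Rightarrow> tensor set \<Rightarrow> bool" where
  "zariski_closed n Z \<longleftrightarrow>
     (\<exists>F \<subseteq> homogeneous_polys. Z = {x \<in> proj_space n. \<forall>f\<in>F. f x = 0})"

definition zariski_closure :: "nat list \<Rightarrow> tensor set \<Rightarrow> tensor set" where
  "zariski_closure n X = zariski_closed n hull X"

text \<open>
  The linear subspace of the space of tensors whose projectivization is the embedded projective
  tangent space at \<open>p\<close> of the projective variety \<open>X\<close>: the common kernel of the differentials at
  \<open>p\<close> of the homogeneous polynomials vanishing on \<open>X\<close>.
\<close>

definition tangent_space :: "nat list \<Rightarrow> tensor set \<Rightarrow> tensor \<Rightarrow> tensor set" where
  "tangent_space n X p = {v \<in> tensors n. \<forall>f\<in>homogeneous_polys. (\<forall>x\<in>X. f x = 0) \<longrightarrow>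
     ((\<lambda>t::complex. f (p + t *\<^sub>C v)) has_field_derivative 0) (at 0)}"


section \<open>Segre varieties, secant varieties and identifiability\<close>

definition segre :: "nat list \<Rightarrow> tensor set" where
  "segre n = {outer n a | a. \<forall>I<length n. a I \<in> carrier_vec (n ! I) \<and> a I \<noteq> 0\<^sub>v (n ! I)}"

definition segre_dim :: "nat list \<Rightarrow> nat" where
  "segre_dim n = (\<Sum>m\<leftarrow>n. m - 1)"

definition secant_variety :: "nat list \<Rightarrow> nat \<Rightarrow> tensor set" where
  "secant_variety n r = zariski_closure n
     {x. x \<noteq> 0 \<and> (\<exists>p. (\<forall>k<r. p k \<in> segre n) \<and> x \<in> tensor.span (p ` {..<r}))}"

definition is_representation ::
  "nat list \<Rightarrow> nat \<Rightarrow> tensor \<Rightarrow> (nat \<Rightarrow> complex) \<Rightarrow> (nat \<Rightarrow> tensor) \<Rightarrow> bool" where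
  "is_representation n r x c p \<longleftrightarrow>
     (\<forall>k<r. p k \<in> segre n) \<and> x = (\<Sum>k<r. c k *\<^sub>C p k)"

text \<open>
  In the uniqueness part, the points agree up to a permutation \<open>\<pi>\<close>, and the coefficients then agree
  up to the change of representatives.
\<close>

definition has_unique_representation :: "nat list \<Rightarrow> nat \<Rightarrow> tensor \<Rightarrow> bool" where
  "has_unique_representation n r x \<longleftrightarrow>
     (\<exists>c p. is_representation n r x c p) \<and>
     (\<forall>c p c' p'. is_representation n r x c p \<and> is_representation n r x c' p' \<longrightarrow>
        (\<exists>\<pi>. \<pi> permutes {..<r} \<and>
           (\<forall>k<r. same_point (p' k) (p (\<pi> k)) \<and> c' k *\<^sub>C p' k = c (\<pi> k) *\<^sub>C p (\<pi> k))))"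

text \<open>A general element is an element of some dense Zariski-open subset.\<close>

definition generically_identifiable :: "nat list \<Rightarrow> nat \<Rightarrow> bool" where
  "generically_identifiable n r \<longleftrightarrow>
     (\<exists>Z. zariski_closed n Z \<and>
        zariski_closure n (secant_variety n r - Z) = secant_variety n r \<and>
        (\<forall>x \<in> secant_variety n r - Z. has_unique_representation n r x))"


section \<open>Linear equations and the stacked Hessian\<close>

definition tangent_join :: "nat list \<Rightarrow> nat \<Rightarrow> (nat \<Rightarrow> tensor) \<Rightarrow> tensor set" where
  "tangent_join n r p = tensor.span (\<Union>k<r. tangent_space n (segre n) (p k))"

text \<open>A linear form on \<open>tensors n\<close> is given by its tensor of coefficients in standard coordinates.\<close>

definition form :: "nat list \<Rightarrow> tensor \<Rightarrow> tensor \<Rightarrow> complex" where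
  "form n q x = (\<Sum>i\<in>idx n. q i * x i)"

definition vanishing_forms :: "nat list \<Rightarrow> tensor set \<Rightarrow> tensor set" where
  "vanishing_forms n H = {q \<in> tensors n. \<forall>x\<in>H. form n q x = 0}"

definition is_basis :: "nat \<Rightarrow> (nat \<Rightarrow> tensor) \<Rightarrow> tensor set \<Rightarrow> bool" where
  "is_basis l q V \<longleftrightarrow> inj_on q {..<l} \<and> tensor.independent (q ` {..<l}) \<and>
     tensor.span (q ` {..<l}) = V"

text \<open>
  Bases of the factors are given by invertible matrices \<open>B I\<close>, whose columns are the basis vectors.
  In the coordinates with respect to the induced basis of the space of tensors, the coefficient of
  a linear form at \<open>i\<close> is its value at the basis tensor with index \<open>i\<close>.
\<close>

definition basis_tensor :: "nat list \<Rightarrow> (nat \<Rightarrow> complex mat) \<Rightarrow> nat list \<Rightarrow> tensor" where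
  "basis_tensor n B i = outer n (\<lambda>I. col (B I) (i ! I))"

definition coeff_wrt :: "nat list \<Rightarrow> (nat \<Rightarrow> complex mat) \<Rightarrow> tensor \<Rightarrow> nat list \<Rightarrow> complex" where
  "coeff_wrt n B q i = form n q (basis_tensor n B i)"

text \<open>
  Row \<open>a\<close> of the Hessian belongs to row \<open>i\<close> of the block row \<open>I\<close>, where
  \<open>(I, i) = hessian_positions n ! a\<close>; similarly for the columns.
\<close>

definition hessian_positions :: "nat list \<Rightarrow> (nat \<times> nat) list" where
  "hessian_positions n = concat (map (\<lambda>I. map (Pair I) [0..<n ! I - 1]) [0..<length n])"

fun hessian_entry :: "nat list \<Rightarrow> (nat list \<Rightarrow> complex) \<Rightarrow> nat \<times> nat \<Rightarrow> nat \<times> nat \<Rightarrow> complex" where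
  "hessian_entry n k (I, i) (J, j) =
     (if I = J then 0 else k ((replicate (length n) 0)[I := i + 1, J := j + 1]))"

definition hessian :: "nat list \<Rightarrow> (nat list \<Rightarrow> complex) \<Rightarrow> complex mat" where
  "hessian n k = mat (segre_dim n) (segre_dim n)
     (\<lambda>(a, b). hessian_entry n k (hessian_positions n ! a) (hessian_positions n ! b))"

definition stacked_hessian ::
  "nat list \<Rightarrow> (nat \<Rightarrow> complex mat) \<Rightarrow> nat \<Rightarrow> (nat \<Rightarrow> tensor) \<Rightarrow> complex mat" where
  "stacked_hessian n B l q = mat (segre_dim n) (l * segre_dim n)
     (\<lambda>(a, b). hessian n (coeff_wrt n B (q (b div segre_dim n))) $$ (a, b mod segre_dim n))"

end

theory Submission
  imports Defs
    "HOL-Computational_Algebra.Fundamental_Theorem_Algebra"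
    "HOL-Analysis.Continuum_Not_Denumerable"
begin

text \<open>
  The theorem has two parts. If one tensor that is generic over the integers has a unique
  decomposition into \<open>r\<close> rank-one tensors, then so does a general element of the secant variety.
  And the hypotheses, which concern one configuration of points, force this uniqueness.

  \<^emph>\<open>Uniqueness at a generic point.\<close> Let \<open>x\<close> be the sum of the rank-one tensors \<open>p k\<close> with algebraically
  independent factors \<open>t k\<close>, and also the sum of rank-one tensors \<open>p' k\<close> with factors \<open>b k\<close>. The derivations
  of the field of complex numbers take arbitrary values at the entries of \<open>t\<close>
  (\<open>generic_derivation\<close>), so the derivatives of \<open>x\<close> form the space \<open>H\<close> spanned by the tangent spaces at
  the \<open>p k\<close>. By the product rule they lie in the sum of the tangent spaces at the \<open>p' k\<close>. As \<open>H\<close> has the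
  expected dimension, it is the direct sum of the latter (\<open>nondefective_direct\<close>); this is
  Terracini's lemma in an algebraic form. Now take a derivation that sends \<open>x\<close> to \<open>p' k\<close>. It only
  rescales the factors of all \<open>b l\<close>, hence preserves \<open>H\<close>. Differentiating the tangent vectors at the
  \<open>p l\<close>, which are in \<open>H\<close>, shows that the derivatives of the factors \<open>t l\<close> are in the kernel of the
  Hessian at \<open>p l\<close>. This kernel is trivial up to rescalings, so every \<open>p l\<close> is mapped to a multiple of
  itself and \<open>p' k\<close> is a combination of the \<open>p l\<close> (\<open>tens_b_in_span\<close>). Only one coefficient is nonzero:
  if two were, then two tangent spaces at the \<open>p l\<close> would be contained, up to the span of the points,
  in the one at \<open>p' k\<close>, against the dimension of \<open>H\<close> (\<open>coefficients_single\<close>). Comparing both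
  expressions for \<open>x\<close> yields the permutation.

  \<^emph>\<open>From the given points to a generic point.\<close> The Segre variety has the expected tangent spaces
  (\<open>tangent_space_segre\<close>), the number of equations gives the dimension of their join
  (\<open>nondefective_of_equations\<close>), and the rank of the stacked Hessian gives the nondegeneracy at the
  first point (\<open>nondegenerate_of_stacked_hessian\<close>). Both are linear independence conditions on vectors
  with polynomial entries, so they persist at generic factors; permuting the points gives the
  nondegeneracy at all of them (\<open>generic_nondegenerate\<close>).

  \<^emph>\<open>From a generic point to a general point.\<close> Otherwise there are bad points outside of any finite
  set of hypersurfaces over the integers that do not contain the secant variety. They form a
  sequence which satisfies, modulo an ultrafilter, exactly the polynomial relations of the generic
  tensor. A back-and-forth argument
  (\<open>match_element\<close>) extends such a correspondence between complex numbers and classes of sequences by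
  further elements of either side. This lifts the decomposition of the generic tensor to the
  sequence, and it gives limits to two different decompositions of its members, which contradicts
  the uniqueness at the generic tensor (\<open>generically_identifiable_of_generic_point\<close>). It plays the
  role of elimination theory.
\<close>


section \<open>Subrings and polynomials over them\<close>

definition subring :: "'a::comm_ring_1 set \<Rightarrow> bool" where
  "subring R \<longleftrightarrow> 1 \<in> R \<and> (\<forall>x\<in>R. \<forall>y\<in>R. x - y \<in> R \<and> x * y \<in> R)"

definition polys_over :: "'a::comm_ring_1 set \<Rightarrow> 'a poly set" where
  "polys_over R = {p. \<forall>i. coeff p i \<in> R}"

definition adjoin :: "'a::comm_ring_1 set \<Rightarrow> 'a \<Rightarrow> 'a set" where
  "adjoin R z = (\<lambda>p. poly p z) ` polys_over R"

lemma subring_closed: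
  assumes "subring R"
  shows subring_one: "1 \<in> R" and subring_zero: "0 \<in> R"
    and subring_diff: "x \<in> R \<Longrightarrow> y \<in> R \<Longrightarrow> x - y \<in> R"
    and subring_mult: "x \<in> R \<Longrightarrow> y \<in> R \<Longrightarrow> x * y \<in> R"
    and subring_minus: "x \<in> R \<Longrightarrow> - x \<in> R"
    and subring_add: "x \<in> R \<Longrightarrow> y \<in> R \<Longrightarrow> x + y \<in> R"
proof -
  show 1: "1 \<in> R" and d: "\<And>x y. x \<in> R \<Longrightarrow> y \<in> R \<Longrightarrow> x - y \<in> R"
    and "x \<in> R \<Longrightarrow> y \<in> R \<Longrightarrow> x * y \<in> R"
    using assms by (auto simp: subring_def)
  show 0: "0 \<in> R" using d[OF 1 1] by simp
  show m: "- x \<in> R" if "x \<in> R" for x using d[OF 0 that] by simp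
  show "x + y \<in> R" if "x \<in> R" "y \<in> R" using d[OF that(1) m[OF that(2)]] by simp
qed

lemma subring_sum: "subring R \<Longrightarrow> (\<And>i. i \<in> A \<Longrightarrow> f i \<in> R) \<Longrightarrow> sum f A \<in> R"
  by (induct A rule: infinite_finite_induct) (auto intro: subring_zero subring_add)


lemma subring_power: "subring R \<Longrightarrow> x \<in> R \<Longrightarrow> x ^ k \<in> R"
  by (induct k) (auto intro: subring_one subring_mult)

lemma subring_of_nat: "subring R \<Longrightarrow> of_nat k \<in> R"
  by (induct k) (auto intro: subring_zero subring_one subring_add)

lemma subring_polys_over:
  assumes R: "subring R"
  shows "subring (polys_over R)"
  using R by (auto simp: subring_def polys_over_def coeff_1 coeff_mult subring_zero[OF R]
      intro!: subring_diff[OF R] subring_sum[OF R] subring_mult[OF R])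

lemma monom_polys_over: "subring R \<Longrightarrow> a \<in> R \<Longrightarrow> monom a k \<in> polys_over R"
  by (auto simp: polys_over_def intro: subring_zero)


lemma smult_polys_over: "subring R \<Longrightarrow> a \<in> R \<Longrightarrow> p \<in> polys_over R \<Longrightarrow> smult a p \<in> polys_over R"
  by (auto simp: polys_over_def intro: subring_mult)

lemma countable_polys_over:
  assumes "countable R"
  shows "countable (polys_over R)"
proof -
  have "coeffs ` polys_over R \<subseteq> lists R"
    by (auto simp: polys_over_def coeffs_def)
  then have "countable (coeffs ` polys_over R)"
    using assms by (meson countable_lists countable_subset)
  then show ?thesis
    by (rule countable_image_inj_on) (simp add: inj_on_def coeffs_eq_iff)
qed

lemma adjoin_extends:
  assumes R: "subring R"
  shows subring_adjoin: "subring (adjoin R z)" and subset_adjoin: "R \<subseteq> adjoin R z"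
    and generator_adjoin: "z \<in> adjoin R z"
proof -
  note P = subring_polys_over[OF R]
  have im: "poly p z \<in> adjoin R z" if "p \<in> polys_over R" for p
    using that by (auto simp: adjoin_def)
  show "subring (adjoin R z)"
    unfolding subring_def
  proof (intro conjI ballI)
    show "1 \<in> adjoin R z" using im[OF subring_one[OF P]] by simp
    fix x y assume "x \<in> adjoin R z" "y \<in> adjoin R z"
    then obtain p q where p: "p \<in> polys_over R" "x = poly p z" and q: "q \<in> polys_over R" "y = poly q z"
      by (auto simp: adjoin_def)
    show "x - y \<in> adjoin R z" using im[OF subring_diff[OF P p(1) q(1)]] p q by simp
    show "x * y \<in> adjoin R z" using im[OF subring_mult[OF P p(1) q(1)]] p q by simp
  qed
  show "R \<subseteq> adjoin R z"
  proof
    fix a assume "a \<in> R"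
    then show "a \<in> adjoin R z" using im[OF monom_polys_over[OF R, of a 0]] by (simp add: poly_monom)
  qed
  show "z \<in> adjoin R z"
    using im[OF monom_polys_over[OF R subring_one[OF R], of 1]] by (simp add: poly_monom)
qed

lemma countable_adjoin: "countable R \<Longrightarrow> countable (adjoin R z)"
  by (simp add: adjoin_def countable_polys_over)

text \<open>
  Division with remainder by a polynomial whose leading coefficient is not a unit becomes possible
  after multiplying with a power of that coefficient; quotient and remainder stay over the subring.
\<close>

lemma pseudo_division:
  assumes R: "subring R" and h: "h \<in> polys_over R" "degree h > 0" and g: "g \<in> polys_over R"
  obtains k q u where "q \<in> polys_over R" "u \<in> polys_over R"
    "smult (lead_coeff h ^ k) g = q * h + u" "degree u < degree h" "degree q \<le> degree g - degree h"
proof -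
  note P = subring_polys_over[OF R]
  let ?m = "degree h"
  let ?c = "lead_coeff h"
  have cR: "?c \<in> R" using h by (simp add: polys_over_def)
  have "\<exists>k q u. q \<in> polys_over R \<and> u \<in> polys_over R \<and> smult (?c ^ k) g = q * h + u \<and>
      degree u < ?m \<and> degree q \<le> degree g - ?m"
    using g
  proof (induct "degree g" arbitrary: g rule: less_induct)
    case less
    show ?case
    proof (cases "degree g < ?m")
      case True
      have "0 \<in> polys_over R" using subring_zero[OF P] .
      then show ?thesis using True less.prems
        by (intro exI[of _ 0] exI[of _ g] exI[of _ "0::nat"]) simp
    next
      case False
      let ?M = "monom (lead_coeff g) (degree g - ?m)"
      let ?g = "smult ?c g - ?M * h"
      have gR: "lead_coeff g \<in> R" using less.prems by (simp add: polys_over_def)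
      have M: "?M \<in> polys_over R" by (rule monom_polys_over[OF R gR])
      have gP: "?g \<in> polys_over R"
        by (intro subring_diff[OF P] smult_polys_over[OF R cR less.prems] subring_mult[OF P M h(1)])
      have "degree ?g \<le> degree g"
        using False degree_mult_le[of ?M h] degree_monom_le[of "lead_coeff g" "degree g - ?m"]
        by (intro degree_diff_le) (auto intro: order_trans[OF degree_smult_le])
      moreover have "coeff ?g (degree g) = 0"
        using False by (simp add: coeff_monom_mult)
      ultimately have dg: "degree ?g < degree g"
        using False h(2)
        by (metis (no_types, lifting) degree_0 leading_coeff_0_iff le_less less_le_trans not_less)
      from less.hyps[OF dg gP] obtain k q u where q: "q \<in> polys_over R" and u: "u \<in> polys_over R"
        and e: "smult (?c ^ k) ?g = q * h + u" and du: "degree u < ?m"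
        and dq: "degree q \<le> degree ?g - ?m" by blast
      let ?q = "q + smult (?c ^ k) ?M"
      have "smult (?c ^ Suc k) g = ?q * h + u"
        using e by (simp add: smult_diff_right algebra_simps)
      moreover have "?q \<in> polys_over R"
        by (intro subring_add[OF P q] smult_polys_over[OF R subring_power[OF R cR] M])
      moreover have "degree ?q \<le> degree g - ?m"
        using dq dg by (intro degree_add_le)
          (auto intro: order_trans[OF degree_smult_le] degree_monom_le)
      ultimately show ?thesis using u du by blast
    qed
  qed
  then show ?thesis using that by blast
qed


section \<open>Back and forth between prime quotients\<close>

definition prime_ideal :: "'a::comm_ring_1 set \<Rightarrow> bool" where
  "prime_ideal P \<longleftrightarrow> 0 \<in> P \<and> 1 \<notin> P \<and> (\<forall>x\<in>P. \<forall>y\<in>P. x - y \<in> P) \<and>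
     (\<forall>x y. x * y \<in> P \<longleftrightarrow> x \<in> P \<or> y \<in> P)"

lemma prime_idealD:
  assumes "prime_ideal P"
  shows "0 \<in> P" "1 \<notin> P" "x \<in> P \<Longrightarrow> y \<in> P \<Longrightarrow> x - y \<in> P" "x \<in> P \<Longrightarrow> y \<in> P \<Longrightarrow> x + y \<in> P"
    "x * y \<in> P \<longleftrightarrow> x \<in> P \<or> y \<in> P" "x ^ k \<in> P \<Longrightarrow> x \<in> P"
proof -
  show 0: "0 \<in> P" and 1: "1 \<notin> P" and d: "\<And>x y. x \<in> P \<Longrightarrow> y \<in> P \<Longrightarrow> x - y \<in> P"
    and m: "x * y \<in> P \<longleftrightarrow> x \<in> P \<or> y \<in> P" for x y
    using assms by (auto simp: prime_ideal_def)
  show "x + y \<in> P" if "x \<in> P" "y \<in> P" using d[OF that(1) d[OF 0 that(2)]] by simp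
  show "x ^ k \<in> P \<Longrightarrow> x \<in> P" by (induct k) (auto simp: 1 m)
qed

lemma prime_ideal_remainder:
  assumes "prime_ideal P" "a = b + u" "a \<in> P" "b \<in> P"
  shows "u \<in> P"
  using prime_idealD(3)[OF assms(1,3,4)] assms(2) by simp

lemma prime_ideal_sum: "prime_ideal P \<Longrightarrow> (\<And>i. i \<in> A \<Longrightarrow> f i \<in> P) \<Longrightarrow> sum f A \<in> P"
  by (induct A rule: infinite_finite_induct) (auto intro: prime_idealD)

lemma poly_in_prime_ideal:
  "prime_ideal P \<Longrightarrow> (\<And>i. coeff p i \<in> P) \<Longrightarrow> poly p z \<in> P"
  unfolding poly_altdef by (rule prime_ideal_sum) (simp_all add: prime_idealD)

text \<open>
  This plays the role of the minimal polynomial of \<open>z\<close> modulo \<open>P\<close>. If its leading coefficient were in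
  \<open>P\<close>, then dropping the leading term would give a relation of smaller degree.
\<close>

lemma minimal_relation:
  assumes R: "subring R" and P: "prime_ideal P"
    and ex: "h0 \<in> polys_over R" "coeff h0 i0 \<notin> P" "poly h0 z \<in> P"
  obtains h where "h \<in> polys_over R" "lead_coeff h \<notin> P" "poly h z \<in> P" "degree h > 0"
    "\<And>g. g \<in> polys_over R \<Longrightarrow> degree g < degree h \<Longrightarrow> poly g z \<in> P \<Longrightarrow> (\<forall>i. coeff g i \<in> P)"
proof -
  define Q where "Q = (\<lambda>h. h \<in> polys_over R \<and> (\<exists>i. coeff h i \<notin> P) \<and> poly h z \<in> P)"
  have "Q h0" using ex by (auto simp: Q_def)
  from ex_has_least_nat[of Q h0 degree, OF this] obtain h
    where h: "Q h" and min: "\<And>g. Q g \<Longrightarrow> degree h \<le> degree g" by blast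
  have hR: "h \<in> polys_over R" and hz: "poly h z \<in> P" using h by (auto simp: Q_def)
  obtain i where i: "coeff h i \<notin> P" using h by (auto simp: Q_def)
  have lc: "lead_coeff h \<notin> P"
  proof
    assume l: "lead_coeff h \<in> P"
    let ?g = "h - monom (lead_coeff h) (degree h)"
    have "h \<noteq> 0" using i prime_idealD(1)[OF P] by auto
    have "?g \<in> polys_over R"
      using hR by (intro subring_diff[OF subring_polys_over[OF R]] monom_polys_over[OF R])
        (auto simp: polys_over_def)
    moreover have "coeff ?g i \<notin> P"
      using i l by (cases "i = degree h") auto
    moreover have "poly ?g z \<in> P"
      using prime_idealD(3)[OF P hz, of "lead_coeff h * z ^ degree h"] l
      by (simp add: poly_monom prime_idealD(5)[OF P])
    ultimately have "Q ?g" unfolding Q_def by blast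
    moreover have "coeff ?g (degree h) = 0" by simp
    moreover have "degree ?g \<le> degree h" by (intro degree_diff_le) (auto simp: degree_monom_le)
    ultimately show False
      using min[of ?g] \<open>coeff ?g i \<notin> P\<close> prime_idealD(1)[OF P]
      by (metis (no_types, lifting) antisym coeff_0 leading_coeff_0_iff)
  qed
  have "degree h > 0"
  proof (rule ccontr)
    assume "\<not> degree h > 0"
    then obtain a where "h = [:a:]" by (metis degree_eq_zeroE gr0I)
    then show False using lc hz by simp
  qed
  then show ?thesis
    using that[OF hR lc hz] min by (fastforce simp: Q_def)
qed

text \<open>
  The step of a back-and-forth argument. Two prime ideals that agree on \<open>R\<close> give two fields
  containing the same domain. If the second field is algebraically closed and not exhausted by the
  roots of countably many polynomials, then any element of the first field is matched by an element
  of the second one that satisfies the same relations over \<open>R\<close>: a root of the same minimal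
  polynomial, or another transcendental element. The minimal polynomial need not stay irreducible a
  priori; it does, since a factor over \<open>R\<close> would be a relation of smaller degree.
\<close>

lemma match_element:
  fixes R :: "'a::comm_ring_1 set"
  assumes R: "subring R" "countable R" and P: "prime_ideal P" and Q: "prime_ideal Q"
    and agree: "\<And>s. s \<in> R \<Longrightarrow> s \<in> P \<longleftrightarrow> s \<in> Q"
    and alg_closed: "\<And>p. lead_coeff p \<notin> Q \<Longrightarrow> degree p > 0 \<Longrightarrow> \<exists>z. poly p z \<in> Q"
    and avoid: "\<And>G. countable G \<Longrightarrow> (\<And>p. p \<in> G \<Longrightarrow> \<exists>i. coeff p i \<notin> Q) \<Longrightarrow>
      \<exists>z. \<forall>p\<in>G. poly p z \<notin> Q"
  shows "\<exists>z. \<forall>p\<in>polys_over R. poly p y \<in> P \<longleftrightarrow> poly p z \<in> Q"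
proof (cases "\<exists>h i. h \<in> polys_over R \<and> coeff h i \<notin> P \<and> poly h y \<in> P")
  case True
  then obtain h0 i0 where "h0 \<in> polys_over R" "coeff h0 i0 \<notin> P" "poly h0 y \<in> P" by blast
  from minimal_relation[OF R(1) P this] obtain h where h: "h \<in> polys_over R" "lead_coeff h \<notin> P"
    "poly h y \<in> P" "degree h > 0" and hmin:
    "\<And>g. g \<in> polys_over R \<Longrightarrow> degree g < degree h \<Longrightarrow> poly g y \<in> P \<Longrightarrow> (\<forall>i. coeff g i \<in> P)"
    by blast
  have R': "coeff p i \<in> R" if "p \<in> polys_over R" for p i using that by (simp add: polys_over_def)
  have lcQ: "lead_coeff h \<notin> Q" using h(2) agree R'[OF h(1)] by blast
  obtain z where z: "poly h z \<in> Q" using alg_closed[OF lcQ h(4)] by blast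
  from minimal_relation[OF R(1) Q h(1) lcQ z] obtain f where f: "f \<in> polys_over R"
    "lead_coeff f \<notin> Q" "poly f z \<in> Q" "degree f > 0" and fmin:
    "\<And>g. g \<in> polys_over R \<Longrightarrow> degree g < degree f \<Longrightarrow> poly g z \<in> Q \<Longrightarrow> (\<forall>i. coeff g i \<in> Q)"
    by blast
  have lfP: "lead_coeff f \<notin> P" using f(2) agree R'[OF f(1)] by blast
  \<comment> \<open>The least degree of a relation is the same on both sides.\<close>
  have deg: "degree h \<le> degree f"
  proof (rule ccontr)
    assume lt: "\<not> degree h \<le> degree f"
    from pseudo_division[OF R(1) f(1,4) h(1)] obtain k q u where q: "q \<in> polys_over R"
      and u: "u \<in> polys_over R" and e: "smult (lead_coeff f ^ k) h = q * f + u"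
      and du: "degree u < degree f" and dq: "degree q \<le> degree h - degree f" .
    have ev: "lead_coeff f ^ k * poly h w = poly q w * poly f w + poly u w" for w
      using arg_cong[OF e, of "\<lambda>p. poly p w"] by simp
    have "poly u z \<in> Q"
      by (rule prime_ideal_remainder[OF Q ev]) (simp_all add: prime_idealD(5)[OF Q] z f(3))
    then have uQ: "\<forall>i. coeff u i \<in> Q" using fmin[OF u du] by blast
    then have uP: "\<forall>i. coeff u i \<in> P" using agree R'[OF u] by blast
    then have "poly u y \<in> P" by (auto intro: poly_in_prime_ideal[OF P])
    then have "poly q y * poly f y \<in> P"
      by (intro prime_ideal_remainder[OF P ev[unfolded add.commute[of "_ * _"]]])
        (simp_all add: prime_idealD(5)[OF P] h(3))
    moreover have "poly f y \<notin> P" using hmin[OF f(1)] lt lfP by auto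
    ultimately have "poly q y \<in> P" by (simp add: prime_idealD(5)[OF P])
    moreover have "degree q < degree h" using dq f(4) lt by linarith
    ultimately have "\<forall>i. coeff q i \<in> P" using hmin[OF q] by blast
    then have "coeff (q * f + u) i \<in> P" for i
      using uP by (auto simp: coeff_mult prime_idealD(5)[OF P]
          intro!: prime_idealD(4)[OF P] prime_ideal_sum[OF P])
    then have "coeff (smult (lead_coeff f ^ k) h) (degree h) \<in> P" by (simp only: e)
    then show False using h(2) lfP prime_idealD(6)[OF P]
      by (auto simp: prime_idealD(5)[OF P])
  qed
  show ?thesis
  proof (intro exI[of _ z] ballI)
    fix g assume g: "g \<in> polys_over R"
    from pseudo_division[OF R(1) h(1,4) g] obtain k q u where q: "q \<in> polys_over R"
      and u: "u \<in> polys_over R" and e: "smult (lead_coeff h ^ k) g = q * h + u"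
      and du: "degree u < degree h" by metis
    have ev: "lead_coeff h ^ k * poly g w = poly q w * poly h w + poly u w" for w
      using arg_cong[OF e, of "\<lambda>p. poly p w"] by simp
    show "poly g y \<in> P \<longleftrightarrow> poly g z \<in> Q"
    proof
      assume "poly g y \<in> P"
      then have "poly u y \<in> P"
        using prime_ideal_remainder[OF P ev] by (simp add: prime_idealD(5)[OF P] h(3))
      then have "\<forall>i. coeff u i \<in> Q" using hmin[OF u du] agree R'[OF u] by blast
      then have "poly u z \<in> Q" by (auto intro: poly_in_prime_ideal[OF Q])
      then have "lead_coeff h ^ k * poly g z \<in> Q"
        unfolding ev using z by (intro prime_idealD(4)[OF Q]) (auto simp: prime_idealD(5)[OF Q])
      then show "poly g z \<in> Q" using lcQ prime_idealD(6)[OF Q] by (auto simp: prime_idealD(5)[OF Q])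
    next
      assume "poly g z \<in> Q"
      then have "poly u z \<in> Q"
        using prime_ideal_remainder[OF Q ev] by (simp add: prime_idealD(5)[OF Q] z)
      then have "\<forall>i. coeff u i \<in> P" using fmin[OF u] du deg agree R'[OF u] by (meson less_le_trans)
      then have "poly u y \<in> P" by (auto intro: poly_in_prime_ideal[OF P])
      then have "lead_coeff h ^ k * poly g y \<in> P"
        unfolding ev using h(3) by (intro prime_idealD(4)[OF P]) (auto simp: prime_idealD(5)[OF P])
      then show "poly g y \<in> P" using h(2) prime_idealD(6)[OF P] by (auto simp: prime_idealD(5)[OF P])
    qed
  qed
next
  case False
  let ?G = "{p \<in> polys_over R. \<exists>i. coeff p i \<notin> P}"
  have R': "coeff p i \<in> R" if "p \<in> polys_over R" for p i using that by (simp add: polys_over_def)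
  have "countable ?G" using countable_polys_over[OF R(2)] by (rule countable_subset[rotated]) auto
  then have "\<exists>z. \<forall>p\<in>?G. poly p z \<notin> Q"
    by (rule avoid) (use agree R' in blast)
  then obtain z where z: "\<forall>p\<in>?G. poly p z \<notin> Q" by blast
  show ?thesis
  proof (intro exI[of _ z] ballI iffI)
    fix p assume p: "p \<in> polys_over R" and "poly p y \<in> P"
    then have "\<forall>i. coeff p i \<in> Q" using False agree R'[OF p] by blast
    then show "poly p z \<in> Q" by (auto intro: poly_in_prime_ideal[OF Q])
  next
    fix p assume p: "p \<in> polys_over R" and "poly p z \<in> Q"
    then have "\<forall>i. coeff p i \<in> P" using z by auto
    then show "poly p y \<in> P" by (auto intro: poly_in_prime_ideal[OF P])
  qed
qed



section \<open>Complex numbers and sequences modulo an ultrafilter\<close>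

lemma ultrafilter_exists:
  "\<exists>U::nat filter. U \<noteq> bot \<and> U \<le> sequentially \<and> (\<forall>P. eventually P U \<or> eventually (\<lambda>N. \<not> P N) U)"
proof -
  define good :: "nat set set \<Rightarrow> bool" where
    "good F \<longleftrightarrow> (\<forall>N. {N..} \<in> F) \<and> (\<forall>X\<in>F. \<forall>Y\<in>F. X \<inter> Y \<in> F) \<and> {} \<notin> F" for F
  have goodD: "{N..} \<in> F" "X \<in> F \<Longrightarrow> Y \<in> F \<Longrightarrow> X \<inter> Y \<in> F" "{} \<notin> F" if "good F" for F N X Y
    using that unfolding good_def by simp_all
  have "{M..} \<inter> {N..} = {max M N..}" for M N :: nat by auto
  then have "good (range atLeast)" unfolding good_def by auto
  then have ne: "Collect good \<noteq> {}" by blast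
  have "\<exists>M\<in>Collect good. \<forall>X\<in>Collect good. M \<subseteq> X \<longrightarrow> X = M"
  proof (rule subset_Zorn_nonempty[OF ne])
    fix C assume C: "C \<noteq> {}" "subset.chain (Collect good) C"
    have C': "good F" if "F \<in> C" for F using C(2) that by (auto simp: subset_chain_def)
    have "X \<inter> Y \<in> \<Union>C" if FG: "X \<in> F" "F \<in> C" "Y \<in> G" "G \<in> C" for X Y F G
    proof -
      have "F \<subseteq> G \<or> G \<subseteq> F" using C(2) FG by (auto simp: subset_chain_def)
      then show ?thesis
      proof
        assume "F \<subseteq> G"
        then have "X \<inter> Y \<in> G" using FG goodD(2)[OF C'[OF FG(4)]] by (simp add: subset_iff)
        then show ?thesis using FG(4) by (rule UnionI[rotated])
      next
        assume "G \<subseteq> F"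
        then have "X \<inter> Y \<in> F" using FG goodD(2)[OF C'[OF FG(2)]] by (simp add: subset_iff)
        then show ?thesis using FG(2) by (rule UnionI[rotated])
      qed
    qed
    moreover obtain F0 where "F0 \<in> C" using C(1) by auto
    ultimately show "\<Union>C \<in> Collect good"
      using goodD(1,3)[OF C'] unfolding good_def mem_Collect_eq by (intro conjI allI ballI) auto
  qed
  then obtain M where M: "good M" and max: "\<And>X. good X \<Longrightarrow> M \<subseteq> X \<Longrightarrow> X = M" by auto
  note MN = goodD(1)[OF M] and MI = goodD(2)[OF M] and M0 = goodD(3)[OF M]
  \<comment> \<open>A maximal family contains every set that meets all its members.\<close>
  have in_M: "X \<in> M" if X: "\<And>Y. Y \<in> M \<Longrightarrow> X \<inter> Y \<noteq> {}" for X
  proof -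
    let ?M = "M \<union> (\<inter>) X ` M"
    have "A \<inter> B \<in> ?M" if AB: "A \<in> ?M" "B \<in> ?M" for A B
    proof -
      obtain Y where Y: "Y \<in> M" "A = Y \<or> A = X \<inter> Y" using AB(1) by auto
      obtain Z where Z: "Z \<in> M" "B = Z \<or> B = X \<inter> Z" using AB(2) by auto
      have "A \<inter> B = Y \<inter> Z \<or> A \<inter> B = X \<inter> (Y \<inter> Z)" using Y(2) Z(2) by auto
      then show ?thesis using MI[OF Y(1) Z(1)] by auto
    qed
    moreover have "{} \<notin> ?M" using M0 X by auto
    moreover have "{N..} \<in> ?M" for N using MN by simp
    ultimately have "good ?M" unfolding good_def by (intro conjI allI ballI)
    then have "?M = M" by (rule max) simp
    moreover have "X \<inter> {0..} \<in> ?M" using MN[of 0] by (intro UnI2 imageI)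
    ultimately show ?thesis by (simp add: atLeast_0)
  qed
  have up: "Y \<in> M" if XY: "X \<in> M" "X \<subseteq> Y" for X Y
  proof (rule in_M)
    fix Z assume "Z \<in> M"
    then have "X \<inter> Z \<in> M" using XY(1) by (intro MI)
    then have "X \<inter> Z \<noteq> {}" using M0 by metis
    then show "Y \<inter> Z \<noteq> {}" using XY(2) by auto
  qed
  have compl: "X \<in> M \<or> - X \<in> M" for X
  proof (rule disjCI, rule in_M, rule notI)
    fix Y assume n: "- X \<notin> M" and Y: "Y \<in> M" and "X \<inter> Y = {}"
    then have "Y \<subseteq> - X" by auto
    then show False using up[OF Y] n by simp
  qed
  define U where "U = Abs_filter (\<lambda>P. {N. P N} \<in> M)"
  have ev: "eventually P U \<longleftrightarrow> {N. P N} \<in> M" for P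
    unfolding U_def
  proof (rule eventually_Abs_filter, rule is_filter.intro)
    show "{N. True} \<in> M" using MN[of 0] by (simp add: atLeast_0)
    show "{N. P N \<and> Q N} \<in> M" if "{N. P N} \<in> M" "{N. Q N} \<in> M" for P Q
      using MI[OF that] by (simp add: Collect_conj_eq)
    show "{N. Q N} \<in> M" if "\<forall>N. P N \<longrightarrow> Q N" "{N. P N} \<in> M" for P Q
      by (rule up[OF that(2)]) (use that(1) in auto)
  qed
  have "U \<noteq> bot" using M0 by (simp add: trivial_limit_def ev)
  moreover have "U \<le> sequentially"
  proof (rule filter_leI)
    fix P :: "nat \<Rightarrow> bool" assume "eventually P sequentially"
    then obtain N where "{N..} \<subseteq> {n. P n}" by (auto simp: eventually_sequentially)
    then show "eventually P U" using up[OF MN] by (simp add: ev)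
  qed
  moreover have "eventually P U \<or> eventually (\<lambda>N. \<not> P N) U" for P
    using compl[of "{N. P N}"] by (simp add: ev Collect_neg_eq)
  ultimately show ?thesis by (intro exI[of _ U] conjI allI)
qed

definition ultra :: "nat filter" where
  "ultra = (SOME U. U \<noteq> bot \<and> U \<le> sequentially \<and> (\<forall>P. eventually P U \<or> eventually (\<lambda>N. \<not> P N) U))"

lemma ultra: "ultra \<noteq> bot" "ultra \<le> sequentially"
  "eventually P ultra \<or> eventually (\<lambda>N. \<not> P N) ultra"
proof -
  have u: "ultra \<noteq> bot \<and> ultra \<le> sequentially \<and> (\<forall>P. eventually P ultra \<or> eventually (\<lambda>N. \<not> P N) ultra)"
    unfolding ultra_def by (rule someI_ex[OF ultrafilter_exists])
  show "ultra \<noteq> bot" by (rule conjunct1[OF u])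
  show "ultra \<le> sequentially" by (rule conjunct1[OF conjunct2[OF u]])
  show "eventually P ultra \<or> eventually (\<lambda>N. \<not> P N) ultra"
    by (rule spec[OF conjunct2[OF conjunct2[OF u]]])
qed

lemma not_eventually_ultra: "\<not> eventually P ultra \<longleftrightarrow> eventually (\<lambda>N. \<not> P N) ultra"
proof
  assume n: "eventually (\<lambda>N. \<not> P N) ultra"
  show "\<not> eventually P ultra"
  proof
    assume "eventually P ultra"
    with n have "eventually (\<lambda>_. False) ultra" by eventually_elim simp
    then show False using ultra(1) by simp
  qed
next
  assume "\<not> eventually P ultra"
  then show "eventually (\<lambda>N. \<not> P N) ultra" using ultra(3)[of P] by simp
qed

lemma eventually_ultra_ge: "eventually (\<lambda>N. N \<ge> M) ultra"
  using ultra(2) eventually_ge_at_top[of M] by (simp add: le_filter_def)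

text \<open>
  Two fields of values for elements of \<open>nat \<Rightarrow> complex\<close>: the complex number at index \<open>0\<close>, and the
  class of the sequence modulo the ultrafilter. In both cases the kernel is a prime ideal with an
  algebraically closed quotient in which countably many nonzero polynomials do not exhaust
  all elements.
\<close>

definition zero_limit :: "(nat \<Rightarrow> complex) set" where
  "zero_limit = {s. s 0 = 0}"

definition ultra_zero :: "(nat \<Rightarrow> complex) set" where
  "ultra_zero = {s. eventually (\<lambda>N. s N = 0) ultra}"

lemma prime_ideal_zero_limit: "prime_ideal zero_limit"
  by (auto simp: prime_ideal_def zero_limit_def)

lemma prime_ideal_ultra_zero: "prime_ideal ultra_zero"
  unfolding prime_ideal_def
proof (intro conjI ballI allI)
  show "0 \<in> ultra_zero" "1 \<notin> ultra_zero" using ultra(1) by (auto simp: ultra_zero_def)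
  fix x y assume "x \<in> ultra_zero" "y \<in> ultra_zero"
  then have "eventually (\<lambda>N. x N = 0) ultra" "eventually (\<lambda>N. y N = 0) ultra"
    by (simp_all add: ultra_zero_def)
  then have "eventually (\<lambda>N. (x - y) N = 0) ultra" by eventually_elim simp
  then show "x - y \<in> ultra_zero" by (simp add: ultra_zero_def)
next
  fix x y
  show "x * y \<in> ultra_zero \<longleftrightarrow> x \<in> ultra_zero \<or> y \<in> ultra_zero"
  proof
    assume xy: "x * y \<in> ultra_zero"
    show "x \<in> ultra_zero \<or> y \<in> ultra_zero"
    proof (rule disjCI)
      assume "y \<notin> ultra_zero"
      then have "eventually (\<lambda>N. y N \<noteq> 0) ultra" by (simp add: ultra_zero_def not_eventually_ultra)
      moreover have "eventually (\<lambda>N. (x * y) N = 0) ultra" using xy by (simp add: ultra_zero_def)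
      ultimately have "eventually (\<lambda>N. x N = 0) ultra" by eventually_elim simp
      then show "x \<in> ultra_zero" by (simp add: ultra_zero_def)
    qed
  next
    assume "x \<in> ultra_zero \<or> y \<in> ultra_zero"
    then have "eventually (\<lambda>N. x N = 0) ultra \<or> eventually (\<lambda>N. y N = 0) ultra"
      by (simp add: ultra_zero_def)
    then have "eventually (\<lambda>N. (x * y) N = 0) ultra"
    proof
      assume "eventually (\<lambda>N. x N = 0) ultra"
      then show ?thesis by eventually_elim simp
    next
      assume "eventually (\<lambda>N. y N = 0) ultra"
      then show ?thesis by eventually_elim simp
    qed
    then show "x * y \<in> ultra_zero" by (simp add: ultra_zero_def)
  qed
qed

lemma poly_pointwise: "poly p z N = poly (map_poly (\<lambda>c. c N) p) (z N)"
  by (induct p) (simp_all add: map_poly_pCons)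

lemma map_poly_pointwise_eq_0_iff: "map_poly (\<lambda>c. c N) p = 0 \<longleftrightarrow> (\<forall>i. coeff p i N = 0)"
  by (simp add: poly_eq_iff coeff_map_poly)

lemma degree_map_poly_pointwise:
  "lead_coeff p N \<noteq> 0 \<Longrightarrow> degree (map_poly (\<lambda>c. c N) p) = degree p"
  by (intro antisym map_poly_degree_leq le_degree) (simp add: coeff_map_poly)

lemma root_pointwise:
  fixes p :: "('i \<Rightarrow> complex) poly"
  assumes "degree p > 0"
  shows "\<exists>z. \<forall>N. lead_coeff p N \<noteq> 0 \<longrightarrow> poly p z N = 0"
proof -
  have "\<forall>N. \<exists>w. lead_coeff p N \<noteq> 0 \<longrightarrow> poly (map_poly (\<lambda>c. c N) p) w = 0"
    using assms alg_closed_imp_poly_has_root by (metis degree_map_poly_pointwise)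
  then obtain z where "\<forall>N. lead_coeff p N \<noteq> 0 \<longrightarrow> poly (map_poly (\<lambda>c. c N) p) (z N) = 0"
    by metis
  then show ?thesis by (auto simp: poly_pointwise)
qed

lemma avoid_roots_zero_limit:
  assumes "countable G" "\<And>p. p \<in> G \<Longrightarrow> \<exists>i. coeff p i \<notin> zero_limit"
  shows "\<exists>z. \<forall>p\<in>G. poly p z \<notin> zero_limit"
proof -
  let ?X = "\<Union>p\<in>G. {w. poly (map_poly (\<lambda>c. c 0) p) w = 0}"
  have "map_poly (\<lambda>c. c 0) p \<noteq> 0" if "p \<in> G" for p
    using assms(2)[OF that] by (simp add: map_poly_pointwise_eq_0_iff zero_limit_def)
  then have "countable ?X"
    using assms(1) poly_roots_finite by (intro countable_UN) (auto intro!: countable_finite)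
  then have "?X \<noteq> UNIV" using uncountable_UNIV_complex by auto
  then obtain w where "w \<notin> ?X" by blast
  then show ?thesis by (intro exI[of _ "\<lambda>_. w"]) (auto simp: zero_limit_def poly_pointwise)
qed

text \<open>
  The sequence avoids the roots of the first \<open>N\<close> polynomials at index \<open>N\<close>, as far as these
  polynomials are nonzero there.
\<close>

lemma avoid_roots_ultra_zero:
  assumes "countable G" "\<And>p. p \<in> G \<Longrightarrow> \<exists>i. coeff p i \<notin> ultra_zero"
  shows "\<exists>z. \<forall>p\<in>G. poly p z \<notin> ultra_zero"
proof -
  let ?p = "\<lambda>i N. map_poly (\<lambda>c. c N) (from_nat_into G i)"
  have "\<exists>w. \<forall>i\<le>N. ?p i N \<noteq> 0 \<longrightarrow> poly (?p i N) w \<noteq> 0" for N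
  proof -
    let ?X = "\<Union>i\<in>{i. i \<le> N \<and> ?p i N \<noteq> 0}. {w. poly (?p i N) w = 0}"
    have "finite ?X"
      by (rule finite_UN_I) (auto intro: poly_roots_finite)
    then have "?X \<noteq> UNIV" using infinite_UNIV_char_0[where 'a = complex] by metis
    then obtain w where "w \<notin> ?X" by blast
    then show ?thesis by auto
  qed
  then obtain z where z: "\<And>i N. i \<le> N \<Longrightarrow> ?p i N \<noteq> 0 \<Longrightarrow> poly (?p i N) (z N) \<noteq> 0" by metis
  have "poly p z \<notin> ultra_zero" if p: "p \<in> G" for p
  proof -
    obtain k where k: "from_nat_into G k = p"
      using from_nat_into_to_nat_on[OF assms(1) p] by blast
    obtain i where "coeff p i \<notin> ultra_zero" using assms(2) p by blast
    then have "eventually (\<lambda>N. coeff p i N \<noteq> 0) ultra" by (simp add: ultra_zero_def not_eventually_ultra)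
    then have "eventually (\<lambda>N. poly p z N \<noteq> 0) ultra"
      using eventually_ultra_ge[of k]
    proof eventually_elim
      case (elim N)
      then show ?case
        using z[of k N] by (auto simp: k poly_pointwise map_poly_pointwise_eq_0_iff)
    qed
    then show ?thesis by (simp add: ultra_zero_def not_eventually_ultra)
  qed
  then show ?thesis by blast
qed

text \<open>
  In a matched ring the sequences satisfy, for almost all indices, exactly the same polynomial
  relations as their values at index \<open>0\<close>: the value at \<open>0\<close> is a generic limit of the sequence.
\<close>

definition matched :: "(nat \<Rightarrow> complex) set \<Rightarrow> bool" where
  "matched R \<longleftrightarrow> subring R \<and> countable R \<and>
     (\<forall>s\<in>R. s 0 = 0 \<longleftrightarrow> eventually (\<lambda>N. s N = 0) ultra)"

lemma matched_adjoin:
  assumes R: "matched R" and eq: "\<forall>p\<in>polys_over R. poly p y \<in> zero_limit \<longleftrightarrow> poly p z \<in> ultra_zero"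
    and x: "x 0 = y 0" "\<forall>N>0. x N = z N"
  shows "matched (adjoin R x)"
proof -
  have R': "subring R" "countable R" using R by (auto simp: matched_def)
  have "poly p x 0 = 0 \<longleftrightarrow> eventually (\<lambda>N. poly p x N = 0) ultra" if "p \<in> polys_over R" for p
  proof -
    have "poly p x 0 = poly p y 0" by (simp add: poly_pointwise x)
    moreover have "eventually (\<lambda>N. poly p x N = 0) ultra \<longleftrightarrow> eventually (\<lambda>N. poly p z N = 0) ultra"
    proof (rule eventually_cong)
      show "eventually (\<lambda>N. poly p x N = poly p z N) ultra"
        using eventually_ultra_ge[of 1] by eventually_elim (simp add: poly_pointwise x(2))
    qed simp
    ultimately show ?thesis using eq that by (auto simp: zero_limit_def ultra_zero_def)
  qed
  then show ?thesis
    using R' subring_adjoin[OF R'(1)] countable_adjoin[OF R'(2)] unfolding matched_def by (auto simp: adjoin_def)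
qed

text \<open>
  Matching from the limit to the sequences: a complex number is the limit of a sequence, for given
  relations. The other direction, \<open>matched_limit_value\<close>, supplies a limit for a given sequence.
\<close>

lemma matched_lift_value:
  assumes R: "matched R"
  shows "\<exists>x. x 0 = b \<and> matched (adjoin R x)"
proof -
  have "\<exists>z. \<forall>p\<in>polys_over R. poly p (\<lambda>_. b) \<in> zero_limit \<longleftrightarrow> poly p z \<in> ultra_zero"
  proof (rule match_element[OF _ _ prime_ideal_zero_limit prime_ideal_ultra_zero])
    show "subring R" "countable R" using R by (simp_all add: matched_def)
    show "s \<in> zero_limit \<longleftrightarrow> s \<in> ultra_zero" if "s \<in> R" for s
      using R that by (simp add: matched_def zero_limit_def ultra_zero_def)
    show "\<exists>z. \<forall>p\<in>G. poly p z \<notin> ultra_zero" if "countable G" "\<And>p. p \<in> G \<Longrightarrow> \<exists>i. coeff p i \<notin> ultra_zero" for G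
      using that by (rule avoid_roots_ultra_zero)
    show "\<exists>z. poly p z \<in> ultra_zero" if p: "lead_coeff p \<notin> ultra_zero" "degree p > 0" for p
    proof -
      obtain z where z: "\<And>N. lead_coeff p N \<noteq> 0 \<Longrightarrow> poly p z N = 0" using root_pointwise[OF p(2)] by blast
      have "eventually (\<lambda>N. lead_coeff p N \<noteq> 0) ultra"
        using p(1) by (simp add: ultra_zero_def not_eventually_ultra)
      then have "eventually (\<lambda>N. poly p z N = 0) ultra" by eventually_elim (simp add: z)
      then show ?thesis by (auto simp: ultra_zero_def)
    qed
  qed
  then obtain z where "\<forall>p\<in>polys_over R. poly p (\<lambda>_. b) \<in> zero_limit \<longleftrightarrow> poly p z \<in> ultra_zero" ..
  from matched_adjoin[OF R this, of "z(0 := b)"] show ?thesis by (intro exI[of _ "z(0 := b)"]) simp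
qed

lemma matched_limit_value:
  assumes R: "matched R"
  shows "\<exists>x. (\<forall>N>0. x N = y N) \<and> matched (adjoin R x)"
proof -
  have "\<exists>z. \<forall>p\<in>polys_over R. poly p y \<in> ultra_zero \<longleftrightarrow> poly p z \<in> zero_limit"
  proof (rule match_element[OF _ _ prime_ideal_ultra_zero prime_ideal_zero_limit])
    show "subring R" "countable R" using R by (simp_all add: matched_def)
    show "s \<in> ultra_zero \<longleftrightarrow> s \<in> zero_limit" if "s \<in> R" for s
      using R that by (simp add: matched_def zero_limit_def ultra_zero_def)
    show "\<exists>z. \<forall>p\<in>G. poly p z \<notin> zero_limit" if "countable G" "\<And>p. p \<in> G \<Longrightarrow> \<exists>i. coeff p i \<notin> zero_limit" for G
      using that by (rule avoid_roots_zero_limit)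
    show "\<exists>z. poly p z \<in> zero_limit" if p: "lead_coeff p \<notin> zero_limit" "degree p > 0" for p
      using root_pointwise[OF p(2)] p(1) by (auto simp: zero_limit_def)
  qed
  then obtain z where "\<forall>p\<in>polys_over R. poly p y \<in> ultra_zero \<longleftrightarrow> poly p z \<in> zero_limit" ..
  with matched_adjoin[OF R, of z y "y(0 := z 0)"] show ?thesis
    by (intro exI[of _ "y(0 := z 0)"]) simp
qed

lemma matched_lift:
  assumes "finite V" "matched R"
  shows "\<exists>X S. (\<forall>v\<in>V. X v 0 = b v \<and> X v \<in> S) \<and> R \<subseteq> S \<and> matched S"
  using assms
proof (induct V)
  case empty
  then show ?case by blast
next
  case (insert u V)
  then obtain X S where XS: "\<forall>v\<in>V. X v 0 = b v \<and> X v \<in> S" "R \<subseteq> S" "matched S" by blast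
  obtain x where x: "x 0 = b u" "matched (adjoin S x)" using matched_lift_value[OF XS(3)] by blast
  have "S \<subseteq> adjoin S x" "x \<in> adjoin S x"
    using XS(3) by (auto simp: matched_def subset_adjoin generator_adjoin)
  then show ?case using XS x insert(2)
    by (intro exI[of _ "X(u := x)"] exI[of _ "adjoin S x"]) auto
qed

lemma matched_limit:
  assumes "finite V" "matched R"
  shows "\<exists>X S. (\<forall>v\<in>V. (\<forall>N>0. X v N = Y v N) \<and> X v \<in> S) \<and> R \<subseteq> S \<and> matched S"
  using assms
proof (induct V)
  case empty
  then show ?case by blast
next
  case (insert u V)
  then obtain X S where XS: "\<forall>v\<in>V. (\<forall>N>0. X v N = Y v N) \<and> X v \<in> S" "R \<subseteq> S" "matched S" by blast
  obtain x where x: "\<forall>N>0. x N = Y u N" "matched (adjoin S x)" using matched_limit_value[OF XS(3)] by blast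
  have "S \<subseteq> adjoin S x" "x \<in> adjoin S x"
    using XS(3) by (auto simp: matched_def subset_adjoin generator_adjoin)
  then show ?case using XS x insert(2)
    by (intro exI[of _ "X(u := x)"] exI[of _ "adjoin S x"]) auto
qed


section \<open>Polynomial functions\<close>

inductive_set polys :: "complex set \<Rightarrow> 'v set \<Rightarrow> (('v \<Rightarrow> complex) \<Rightarrow> complex) set" for K V where
  const: "c \<in> K \<Longrightarrow> (\<lambda>s. c) \<in> polys K V"
| var: "v \<in> V \<Longrightarrow> (\<lambda>s. s v) \<in> polys K V"
| add: "f \<in> polys K V \<Longrightarrow> g \<in> polys K V \<Longrightarrow> (\<lambda>s. f s + g s) \<in> polys K V"
| mult: "f \<in> polys K V \<Longrightarrow> g \<in> polys K V \<Longrightarrow> (\<lambda>s. f s * g s) \<in> polys K V"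

lemma subring_polys:
  assumes K: "subring K"
  shows "subring (polys K V)"
proof -
  have "f - g \<in> polys K V" if "f \<in> polys K V" "g \<in> polys K V" for f g
    using polys.add[OF that(1) polys.mult[OF polys.const[OF subring_minus[OF K subring_one[OF K]]] that(2)]]
    by (simp add: fun_diff_def)
  then show ?thesis
    using polys.const[OF subring_one[OF K]]
    by (auto simp: subring_def one_fun_def times_fun_def polys.mult)
qed

lemma subring_UNIV: "subring UNIV"
  by (simp add: subring_def)

lemma polys_sum: "subring K \<Longrightarrow> (\<And>i. i \<in> A \<Longrightarrow> f i \<in> polys K V) \<Longrightarrow> (\<lambda>s. \<Sum>i\<in>A. f i s) \<in> polys K V"
  by (induct A rule: infinite_finite_induct) (auto intro: polys.intros subring_zero)

lemma polys_prod: "subring K \<Longrightarrow> (\<And>i. i \<in> A \<Longrightarrow> f i \<in> polys K V) \<Longrightarrow> (\<lambda>s. \<Prod>i\<in>A. f i s) \<in> polys K V"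
  by (induct A rule: infinite_finite_induct) (auto intro: polys.intros subring_one)

lemma polys_diff: "subring K \<Longrightarrow> f \<in> polys K V \<Longrightarrow> g \<in> polys K V \<Longrightarrow> (\<lambda>s. f s - g s) \<in> polys K V"
  using subring_diff[OF subring_polys, of K f V g] by (simp add: fun_diff_def)

lemma polys_mono: "f \<in> polys K V \<Longrightarrow> K \<subseteq> L \<Longrightarrow> V \<subseteq> W \<Longrightarrow> f \<in> polys L W"
  by (induct rule: polys.induct) (auto intro: polys.intros)

lemma polys_compose:
  "g \<in> polys K V \<Longrightarrow> (\<And>v. v \<in> V \<Longrightarrow> h v \<in> polys K W) \<Longrightarrow> (\<lambda>s. g (\<lambda>v. h v s)) \<in> polys K W"
  by (induct rule: polys.induct) (auto intro: polys.intros)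

lemma polys_cong: "g \<in> polys K V \<Longrightarrow> (\<And>v. v \<in> V \<Longrightarrow> s v = s' v) \<Longrightarrow> g s = g s'"
  by (induct rule: polys.induct) auto

datatype 'v pexp = Cst nat | Var 'v | Add "'v pexp" "'v pexp" | Mul "'v pexp" "'v pexp"

instance pexp :: (countable) countable
  by countable_datatype

lemma countable_polys:
  fixes V :: "'v::countable set"
  assumes K: "countable K" "K \<noteq> {}"
  shows "countable (polys K V)"
proof -
  define ev where "ev = rec_pexp (\<lambda>k (s::'v \<Rightarrow> complex). from_nat_into K k) (\<lambda>v s. s v)
    (\<lambda>_ _ f g s. f s + g s) (\<lambda>_ _ f g s. f s * g s)"
  have ev: "ev (Cst k) = (\<lambda>s. from_nat_into K k)" "ev (Var v) = (\<lambda>s. s v)"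
    "ev (Add a b) = (\<lambda>s. ev a s + ev b s)" "ev (Mul a b) = (\<lambda>s. ev a s * ev b s)" for k v a b
    by (simp_all add: ev_def)
  have "f \<in> range ev" if "f \<in> polys K V" for f
    using that
  proof (induct rule: polys.induct)
    case (const c)
    then show ?case by (intro image_eqI[of _ _ "Cst (to_nat_on K c)"]) (simp_all add: ev K)
  next
    case (var v)
    show ?case by (intro image_eqI[of _ _ "Var v"]) (simp_all add: ev)
  next
    case (add f g)
    then obtain a b where "f = ev a" "g = ev b" by auto
    then show ?case by (intro image_eqI[of _ _ "Add a b"]) (simp_all add: ev)
  next
    case (mult f g)
    then obtain a b where "f = ev a" "g = ev b" by auto
    then show ?case by (intro image_eqI[of _ _ "Mul a b"]) (simp_all add: ev)
  qed
  then have "polys K V \<subseteq> range ev" by blast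
  then show ?thesis by (rule countable_subset) simp
qed

lemma poly_on_line:
  "g \<in> polys K V \<Longrightarrow> \<exists>p. \<forall>c. g (\<lambda>v. s v + c * u v) = poly p c"
proof (induct rule: polys.induct)
  case (const a)
  then show ?case by (intro exI[of _ "[:a:]"]) simp
next
  case (var v)
  then show ?case by (intro exI[of _ "[:s v, u v:]"]) simp
next
  case (add f g)
  then obtain p q where "\<forall>c. f (\<lambda>v. s v + c * u v) = poly p c" "\<forall>c. g (\<lambda>v. s v + c * u v) = poly q c"
    by blast
  then show ?case by (intro exI[of _ "p + q"]) simp
next
  case (mult f g)
  then obtain p q where "\<forall>c. f (\<lambda>v. s v + c * u v) = poly p c" "\<forall>c. g (\<lambda>v. s v + c * u v) = poly q c"
    by blast
  then show ?case by (intro exI[of _ "p * q"]) simp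
qed

text \<open>On the line through \<open>s\<close> and \<open>t\<close>, both functions are nonzero polynomials in one variable.\<close>

lemma polys_no_zero_divisors:
  assumes f: "f \<in> polys K V" "f s \<noteq> 0" and g: "g \<in> polys L W" "g t \<noteq> 0"
  shows "\<exists>x. f x * g x \<noteq> 0"
proof (rule ccontr)
  assume zero: "\<nexists>x. f x * g x \<noteq> 0"
  let ?x = "\<lambda>c v. s v + c * (t v - s v)"
  obtain p where p: "f (?x c) = poly p c" for c using poly_on_line[OF f(1)] by metis
  obtain q where q: "g (?x c) = poly q c" for c using poly_on_line[OF g(1)] by metis
  have "poly (p * q) c = 0" for c using zero p q by (metis poly_mult)
  then have "p * q = 0" by (intro iffD1[OF poly_eq_poly_eq_iff] ext) simp
  moreover have "poly p 0 \<noteq> 0" using p[of 0] f by simp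
  moreover have "poly q 1 \<noteq> 0" using q[of 1] g by simp
  ultimately show False by (metis mult_eq_0_iff poly_0)
qed

lemma prod_polys_nonzero:
  assumes "finite A" "\<And>i. i \<in> A \<Longrightarrow> f i \<in> polys K V \<and> (\<exists>s. f i s \<noteq> 0)"
  shows "\<exists>s. (\<Prod>i\<in>A. f i s) \<noteq> 0"
  using assms
proof (induct A)
  case empty
  then show ?case by simp
next
  case (insert i A)
  have "f j \<in> polys UNIV UNIV" if "j \<in> A" for j
    by (rule polys_mono[of _ K V]) (use insert.prems[of j] that in auto)
  then have "(\<lambda>s. \<Prod>i\<in>A. f i s) \<in> polys UNIV UNIV"
    by (rule polys_prod[OF subring_UNIV])
  then show ?case
    using insert polys_no_zero_divisors[of "f i" K V _ "\<lambda>s. \<Prod>i\<in>A. f i s" UNIV UNIV] by auto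
qed

lemma polys_insert:
  assumes K: "subring K" and g: "g \<in> polys K (insert v V)"
  shows "g \<in> adjoin (polys K V) (\<lambda>s. s v)"
proof -
  note P = subring_polys[OF K, of V]
  note A = subring_adjoin[OF P, of "\<lambda>s. s v"] subset_adjoin[OF P, of "\<lambda>s. s v"]
    generator_adjoin[OF P, of "\<lambda>s. s v"]
  show ?thesis
    using g
  proof (induct rule: polys.induct)
    case (add f g)
    then show ?case using subring_add[OF A(1), of f g] by (simp add: plus_fun_def)
  next
    case (mult f g)
    then show ?case using subring_mult[OF A(1), of f g] by (simp add: times_fun_def)
  next
    case (const c)
    then show ?case using A(2) polys.const[of c K V] by blast
  next
    case (var u)
    then show ?case using A(2,3) polys.var[of u V K] by blast
  qed
qed

text \<open>
  Countably many nonzero polynomials have a common non-root: one coordinate at a time, since a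
  nonzero polynomial in one variable has finitely many roots.
\<close>

lemma generic_point_exists:
  assumes "finite V" "countable G" "\<And>g. g \<in> G \<Longrightarrow> g \<in> polys UNIV V \<and> (\<exists>s. g s \<noteq> 0)"
  shows "\<exists>t. \<forall>g\<in>G. g t \<noteq> 0"
  using assms
proof (induct V arbitrary: G)
  case empty
  have "g s = g t" if "g \<in> polys UNIV {}" for g :: "('a \<Rightarrow> complex) \<Rightarrow> complex" and s t
    using polys_cong[OF that] by blast
  then show ?case using empty by (metis (no_types))
next
  case (insert v V)
  have "\<exists>p i. p \<in> polys_over (polys UNIV V) \<and> g = poly p (\<lambda>s. s v) \<and> (\<exists>s. coeff p i s \<noteq> 0)"
    if "g \<in> G" for g
  proof -
    have g: "g \<in> polys UNIV (insert v V)" "\<exists>s. g s \<noteq> 0" using insert.prems(2)[OF that] by auto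
    obtain p where p: "p \<in> polys_over (polys UNIV V)" "g = poly p (\<lambda>s. s v)"
      using polys_insert[OF subring_UNIV g(1)] by (auto simp: adjoin_def)
    have "\<exists>i s. coeff p i s \<noteq> 0"
    proof (rule ccontr)
      assume "\<nexists>i s. coeff p i s \<noteq> 0"
      then have "p = 0" by (auto simp: poly_eq_iff fun_eq_iff)
      then show False using p g(2) by simp
    qed
    then show ?thesis using p by blast
  qed
  then obtain p i where p: "\<And>g. g \<in> G \<Longrightarrow> p g \<in> polys_over (polys UNIV V)"
    "\<And>g. g \<in> G \<Longrightarrow> g = poly (p g) (\<lambda>s. s v)" "\<And>g. g \<in> G \<Longrightarrow> \<exists>s. coeff (p g) (i g) s \<noteq> 0"
    by metis
  have "\<exists>t. \<forall>h\<in>(\<lambda>g. coeff (p g) (i g)) ` G. h t \<noteq> 0"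
    using insert.prems(1) p(1,3) by (intro insert.hyps(3)) (auto simp: polys_over_def)
  then obtain t where t: "\<And>g. g \<in> G \<Longrightarrow> coeff (p g) (i g) t \<noteq> 0" by blast
  let ?q = "\<lambda>g. map_poly (\<lambda>c. c t) (p g)"
  let ?X = "\<Union>g\<in>G. {w. poly (?q g) w = 0}"
  have "?q g \<noteq> 0" if "g \<in> G" for g
    using t[OF that] map_poly_pointwise_eq_0_iff[of t "p g"] by auto
  then have "countable ?X"
    using insert.prems(1) poly_roots_finite by (intro countable_UN) (auto intro!: countable_finite)
  then have "?X \<noteq> UNIV" using uncountable_UNIV_complex by auto
  then obtain w where w: "w \<notin> ?X" by blast
  have "g (t(v := w)) \<noteq> 0" if g: "g \<in> G" for g
  proof -
    have "coeff (p g) j (t(v := w)) = coeff (p g) j t" for j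
      by (rule polys_cong[of _ UNIV V]) (use p(1)[OF g] insert.hyps(2) in \<open>auto simp: polys_over_def\<close>)
    then have "map_poly (\<lambda>c. c (t(v := w))) (p g) = ?q g"
      by (simp add: poly_eq_iff coeff_map_poly)
    then have "g (t(v := w)) = poly (?q g) w"
      using p(2)[OF g] poly_pointwise[of "p g" "\<lambda>s. s v" "t(v := w)"] by (metis fun_upd_same)
    then show ?thesis using w g by auto
  qed
  then show ?case by blast
qed

text \<open>The homogeneous components of \<open>g\<close> are the coefficients of \<open>g (c s)\<close> as a polynomial in \<open>c\<close>.\<close>

lemma homogeneous_components:
  assumes K: "subring K" and g: "g \<in> polys K V"
  obtains m h where "\<And>j. h j \<in> polys K V" "\<And>j c s. h j (\<lambda>v. c * s v) = c ^ j * h j s"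
    "\<And>c s. g (\<lambda>v. c * s v) = (\<Sum>j\<le>m. h j s * c ^ j)"
proof -
  note P = subring_polys_over[OF subring_polys[OF K, of V]]
  have "\<exists>p\<in>polys_over (polys K V). \<forall>c s. g (\<lambda>v. c * s v) = poly p (\<lambda>_. c) s"
    using g
  proof (induct rule: polys.induct)
    case (const a)
    then show ?case
      using monom_polys_over[OF subring_polys[OF K] polys.const[OF const], of 0]
      by (intro bexI[of _ "monom (\<lambda>_. a) 0"]) (auto simp: poly_monom)
  next
    case (var v)
    then show ?case
      using monom_polys_over[OF subring_polys[OF K] polys.var[OF var], of 1]
      by (intro bexI[of _ "monom (\<lambda>s. s v) 1"]) (auto simp: poly_monom mult.commute)
  next
    case (add f g)
    then obtain p q where "p \<in> polys_over (polys K V)" "q \<in> polys_over (polys K V)"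
      "\<forall>c s. f (\<lambda>v. c * s v) = poly p (\<lambda>_. c) s" "\<forall>c s. g (\<lambda>v. c * s v) = poly q (\<lambda>_. c) s" by blast
    then show ?case by (intro bexI[of _ "p + q"] subring_add[OF P]) auto
  next
    case (mult f g)
    then obtain p q where "p \<in> polys_over (polys K V)" "q \<in> polys_over (polys K V)"
      "\<forall>c s. f (\<lambda>v. c * s v) = poly p (\<lambda>_. c) s" "\<forall>c s. g (\<lambda>v. c * s v) = poly q (\<lambda>_. c) s" by blast
    then show ?case by (intro bexI[of _ "p * q"] subring_mult[OF P]) auto
  qed
  then obtain p where p: "p \<in> polys_over (polys K V)"
    and gp: "g (\<lambda>v. c * s v) = poly (map_poly (\<lambda>h. h s) p) c" for c s
    by (auto simp: poly_pointwise)
  show ?thesis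
  proof
    show "coeff p j \<in> polys K V" for j using p by (simp add: polys_over_def)
    show "coeff p j (\<lambda>v. c * s v) = c ^ j * coeff p j s" for j c s
    proof -
      have "poly (map_poly (\<lambda>h. h (\<lambda>v. c * s v)) p) a = poly (pcompose (map_poly (\<lambda>h. h s) p) [:0, c:]) a" for a
        unfolding gp[symmetric] poly_pcompose by (simp add: gp[symmetric] mult_ac)
      then have "map_poly (\<lambda>h. h (\<lambda>v. c * s v)) p = pcompose (map_poly (\<lambda>h. h s) p) [:0, c:]"
        by (intro iffD1[OF poly_eq_poly_eq_iff] ext)
      from arg_cong[OF this, of "\<lambda>q. coeff q j"] show ?thesis
        by (simp add: coeff_pcompose_linear coeff_map_poly)
    qed
    show "g (\<lambda>v. c * s v) = (\<Sum>j\<le>degree p. coeff p j s * c ^ j)" for c s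
    proof -
      have "poly (map_poly (\<lambda>h. h s) p) c = (\<Sum>j\<le>degree p. coeff (map_poly (\<lambda>h. h s) p) j * c ^ j)"
        unfolding poly_altdef
        by (rule sum.mono_neutral_left) (auto simp: map_poly_degree_leq coeff_eq_0)
      then show ?thesis by (simp add: gp coeff_map_poly)
    qed
  qed
qed



section \<open>Derivations of the complex numbers\<close>

definition derivation :: "(complex \<Rightarrow> complex) \<Rightarrow> bool" where
  "derivation \<delta> \<longleftrightarrow> (\<forall>x y. \<delta> (x + y) = \<delta> x + \<delta> y) \<and> (\<forall>x y. \<delta> (x * y) = x * \<delta> y + \<delta> x * y)"

lemma derivation_rules:
  assumes "derivation \<delta>"
  shows derivation_add: "\<delta> (x + y) = \<delta> x + \<delta> y"
    and derivation_mult: "\<delta> (x * y) = x * \<delta> y + \<delta> x * y"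
    and derivation_0: "\<delta> 0 = 0" and derivation_1: "\<delta> 1 = 0"
proof -
  show a: "\<delta> (x + y) = \<delta> x + \<delta> y" and m: "\<delta> (x * y) = x * \<delta> y + \<delta> x * y" for x y
    using assms by (auto simp: derivation_def)
  show "\<delta> 0 = 0" using a[of 0 0] by simp
  show "\<delta> 1 = 0" using m[of 1 1] by simp
qed

lemma derivation_sum: "derivation \<delta> \<Longrightarrow> \<delta> (\<Sum>i\<in>A. f i) = (\<Sum>i\<in>A. \<delta> (f i))"
  by (induct A rule: infinite_finite_induct) (simp_all add: derivation_rules)

lemma derivation_prod:
  assumes \<delta>: "derivation \<delta>" and A: "finite A"
  shows "\<delta> (\<Prod>i\<in>A. f i) = (\<Sum>j\<in>A. \<Prod>i\<in>A. if i = j then \<delta> (f i) else f i)"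
  using A
proof (induct A)
  case empty
  then show ?case by (simp add: derivation_rules[OF \<delta>])
next
  case (insert a A)
  have "(\<Prod>i\<in>A. if i = a then \<delta> (f i) else f i) = (\<Prod>i\<in>A. f i)"
    using insert(2) by (intro prod.cong) auto
  moreover have "(\<Sum>j\<in>A. (if a = j then \<delta> (f a) else f a) * (\<Prod>i\<in>A. if i = j then \<delta> (f i) else f i)) =
      f a * (\<Sum>j\<in>A. \<Prod>i\<in>A. if i = j then \<delta> (f i) else f i)"
    unfolding sum_distrib_left using insert(2) by (intro sum.cong) auto
  ultimately show ?case using insert by (simp add: derivation_mult[OF \<delta>])
qed

text \<open>
  A derivation on a subring is a ring of dual numbers \<open>x + \<epsilon> u\<close> in which \<open>x\<close> determines \<open>u\<close>.
\<close>

datatype dual = Dual (std: complex) (eps: complex)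

instantiation dual :: comm_ring_1
begin

definition "0 = Dual 0 0"
definition "1 = Dual 1 0"
definition "x + y = Dual (std x + std y) (eps x + eps y)"
definition "x - y = Dual (std x - std y) (eps x - eps y)"
definition "- x = Dual (- std x) (- eps x)"
definition "x * y = Dual (std x * std y) (std x * eps y + eps x * std y)"

instance
  by standard (auto simp: zero_dual_def one_dual_def plus_dual_def minus_dual_def uminus_dual_def
      times_dual_def algebra_simps)

end

lemma dual_simps [simp]:
  "std 0 = 0" "eps 0 = 0" "std 1 = 1" "eps 1 = 0" "std (x + y) = std x + std y"
  "eps (x + y) = eps x + eps y" "std (x - y) = std x - std y" "eps (x - y) = eps x - eps y"
  "std (x * y) = std x * std y" "eps (x * y) = std x * eps y + eps x * std y"
  by (simp_all add: zero_dual_def one_dual_def plus_dual_def minus_dual_def times_dual_def)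

lemma std_poly: "std (poly p z) = poly (map_poly std p) (std z)"
  by (induct p) (simp_all add: map_poly_pCons)

lemma std_power: "std (x ^ k) = std x ^ k"
  by (induct k) simp_all

lemma std_of_nat: "std (of_nat k) = of_nat k"
  by (induct k) simp_all

text \<open>Taylor expansion to first order.\<close>

lemma poly_Dual_eps:
  "poly p (Dual b d) = poly p (Dual b 0) + Dual 0 (d * poly (pderiv (map_poly std p)) b)"
proof (induct p)
  case 0
  then show ?case by (simp add: zero_dual_def plus_dual_def)
next
  case (pCons a p)
  have "poly (map_poly std p) b = std (poly p (Dual b 0))" by (simp add: std_poly)
  with pCons show ?case
    by (simp add: map_poly_pCons pderiv_pCons plus_dual_def times_dual_def algebra_simps)
qed

lemma dual_eqI: "std x = std y \<Longrightarrow> eps x = eps y \<Longrightarrow> x = y"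
  by (cases x; cases y) simp

definition partial_derivation :: "dual set \<Rightarrow> bool" where
  "partial_derivation G \<longleftrightarrow> subring G \<and> (\<forall>z\<in>G. std z = 0 \<longrightarrow> z = 0)"

text \<open>
  A derivation extends to one more element \<open>b\<close>. If \<open>b\<close> satisfies a relation \<open>h(b) = 0\<close>, then the
  derivation extends to the coefficients of \<open>h\<close> and the value at \<open>b\<close> is determined by
  differentiating the relation; this is possible since \<open>h'(b) \<noteq> 0\<close> for \<open>h\<close> of least degree.
\<close>

lemma partial_derivation_extend:
  assumes G: "partial_derivation G"
  shows "\<exists>d. partial_derivation (adjoin G (Dual b d))"
proof -
  have R: "subring G" and G0: "\<And>z. z \<in> G \<Longrightarrow> std z = 0 \<Longrightarrow> z = 0"
    using G by (auto simp: partial_derivation_def)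
  have "\<exists>d. \<forall>p\<in>polys_over G. poly (map_poly std p) b = 0 \<longrightarrow> poly p (Dual b d) = 0"
  proof (cases "\<exists>h\<in>polys_over G. h \<noteq> 0 \<and> poly (map_poly std h) b = 0")
    case True
    define Q where "Q h \<longleftrightarrow> h \<in> polys_over G \<and> h \<noteq> 0 \<and> poly (map_poly std h) b = 0" for h
    obtain h0 where "Q h0" using True by (auto simp: Q_def)
    from ex_has_least_nat[of Q h0 degree, OF this] obtain h
      where h: "Q h" and min: "\<And>g. Q g \<Longrightarrow> degree h \<le> degree g" by blast
    have hG: "h \<in> polys_over G" and h0: "h \<noteq> 0" and hb: "poly (map_poly std h) b = 0"
      using h by (auto simp: Q_def)
    have "lead_coeff h \<in> G" "lead_coeff h \<noteq> 0" using hG h0 by (simp_all add: polys_over_def)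
    then have lc: "std (lead_coeff h) \<noteq> 0" using G0 by blast
    have deg: "degree (map_poly std h) = degree h"
      using lc by (intro map_poly_degree_eq) simp
    have pos: "degree h > 0"
    proof (rule ccontr)
      assume "\<not> degree h > 0"
      then obtain a where "h = [:a:]" by (metis degree_eq_zeroE gr0I)
      then show False using lc hb by (simp add: map_poly_pCons)
    qed
    \<comment> \<open>The derivative of a relation of least degree does not vanish at \<open>b\<close>.\<close>
    have nz: "poly (pderiv (map_poly std h)) b \<noteq> 0"
    proof
      assume z: "poly (pderiv (map_poly std h)) b = 0"
      let ?g = "\<Sum>i<degree h. monom (of_nat (Suc i) * coeff h (Suc i)) i"
      have cg: "coeff ?g i = of_nat (Suc i) * coeff h (Suc i)" for i
        by (simp add: coeff_sum coeff_eq_0 sum.delta del: of_nat_Suc)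
      have "map_poly std ?g = pderiv (map_poly std h)"
        by (simp add: poly_eq_iff coeff_map_poly coeff_pderiv std_of_nat cg del: of_nat_Suc)
      moreover have "?g \<in> polys_over G"
        using hG subring_mult[OF R subring_of_nat[OF R]] by (simp add: polys_over_def cg del: of_nat_Suc)
      moreover have "?g \<noteq> 0"
      proof
        assume "?g = 0"
        then have "pderiv (map_poly std h) = 0" using calculation(1) by simp
        then show False using pos deg by (simp add: pderiv_eq_0_iff)
      qed
      moreover have "degree ?g \<le> degree h - 1"
        by (rule degree_le) (simp add: cg coeff_eq_0 del: of_nat_Suc)
      ultimately have "Q ?g" "degree ?g < degree h" using z pos by (simp_all add: Q_def)
      then show False using min[of ?g] by simp
    qed
    define d where "d = - eps (poly h (Dual b 0)) / poly (pderiv (map_poly std h)) b"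
    have hd: "poly h (Dual b d) = 0"
      using hb nz unfolding poly_Dual_eps[of h b d] by (intro dual_eqI) (simp_all add: std_poly d_def)
    show ?thesis
    proof (intro exI[of _ d] ballI impI)
      fix g assume g: "g \<in> polys_over G" and gb: "poly (map_poly std g) b = 0"
      from pseudo_division[OF R hG pos g] obtain k q u where q: "q \<in> polys_over G"
        and u: "u \<in> polys_over G" and e: "smult (lead_coeff h ^ k) g = q * h + u"
        and du: "degree u < degree h" by metis
      have ev: "lead_coeff h ^ k * poly g w = poly q w * poly h w + poly u w" for w
        using arg_cong[OF e, of "\<lambda>p. poly p w"] by simp
      have "std (poly u (Dual b d)) = 0"
        using arg_cong[OF ev[of "Dual b d"], of std] gb by (simp add: hd std_poly)
      then have "u = 0" using min[of u] u du by (auto simp: Q_def std_poly)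
      then have "lead_coeff h ^ k * poly g (Dual b d) = 0" using ev hd by simp
      moreover have "std (poly g (Dual b d)) = 0" using gb by (simp add: std_poly)
      ultimately have "std (lead_coeff h) ^ k * eps (poly g (Dual b d)) = 0"
        by (metis dual_simps(2,10) add.right_neutral mult_zero_right std_power)
      then show "poly g (Dual b d) = 0"
        using lc gb by (intro dual_eqI) (auto simp: std_poly)
    qed
  next
    case False
    then show ?thesis by (intro exI[of _ 0]) auto
  qed
  then obtain d where d: "\<And>p. p \<in> polys_over G \<Longrightarrow> poly (map_poly std p) b = 0 \<Longrightarrow> poly p (Dual b d) = 0"
    by blast
  have "partial_derivation (adjoin G (Dual b d))"
    using subring_adjoin[OF R] d by (auto simp: partial_derivation_def adjoin_def std_poly)
  then show ?thesis ..
qed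

text \<open>By Zorn's lemma: a maximal partial derivation is defined everywhere.\<close>

lemma partial_derivation_total:
  assumes G: "partial_derivation G"
  obtains \<delta> where "derivation \<delta>" "\<And>z. z \<in> G \<Longrightarrow> \<delta> (std z) = eps z"
proof -
  let ?A = "{F. partial_derivation F \<and> G \<subseteq> F}"
  have "\<exists>M\<in>?A. \<forall>X\<in>?A. M \<subseteq> X \<longrightarrow> X = M"
  proof (rule subset_Zorn_nonempty)
    show "?A \<noteq> {}" using G by auto
    fix C assume C: "C \<noteq> {}" "subset.chain ?A C"
    have C': "partial_derivation F" "G \<subseteq> F" if "F \<in> C" for F
      using C(2) that by (auto simp: subset_chain_def)
    have sub: "x - y \<in> \<Union>C \<and> x * y \<in> \<Union>C" if xy: "x \<in> F" "F \<in> C" "y \<in> H" "H \<in> C" for x y F H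
    proof -
      have "F \<subseteq> H \<or> H \<subseteq> F" using C(2) xy by (auto simp: subset_chain_def)
      then have "\<exists>E\<in>C. x \<in> E \<and> y \<in> E" using xy by (elim disjE) auto
      then obtain E where E: "E \<in> C" "x \<in> E" "y \<in> E" by blast
      then have "subring E" using C' by (auto simp: partial_derivation_def)
      then show ?thesis using E by (auto intro: subring_diff subring_mult)
    qed
    obtain F0 where F0: "F0 \<in> C" using C(1) by auto
    have "subring F0" using C'(1)[OF F0] by (simp add: partial_derivation_def)
    then have "1 \<in> \<Union>C" using F0 by (auto dest: subring_one)
    then have "subring (\<Union>C)" unfolding subring_def using sub by (intro conjI ballI) auto
    moreover have "z = 0" if z: "z \<in> \<Union>C" "std z = 0" for z
      using z C'(1) by (auto simp: partial_derivation_def)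
    ultimately have "partial_derivation (\<Union>C)" by (simp add: partial_derivation_def)
    moreover have "G \<subseteq> \<Union>C" using F0 C'(2) by auto
    ultimately show "\<Union>C \<in> ?A" by simp
  qed
  then obtain M where M: "partial_derivation M" "G \<subseteq> M"
    and max: "\<And>X. partial_derivation X \<Longrightarrow> M \<subseteq> X \<Longrightarrow> X = M" by auto
  have R: "subring M" and M0: "\<And>z. z \<in> M \<Longrightarrow> std z = 0 \<Longrightarrow> z = 0"
    using M(1) by (auto simp: partial_derivation_def)
  have "\<exists>u. Dual x u \<in> M" for x
  proof -
    obtain d where "partial_derivation (adjoin M (Dual x d))"
      using partial_derivation_extend[OF M(1)] by blast
    from max[OF this subset_adjoin[OF R]] show ?thesis using generator_adjoin[OF R, of "Dual x d"] by auto
  qed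
  then obtain \<delta> where \<delta>: "\<And>x. Dual x (\<delta> x) \<in> M" by metis
  have uniq: "\<delta> (std z) = eps z" if "z \<in> M" for z
  proof -
    have "Dual (std z) (\<delta> (std z)) - z = 0" by (rule M0[OF subring_diff[OF R \<delta> that]]) simp
    from arg_cong[OF this, of eps] show ?thesis by simp
  qed
  have "derivation \<delta>"
    unfolding derivation_def
    using uniq[OF subring_add[OF R \<delta> \<delta>]] uniq[OF subring_mult[OF R \<delta> \<delta>]] by simp
  then show ?thesis using that uniq M(2) by blast
qed

text \<open>
  An algebraic substitute for a general point: the coordinates in \<open>V\<close> are algebraically independent
  over \<open>K\<close>.
\<close>

definition generic :: "complex set \<Rightarrow> 'v set \<Rightarrow> ('v \<Rightarrow> complex) \<Rightarrow> bool" where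
  "generic K V t \<longleftrightarrow> (\<forall>g\<in>polys K V. g t = 0 \<longrightarrow> (\<forall>s. g s = 0))"

lemma generic_exists:
  fixes V :: "'v::countable set"
  assumes "finite V" "countable K" "K \<noteq> {}"
  obtains t where "generic K V t"
proof -
  let ?G = "{g \<in> polys K V. \<exists>s. g s \<noteq> 0}"
  have "countable ?G" using countable_polys[OF assms(2,3)] by (rule countable_subset[rotated]) auto
  moreover have "g \<in> polys UNIV V \<and> (\<exists>s. g s \<noteq> 0)" if "g \<in> ?G" for g
    using that polys_mono[of g K V UNIV V] by auto
  ultimately have "\<exists>t. \<forall>g\<in>?G. g t \<noteq> 0" by (rule generic_point_exists[OF assms(1)])
  then obtain t where "\<forall>g\<in>?G. g t \<noteq> 0" by (elim exE)
  then have "generic K V t" unfolding generic_def by blast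
  then show ?thesis by (rule that)
qed

text \<open>
  The values of a derivation at the coordinates of a generic point are arbitrary: on the ring
  generated by them there is the directional derivative, which extends to all complex numbers.
\<close>

lemma generic_derivation:
  assumes K: "subring K" and t: "generic K V t"
  obtains \<delta> where "derivation \<delta>" "\<And>v. v \<in> V \<Longrightarrow> \<delta> (t v) = W v"
proof -
  let ?l = "\<lambda>g c. g (\<lambda>v. t v + c * W v) :: complex"
  define G where "G = {z. \<exists>g\<in>polys K V. std z = g t \<and> (?l g has_field_derivative eps z) (at 0)}"
  have P: "subring (polys K V)" by (rule subring_polys[OF K])
  have "partial_derivation G"
    unfolding partial_derivation_def subring_def
  proof (intro conjI ballI impI)
    show "1 \<in> G"
      unfolding G_def using polys.const[OF subring_one[OF K], of V] by force
    fix x y assume "x \<in> G" "y \<in> G"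
    then obtain f g where f: "f \<in> polys K V" "std x = f t" "(?l f has_field_derivative eps x) (at 0)"
      and g: "g \<in> polys K V" "std y = g t" "(?l g has_field_derivative eps y) (at 0)"
      by (auto simp: G_def)
    have "(?l (\<lambda>s. f s - g s) has_field_derivative eps (x - y)) (at 0)"
      using DERIV_diff[OF f(3) g(3)] by simp
    then show "x - y \<in> G" unfolding G_def using polys_diff[OF K f(1) g(1)] f g by force
    have "(?l (\<lambda>s. f s * g s) has_field_derivative eps (x * y)) (at 0)"
      using DERIV_mult[OF f(3) g(3)] f(2) g(2) by (simp add: algebra_simps)
    then show "x * y \<in> G" unfolding G_def using polys.mult[OF f(1) g(1)] f g by force
  next
    fix z assume "z \<in> G" "std z = 0"
    then obtain g where g: "g \<in> polys K V" "g t = 0" "(?l g has_field_derivative eps z) (at 0)"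
      by (auto simp: G_def)
    then have "?l g = (\<lambda>_. 0)" using t by (auto simp: generic_def)
    then have "eps z = 0" using g(3) by (metis DERIV_const DERIV_unique)
    then show "z = 0" using \<open>std z = 0\<close> by (intro dual_eqI) simp_all
  qed
  then obtain \<delta> where \<delta>: "derivation \<delta>" "\<And>z. z \<in> G \<Longrightarrow> \<delta> (std z) = eps z"
    using partial_derivation_total by blast
  have "\<delta> (t v) = W v" if "v \<in> V" for v
  proof -
    have "((\<lambda>c. t v + c * W v) has_field_derivative W v) (at 0)"
      by (auto intro!: derivative_eq_intros)
    then have "Dual (t v) (W v) \<in> G" unfolding G_def using polys.var[OF that, of K] by force
    from \<delta>(2)[OF this] show ?thesis by simp
  qed
  then show ?thesis using \<delta>(1) that by blast
qed



section \<open>Rank-one tensors and their tangent spaces\<close>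

text \<open>
  The tensor product of the vectors \<open>b 0, b 1, ...\<close>, which are given as functions, so that
  a factor is exchanged by a function update.
\<close>

definition tens :: "nat list \<Rightarrow> (nat \<Rightarrow> nat \<Rightarrow> complex) \<Rightarrow> tensor" where
  "tens n b = (\<lambda>i. if i \<in> idx n then \<Prod>I<length n. b I (i ! I) else 0)"

text \<open>The differential of the tensor product at \<open>b\<close> in the direction \<open>w\<close>.\<close>

definition dtens :: "nat list \<Rightarrow> (nat \<Rightarrow> nat \<Rightarrow> complex) \<Rightarrow> (nat \<Rightarrow> nat \<Rightarrow> complex) \<Rightarrow> tensor" where
  "dtens n b w = (\<Sum>I<length n. tens n (b(I := w I)))"

text \<open>The cone over the embedded tangent space of the Segre variety, see \<open>tangent_space_segre\<close>.\<close>

definition tspace :: "nat list \<Rightarrow> (nat \<Rightarrow> nat \<Rightarrow> complex) \<Rightarrow> tensor set" where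
  "tspace n b = range (dtens n b)"

definition join :: "nat list \<Rightarrow> nat \<Rightarrow> (nat \<Rightarrow> nat \<Rightarrow> nat \<Rightarrow> complex) \<Rightarrow> tensor set" where
  "join n r t = tensor.span (\<Union>k<r. tspace n (t k))"

definition unit :: "nat \<Rightarrow> nat \<Rightarrow> complex" where
  "unit j = (\<lambda>m. if m = j then 1 else 0)"

lemma sum_fun_apply: "(\<Sum>a\<in>A. f a) i = (\<Sum>a\<in>A. f a i)"
  by (induct A rule: infinite_finite_induct) simp_all

lemma smul_apply: "(c *\<^sub>C x) i = c * x i"
  by (simp add: smul_def)

lemma tens_slot:
  assumes "I < length n"
  shows "tens n (b(I := u)) i = (if i \<in> idx n then u (i ! I) * (\<Prod>J\<in>{..<length n} - {I}. b J (i ! J)) else 0)"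
proof -
  have "(\<Prod>J<length n. (b(I := u)) J (i ! J)) = u (i ! I) * (\<Prod>J\<in>{..<length n} - {I}. (b(I := u)) J (i ! J))"
    using assms by (subst prod.remove[of _ I]) auto
  also have "(\<Prod>J\<in>{..<length n} - {I}. (b(I := u)) J (i ! J)) = (\<Prod>J\<in>{..<length n} - {I}. b J (i ! J))"
    by (rule prod.cong) auto
  finally show ?thesis by (simp add: tens_def)
qed

lemma tens_cong:
  assumes "\<And>I j. I < length n \<Longrightarrow> j < n ! I \<Longrightarrow> b I j = b' I j"
  shows "tens n b = tens n b'"
  using assms by (auto simp: tens_def idx_def fun_eq_iff intro!: prod.cong)

lemma tens_slot_cong:
  assumes "I < length n" "\<And>j. j < n ! I \<Longrightarrow> u j = v j"
  shows "tens n (b(I := u)) = tens n (b(I := v))"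
  using assms by (intro tens_cong) auto

lemma tens_slot_linear:
  assumes I: "I < length n"
  shows tens_slot_add: "tens n (b(I := \<lambda>j. u j + v j)) = tens n (b(I := u)) + tens n (b(I := v))"
    and tens_slot_diff: "tens n (b(I := \<lambda>j. u j - v j)) = tens n (b(I := u)) - tens n (b(I := v))"
    and tens_slot_scale: "tens n (b(I := \<lambda>j. c * u j)) = c *\<^sub>C tens n (b(I := u))"
    and tens_slot_zero: "tens n (b(I := \<lambda>j. 0)) = 0"
    and tens_slot_sum: "tens n (b(I := \<lambda>j. \<Sum>a\<in>A. f a * g a j)) = (\<Sum>a\<in>A. f a *\<^sub>C tens n (b(I := g a)))"
  by (auto simp: fun_eq_iff tens_slot[OF I] smul_apply algebra_simps sum_fun_apply sum_distrib_left sum_distrib_right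
      intro!: sum.cong)

lemma tens_rescale: "I < length n \<Longrightarrow> tens n (b(I := \<lambda>j. c * b I j)) = c *\<^sub>C tens n b"
  using tens_slot_scale[of I n b c "b I"] by simp

lemma tens_slot_expand:
  assumes I: "I < length n"
  shows "tens n (b(I := w)) = (\<Sum>j<n ! I. w j *\<^sub>C tens n (b(I := unit j)))"
proof -
  have "tens n (b(I := w)) = tens n (b(I := \<lambda>m. \<Sum>j<n ! I. w j * unit j m))"
    using I by (intro tens_slot_cong) (auto simp: unit_def if_distrib sum.delta cong: if_cong)
  then show ?thesis using tens_slot_sum[OF I] by simp
qed

lemma tens_zero:
  assumes "I < length n" "\<And>j. j < n ! I \<Longrightarrow> b I j = 0"
  shows "tens n b = 0"
proof -
  have "tens n b = tens n (b(I := \<lambda>j. 0))" using assms by (intro tens_cong) auto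
  then show ?thesis using tens_slot_zero[OF assms(1)] by simp
qed

lemma dtens_linear:
  shows dtens_add: "dtens n b (\<lambda>I j. w I j + w' I j) = dtens n b w + dtens n b w'"
    and dtens_diff: "dtens n b (\<lambda>I j. w I j - w' I j) = dtens n b w - dtens n b w'"
    and dtens_scale: "dtens n b (\<lambda>I j. c * w I j) = c *\<^sub>C dtens n b w"
    and dtens_zero: "dtens n b (\<lambda>I j. 0) = 0"
  by (simp_all add: dtens_def tens_slot_add tens_slot_diff tens_slot_scale tens_slot_zero
      sum.distrib sum_subtractf tensor.scale_sum_right)

lemma dtens_cong:
  "(\<And>I j. I < length n \<Longrightarrow> j < n ! I \<Longrightarrow> w I j = w' I j) \<Longrightarrow> dtens n b w = dtens n b w'"
  unfolding dtens_def by (intro sum.cong refl tens_slot_cong) auto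

lemma dtens_single:
  assumes "I < length n"
  shows "dtens n b (\<lambda>J. if J = I then v else (\<lambda>j. 0)) = tens n (b(I := v))"
proof -
  have "dtens n b (\<lambda>J. if J = I then v else (\<lambda>j. 0)) = (\<Sum>J<length n. if J = I then tens n (b(I := v)) else 0)"
    unfolding dtens_def by (intro sum.cong) (auto simp: tens_slot_zero)
  then show ?thesis using assms by simp
qed

lemma subspace_tspace: "tensor.subspace (tspace n b)"
  unfolding tensor.subspace_def
proof (intro conjI ballI allI)
  show "0 \<in> tspace n b" unfolding tspace_def using dtens_zero[of n b] by (metis rangeI)
  fix x assume "x \<in> tspace n b"
  then obtain w where x: "x = dtens n b w" unfolding tspace_def by (rule rangeE)
  show "c *\<^sub>C x \<in> tspace n b" for c
    unfolding tspace_def x dtens_scale[symmetric] by (rule rangeI)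
  fix y assume "y \<in> tspace n b"
  then obtain w' where y: "y = dtens n b w'" unfolding tspace_def by (rule rangeE)
  show "x + y \<in> tspace n b"
    unfolding tspace_def x y dtens_add[symmetric] by (rule rangeI)
qed

lemma dtens_in_tspace: "dtens n b w \<in> tspace n b"
  unfolding tspace_def by (rule rangeI)

lemma tens_slot_in_tspace: "I < length n \<Longrightarrow> tens n (b(I := v)) \<in> tspace n b"
  using dtens_in_tspace[of n b "\<lambda>J. if J = I then v else (\<lambda>j. 0)"] by (simp add: dtens_single)

lemma tens_in_tspace: "n \<noteq> [] \<Longrightarrow> tens n b \<in> tspace n b"
  using tens_slot_in_tspace[of 0 n b "b 0"] by simp

lemma tspace_rescale:
  assumes I: "I < length n" and c: "c \<noteq> 0"
  shows "tspace n (b(I := \<lambda>j. c * b I j)) = tspace n b"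
proof -
  have sub: "tspace n (b(I := \<lambda>j. c * b I j)) \<subseteq> tspace n b" for b c
  proof
    fix x assume "x \<in> tspace n (b(I := \<lambda>j. c * b I j))"
    then obtain w where x: "x = dtens n (b(I := \<lambda>j. c * b I j)) w" unfolding tspace_def by (rule rangeE)
    have "tens n (b(I := \<lambda>j. c * b I j, J := w J)) \<in> tspace n b" if J: "J < length n" for J
    proof (cases "J = I")
      case True
      then show ?thesis using tens_slot_in_tspace[OF I] by simp
    next
      case False
      then have "tens n (b(I := \<lambda>j. c * b I j, J := w J)) = c *\<^sub>C tens n (b(J := w J))"
        using tens_slot_scale[OF I, of "b(J := w J)" c "b I"] by (simp add: fun_upd_twist fun_upd_idem)
      then show ?thesis
        using tensor.subspace_scale[OF subspace_tspace tens_slot_in_tspace[OF J]] by simp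
    qed
    then show "x \<in> tspace n b"
      unfolding x dtens_def by (intro tensor.subspace_sum[OF subspace_tspace]) auto
  qed
  have "(b(I := \<lambda>j. c * b I j))(I := \<lambda>j. inverse c * (b(I := \<lambda>j. c * b I j)) I j) = b"
    using c by (auto simp: fun_eq_iff)
  then show ?thesis using sub[of b c] sub[of "b(I := \<lambda>j. c * b I j)" "inverse c"] by auto
qed

lemma tspace_subset_join: "k < r \<Longrightarrow> tspace n (t k) \<subseteq> join n r t"
  unfolding join_def by (auto intro: tensor.span_base)

lemma join_sum: "(\<And>k. k < r \<Longrightarrow> u k \<in> tspace n (t k)) \<Longrightarrow> (\<Sum>k<r. u k) \<in> join n r t"
  unfolding join_def by (rule tensor.span_sum) (auto intro!: tensor.span_base)

lemma in_join:
  assumes "h \<in> join n r t"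
  obtains W where "h = (\<Sum>k<r. dtens n (t k) (W k))"
proof -
  let ?S = "{\<Sum>k<r. dtens n (t k) (W k) | W. True}"
  have sub: "tensor.subspace ?S"
    unfolding tensor.subspace_def
  proof (intro conjI ballI allI)
    show "0 \<in> ?S" by (intro CollectI exI[of _ "\<lambda>k I j. 0"]) (simp add: dtens_zero)
    fix x assume "x \<in> ?S"
    then obtain W where x: "x = (\<Sum>k<r. dtens n (t k) (W k))" by blast
    show "c *\<^sub>C x \<in> ?S" for c
      by (intro CollectI exI[of _ "\<lambda>k I j. c * W k I j"]) (simp add: x dtens_scale tensor.scale_sum_right)
    fix y assume "y \<in> ?S"
    then obtain W' where y: "y = (\<Sum>k<r. dtens n (t k) (W' k))" by blast
    show "x + y \<in> ?S"
      by (intro CollectI exI[of _ "\<lambda>k I j. W k I j + W' k I j"]) (simp add: x y dtens_add sum.distrib)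
  qed
  have "x \<in> ?S" if kx: "k < r" "x \<in> tspace n (t k)" for k x
  proof -
    obtain w where w: "x = dtens n (t k) w" using kx(2) unfolding tspace_def by (rule rangeE)
    have "(\<Sum>l<r. dtens n (t l) (if l = k then w else (\<lambda>I j. 0))) = (\<Sum>l<r. if l = k then dtens n (t k) w else 0)"
      by (intro sum.cong) (auto simp: dtens_zero)
    then show ?thesis using kx w by (intro CollectI exI[of _ "\<lambda>l. if l = k then w else (\<lambda>I j. 0)"]) simp
  qed
  then have "join n r t \<subseteq> ?S" unfolding join_def by (intro tensor.span_minimal sub) auto
  then show ?thesis using assms that by blast
qed

lemma tens_nonzero:
  assumes "\<And>I. I < length n \<Longrightarrow> \<exists>j<n ! I. b I j \<noteq> 0"
  shows "tens n b \<noteq> 0"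
proof -
  obtain e where e: "\<And>I. I < length n \<Longrightarrow> e I < n ! I \<and> b I (e I) \<noteq> 0" using assms by metis
  then have "tens n b (map e [0..<length n]) \<noteq> 0" by (auto simp: tens_def idx_def)
  then show ?thesis by auto
qed

text \<open>
  Where the factors do not vanish, the only directions that are not seen by the tensor product are
  those that rescale the factors. Fix all entries but the \<open>J\<close>-th one of a multi-index: as a function
  of this last entry, the differential is a combination of \<open>w J\<close> and \<open>b J\<close>.
\<close>

lemma dtens_kernel:
  assumes nz: "\<And>I. I < length n \<Longrightarrow> \<exists>j<n ! I. b I j \<noteq> 0" and zero: "dtens n b w = 0"
    and J: "J < length n"
  shows "\<exists>c. \<forall>j<n ! J. w J j = c * b J j"
proof -
  let ?d = "length n"
  obtain e where e: "\<And>I. I < ?d \<Longrightarrow> e I < n ! I \<and> b I (e I) \<noteq> 0" using nz by metis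
  define P where "P = (\<Prod>K\<in>{..<?d} - {J}. b K (e K))"
  define C where "C = (\<Sum>I\<in>{..<?d} - {J}. \<Prod>K\<in>{..<?d} - {J}. (b(I := w I)) K (e K))"
  have P: "P \<noteq> 0" using e by (simp add: P_def)
  have "w J j = - C / P * b J j" if j: "j < n ! J" for j
  proof -
    let ?i = "map (e(J := j)) [0..<?d]"
    have i: "?i \<in> idx n" using e j by (auto simp: idx_def)
    have slot: "tens n (b(I := w I)) ?i =
        (if I = J then w J j * P else b J j * (\<Prod>K\<in>{..<?d} - {J}. (b(I := w I)) K (e K)))" if "I < ?d" for I
    proof -
      have "tens n (b(I := w I)) ?i = (\<Prod>K<?d. (b(I := w I)) K ((e(J := j)) K))"
        using i by (auto simp: tens_def intro!: prod.cong)
      also have "\<dots> = (b(I := w I)) J j * (\<Prod>K\<in>{..<?d} - {J}. (b(I := w I)) K ((e(J := j)) K))"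
        using J by (subst prod.remove[of _ J]) auto
      also have "(\<Prod>K\<in>{..<?d} - {J}. (b(I := w I)) K ((e(J := j)) K)) = (\<Prod>K\<in>{..<?d} - {J}. (b(I := w I)) K (e K))"
        by (rule prod.cong) auto
      finally have *: "tens n (b(I := w I)) ?i =
        (b(I := w I)) J j * (\<Prod>K\<in>{..<?d} - {J}. (b(I := w I)) K (e K))" .
      have "(\<Prod>K\<in>{..<?d} - {J}. (b(J := w J)) K (e K)) = P"
        unfolding P_def by (intro prod.cong) auto
      then show ?thesis unfolding * by (cases "I = J") (simp_all del: fun_upd_apply add: fun_upd_same fun_upd_other)
    qed
    have "0 = dtens n b w ?i" using zero by simp
    also have "\<dots> = (\<Sum>I<?d. tens n (b(I := w I)) ?i)" by (simp add: dtens_def sum_fun_apply)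
    also have "\<dots> = tens n (b(J := w J)) ?i + (\<Sum>I\<in>{..<?d} - {J}. tens n (b(I := w I)) ?i)"
      using J by (subst sum.remove[of _ J]) auto
    also have "\<dots> = w J j * P + b J j * C"
      using J by (simp add: slot C_def sum_distrib_left)
    finally have "P * w J j = - (C * b J j)" by (simp add: eq_neg_iff_add_eq_0 mult.commute add.commute)
    then show ?thesis using P by (simp add: field_simps)
  qed
  then show ?thesis by blast
qed

lemma segre_dim_sum: "segre_dim n = (\<Sum>I<length n. n ! I - 1)"
  by (simp add: segre_dim_def sum_list_sum_nth atLeast0LessThan)

text \<open>
  With a vanishing factor, the tensor product moves only if this factor does. The dimension of the
  tangent space drops, unless all other factors are scalars.
\<close>

lemma tspace_span_zero_factor:
  assumes I0: "I0 < length n" "\<And>j. j < n ! I0 \<Longrightarrow> b I0 j = 0"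
  obtains S where "finite S" "card S \<le> n ! I0" "tspace n b \<subseteq> tensor.span S"
proof -
  let ?S = "(\<lambda>j. tens n (b(I0 := unit j))) ` {..<n ! I0}"
  have "dtens n b w \<in> tensor.span ?S" for w
    unfolding dtens_def
  proof (rule tensor.span_sum)
    fix I assume I: "I \<in> {..<length n}"
    show "tens n (b(I := w I)) \<in> tensor.span ?S"
    proof (cases "I = I0")
      case True
      show ?thesis unfolding True
        by (subst tens_slot_expand[OF I0(1)], intro tensor.span_sum tensor.span_scale tensor.span_base) auto
    next
      case False
      then have "tens n (b(I := w I)) = 0" using I0 by (intro tens_zero[of I0]) auto
      then show ?thesis by (simp add: tensor.span_zero)
    qed
  qed
  moreover have "card ?S \<le> n ! I0" using card_image_le[of "{..<n ! I0}"] by simp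
  ultimately show ?thesis by (intro that[of ?S]) (auto simp: tspace_def)
qed

text \<open>
  The tensor itself and, for each factor, the unit vectors except one at which the factor does not
  vanish.
\<close>

lemma tspace_span:
  assumes pos: "\<forall>m\<in>set n. 1 \<le> m"
  obtains S where "finite S" "card S \<le> segre_dim n + 1" "tspace n b \<subseteq> tensor.span S"
proof (cases "\<exists>I0<length n. \<forall>j<n ! I0. b I0 j = 0")
  case True
  then obtain I0 where I0: "I0 < length n" "\<And>j. j < n ! I0 \<Longrightarrow> b I0 j = 0" by blast
  obtain S where S: "finite S" "card S \<le> n ! I0" "tspace n b \<subseteq> tensor.span S"
    by (rule tspace_span_zero_factor[where b = b, OF I0])
  have "n ! I0 - 1 \<le> segre_dim n"
    unfolding segre_dim_sum using I0(1) by (intro member_le_sum) auto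
  then show ?thesis using S by (intro that[of S]) auto
next
  case False
  then obtain e where e: "\<And>I. I < length n \<Longrightarrow> e I < n ! I \<and> b I (e I) \<noteq> 0" by metis
  let ?F = "\<lambda>I. (\<lambda>j. tens n (b(I := unit j))) ` ({..<n ! I} - {e I})"
  let ?S = "insert (tens n b) (\<Union>I<length n. ?F I)"
  have "card (?F I) \<le> n ! I - 1" if "I < length n" for I
    using e[OF that] by (intro order_trans[OF card_image_le]) auto
  then have "(\<Sum>I<length n. card (?F I)) \<le> segre_dim n"
    unfolding segre_dim_sum by (intro sum_mono) auto
  moreover have "card (\<Union>I<length n. ?F I) \<le> (\<Sum>I<length n. card (?F I))"
    by (intro card_UN_le) auto
  ultimately have card: "card ?S \<le> segre_dim n + 1"
    by (intro order_trans[OF card_insert_le_m1]) auto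
  have unit_in: "tens n (b(I := unit j)) \<in> tensor.span ?S" if I: "I < length n" and j: "j < n ! I" for I j
  proof (cases "j = e I")
    case False
    then show ?thesis using I j by (intro tensor.span_base) auto
  next
    case True
    have "tens n b = (\<Sum>m<n ! I. b I m *\<^sub>C tens n (b(I := unit m)))"
      using tens_slot_expand[OF I, of b "b I"] by simp
    also have "\<dots> = b I j *\<^sub>C tens n (b(I := unit j)) + (\<Sum>m\<in>{..<n ! I} - {j}. b I m *\<^sub>C tens n (b(I := unit m)))"
      using j by (subst sum.remove[of _ j]) auto
    finally have "b I j *\<^sub>C tens n (b(I := unit j)) = tens n b - (\<Sum>m\<in>{..<n ! I} - {j}. b I m *\<^sub>C tens n (b(I := unit m)))"
      by simp
    moreover have "\<dots> \<in> tensor.span ?S"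
      using I True by (intro tensor.span_diff tensor.span_sum tensor.span_scale tensor.span_base) auto
    ultimately have "b I j *\<^sub>C tens n (b(I := unit j)) \<in> tensor.span ?S" by simp
    from tensor.span_scale[OF this, of "inverse (b I j)"] show ?thesis using e[OF I] True by simp
  qed
  have "dtens n b w \<in> tensor.span ?S" for w
    unfolding dtens_def
  proof (rule tensor.span_sum)
    fix I assume "I \<in> {..<length n}"
    then show "tens n (b(I := w I)) \<in> tensor.span ?S"
      by (subst tens_slot_expand) (auto intro!: tensor.span_sum tensor.span_scale unit_in)
  qed
  then show ?thesis using card by (intro that[of ?S]) (auto simp: tspace_def)
qed


section \<open>Joins of tangent spaces of the expected dimension\<close>

text \<open>
  The dimension is at least the expected one. It cannot be larger, by \<open>tspace_span\<close>.
\<close>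

definition nondefective :: "nat list \<Rightarrow> nat \<Rightarrow> (nat \<Rightarrow> nat \<Rightarrow> nat \<Rightarrow> complex) \<Rightarrow> bool" where
  "nondefective n r t \<longleftrightarrow>
     (\<exists>A \<subseteq> join n r t. tensor.independent A \<and> finite A \<and> card A = r * (segre_dim n + 1))"

lemma nondefective_bound:
  assumes "nondefective n r t" "join n r t \<subseteq> tensor.span S" "finite S"
  shows "r * (segre_dim n + 1) \<le> card S"
  using assms tensor.independent_span_bound[of S] unfolding nondefective_def
  by (metis subset_trans)

text \<open>Steinitz exchange: \<open>s\<close> is any member of a minimal subset of \<open>S\<close> whose span contains \<open>u\<close>.\<close>

lemma spanning_exchange:
  assumes "finite S" "u \<in> tensor.span S" "u \<noteq> (0 :: tensor)"
  obtains s where "s \<in> S" "s \<in> tensor.span (insert u (S - {s}))"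
proof -
  have "\<exists>S'\<subseteq>S. u \<in> tensor.span S' \<and> (\<forall>S''\<subset>S'. u \<notin> tensor.span S'')"
    using assms(1,2)
  proof (induct S rule: finite_psubset_induct)
    case (psubset S)
    show ?case
    proof (cases "\<exists>S''\<subset>S. u \<in> tensor.span S''")
      case True
      then obtain S'' where "S'' \<subset> S" "u \<in> tensor.span S''" by blast
      then show ?thesis using psubset(2)[of S''] by (meson psubset_imp_subset subset_trans)
    next
      case False
      then show ?thesis using psubset(3) by blast
    qed
  qed
  then obtain S' where S': "S' \<subseteq> S" "u \<in> tensor.span S'" "\<And>S''. S'' \<subset> S' \<Longrightarrow> u \<notin> tensor.span S''" by blast
  have "S' \<noteq> {}" using S'(2) assms(3) by auto
  then obtain s where s: "s \<in> S'" by blast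
  have "u \<in> tensor.span (insert s (S' - {s}))" using S'(2) s by (simp add: insert_absorb)
  moreover have "u \<notin> tensor.span (S' - {s})" using S'(3) s by blast
  ultimately have "s \<in> tensor.span (insert u (S' - {s}))" by (rule tensor.in_span_insert)
  moreover have "tensor.span (insert u (S' - {s})) \<subseteq> tensor.span (insert u (S - {s}))"
    using S'(1) by (intro tensor.span_mono) auto
  ultimately show ?thesis using that s S'(1) by blast
qed

text \<open>
  A join of dimension \<open>r (\<Sigma> + 1)\<close> that lies in the sum of \<open>r\<close> tangent spaces, each of
  dimension at most \<open>\<Sigma> + 1\<close>, leaves no room for relations between these spaces.
\<close>

lemma nondefective_direct:
  assumes pos: "\<forall>m\<in>set n. 1 \<le> m" and nd: "nondefective n r t" and sub: "join n r t \<subseteq> join n r b"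
  shows join_eq: "join n r t = join n r b"
    and tspace_dim: "\<And>k S. k < r \<Longrightarrow> finite S \<Longrightarrow> tspace n (b k) \<subseteq> tensor.span S \<Longrightarrow> segre_dim n + 1 \<le> card S"
    and direct_sum: "\<And>u k. (\<And>k. k < r \<Longrightarrow> u k \<in> tspace n (b k)) \<Longrightarrow> (\<Sum>k<r. u k) = 0 \<Longrightarrow> k < r \<Longrightarrow> u k = 0"
proof -
  let ?m = "segre_dim n + 1"
  have "\<forall>k. \<exists>S. finite S \<and> card S \<le> ?m \<and> tspace n (b k) \<subseteq> tensor.span S"
    using tspace_span[OF pos] by metis
  then obtain S where S: "\<And>k. finite (S k)" "\<And>k. card (S k) \<le> ?m" "\<And>k. tspace n (b k) \<subseteq> tensor.span (S k)"
    by metis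
  have span: "join n r b \<subseteq> tensor.span Q" if "\<And>k. k < r \<Longrightarrow> tspace n (b k) \<subseteq> tensor.span Q" for Q
    unfolding join_def using that by (intro tensor.span_minimal tensor.subspace_span) auto
  have S_Q: "tspace n (b k) \<subseteq> tensor.span Q" if "S k \<subseteq> tensor.span Q" for k Q
    using S(3)[of k] tensor.span_minimal[OF that tensor.subspace_span] by blast
  have card_UN: "card (\<Union>k\<in>A. S k) \<le> card A * ?m" if "finite A" for A
    using order_trans[OF card_UN_le[OF that] sum_bounded_above[of A "\<lambda>k. card (S k)" ?m]] S(2) by simp
  show "join n r t = join n r b"
  proof (rule antisym[OF sub], rule subsetI, rule ccontr)
    fix x assume x: "x \<in> join n r b" "x \<notin> join n r t"
    obtain A where A: "A \<subseteq> join n r t" "tensor.independent A" "finite A" "card A = r * ?m"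
      using nd by (auto simp: nondefective_def)
    have "tensor.span A \<subseteq> join n r t"
      using A(1) unfolding join_def by (intro tensor.span_minimal tensor.subspace_span)
    then have xA: "x \<notin> tensor.span A" using x(2) by blast
    then have "tensor.independent (insert x A)" using A(2) by (rule tensor.independent_insertI)
    moreover have "insert x A \<subseteq> tensor.span (\<Union>k<r. S k)"
    proof -
      have "S k \<subseteq> tensor.span (\<Union>k<r. S k)" if "k < r" for k
        using that by (intro order_trans[OF _ tensor.span_superset]) auto
      then have "join n r b \<subseteq> tensor.span (\<Union>k<r. S k)" by (intro span S_Q)
      then show ?thesis using x(1) A(1) sub by auto
    qed
    ultimately have "card (insert x A) \<le> card (\<Union>k<r. S k)"
      using tensor.independent_span_bound[of "\<Union>k<r. S k" "insert x A"] S(1) by auto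
    moreover have "x \<notin> A" using xA tensor.span_base by blast
    ultimately show False using card_UN[of "{..<r}"] A(3,4) by simp
  qed
  \<comment> \<open>No tangent space can be spanned by fewer vectors, even modulo the sum of the others.\<close>
  have drop: "\<And>k Q. k < r \<Longrightarrow> finite Q \<Longrightarrow> tspace n (b k) \<subseteq> tensor.span (Q \<union> (\<Union>l\<in>{..<r} - {k}. S l)) \<Longrightarrow> ?m \<le> card Q"
  proof -
    fix k Q assume k: "k < r" and Q: "finite Q" and Q': "tspace n (b k) \<subseteq> tensor.span (Q \<union> (\<Union>l\<in>{..<r} - {k}. S l))"
    let ?Q = "Q \<union> (\<Union>l\<in>{..<r} - {k}. S l)"
    have "tspace n (b l) \<subseteq> tensor.span ?Q" if "l < r" for l
    proof (cases "l = k")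
      case False
      then have "S l \<subseteq> ?Q" using that by auto
      then show ?thesis using S_Q tensor.span_superset by blast
    qed (use Q' in simp)
    then have "join n r t \<subseteq> tensor.span ?Q" using span sub by blast
    then have "r * ?m \<le> card ?Q" using nondefective_bound[OF nd] Q S(1) by simp
    also have "\<dots> \<le> card Q + (r - 1) * ?m"
      using card_Un_le[of Q "\<Union>l\<in>{..<r} - {k}. S l"] card_UN[of "{..<r} - {k}"] k by simp
    finally show "?m \<le> card Q" using k by (cases r) auto
  qed
  show "?m \<le> card Q" if "k < r" "finite Q" "tspace n (b k) \<subseteq> tensor.span Q" for k Q
    using that tensor.span_mono[of Q "Q \<union> (\<Union>l\<in>{..<r} - {k}. S l)"] by (intro drop[of k]) auto
  show "u k = 0" if u: "\<And>k. k < r \<Longrightarrow> u k \<in> tspace n (b k)" and sum: "(\<Sum>k<r. u k) = 0" and k: "k < r" for u k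
  proof (rule ccontr)
    assume "u k \<noteq> 0"
    moreover have "u k \<in> tensor.span (S k)" using u[OF k] S(3) by blast
    ultimately obtain s where s: "s \<in> S k" "s \<in> tensor.span (insert (u k) (S k - {s}))"
      using spanning_exchange[OF S(1)] by blast
    let ?Q = "(S k - {s}) \<union> (\<Union>l\<in>{..<r} - {k}. S l)"
    have "(\<Sum>l<r. u l) = u k + (\<Sum>l\<in>{..<r} - {k}. u l)" using k by (subst sum.remove[of _ k]) auto
    then have uk: "u k = - (\<Sum>l\<in>{..<r} - {k}. u l)" using sum by (simp add: eq_neg_iff_add_eq_0)
    have "u l \<in> tensor.span ?Q" if "l \<in> {..<r} - {k}" for l
    proof -
      have "S l \<subseteq> ?Q" using that by auto
      then show ?thesis using u[of l] S_Q[of l ?Q] tensor.span_superset[of ?Q] that by auto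
    qed
    then have "u k \<in> tensor.span ?Q"
      unfolding uk by (intro tensor.span_neg tensor.span_sum)
    then have "insert (u k) (S k - {s}) \<subseteq> tensor.span ?Q" using tensor.span_superset[of ?Q] by auto
    then have "s \<in> tensor.span ?Q" using s(2) tensor.span_minimal[OF _ tensor.subspace_span] by blast
    then have "S k \<subseteq> tensor.span ?Q" using tensor.span_superset[of ?Q] by auto
    then have "?m \<le> card (S k - {s})" using S(1) by (intro drop[OF k] S_Q) auto
    moreover have "card (S k - {s}) < card (S k)" using s(1) S(1) by (intro psubset_card_mono) auto
    ultimately show False using S(2)[of k] by simp
  qed
qed



section \<open>Uniqueness of the decomposition at a generic point\<close>

text \<open>
  In an affine chart, the form \<open>\<Sum>J\<noteq>I. tens n (b(I := v I, J := w J))\<close> modulo \<open>H\<close> is the Hessian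
  at \<open>b\<close> of the equations of \<open>H\<close>. Nondegeneracy means that its kernel only contains the directions
  that rescale the factors.
\<close>

definition nondegenerate :: "nat list \<Rightarrow> tensor set \<Rightarrow> (nat \<Rightarrow> nat \<Rightarrow> complex) \<Rightarrow> bool" where
  "nondegenerate n H b \<longleftrightarrow> (\<forall>w.
     (\<forall>I<length n. \<forall>j<n ! I. (\<Sum>J\<in>{..<length n} - {I}. tens n (b(I := unit j, J := w J))) \<in> H) \<longrightarrow>
     (\<forall>J<length n. \<exists>c. \<forall>j<n ! J. w J j = c * b J j))"

lemma derivation_tens:
  assumes \<delta>: "derivation \<delta>"
  shows "(\<lambda>i. \<delta> (tens n b i)) = dtens n b (\<lambda>I j. \<delta> (b I j))"
proof
  fix i
  show "\<delta> (tens n b i) = dtens n b (\<lambda>I j. \<delta> (b I j)) i"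
  proof (cases "i \<in> idx n")
    case True
    then have "\<delta> (tens n b i) = (\<Sum>I<length n. \<Prod>J<length n. if J = I then \<delta> (b J (i ! J)) else b J (i ! J))"
      by (simp add: tens_def derivation_prod[OF \<delta>])
    also have "\<dots> = dtens n b (\<lambda>I j. \<delta> (b I j)) i"
      using True by (auto simp: dtens_def sum_fun_apply tens_def intro!: sum.cong prod.cong)
    finally show ?thesis .
  qed (simp add: tens_def dtens_def sum_fun_apply derivation_0[OF \<delta>])
qed

lemma derivation_fun_sum: "derivation \<delta> \<Longrightarrow> (\<lambda>i. \<delta> ((\<Sum>a\<in>A. f a) i)) = (\<Sum>a\<in>A. (\<lambda>i. \<delta> (f a i)))"
  by (simp add: fun_eq_iff sum_fun_apply derivation_sum)

lemma dtens_rescale: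
  assumes "\<And>I. I < length n \<Longrightarrow> \<exists>c. \<forall>j<n ! I. w I j = c * b I j"
  shows "\<exists>c. dtens n b w = c *\<^sub>C tens n b"
proof -
  obtain c where c: "\<And>I j. I < length n \<Longrightarrow> j < n ! I \<Longrightarrow> w I j = c I * b I j" using assms by metis
  have "tens n (b(I := w I)) = c I *\<^sub>C tens n b" if "I < length n" for I
  proof -
    have "tens n (b(I := w I)) = tens n (b(I := \<lambda>j. c I * b I j))"
      using that c by (intro tens_slot_cong) auto
    then show ?thesis using tens_slot_scale[OF that, of b "c I" "b I"] by simp
  qed
  then have "dtens n b w = (\<Sum>I<length n. c I) *\<^sub>C tens n b"
    by (simp add: dtens_def tensor.scale_sum_left)
  then show ?thesis ..
qed

text \<open>
  The assumption \<open>free\<close> says that the entries of \<open>t\<close> are algebraically independent, in terms of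
  derivations. About \<open>b\<close> nothing is known but the equality of the two tensors; in particular, its
  factors may vanish a priori.
\<close>

locale two_decompositions =
  fixes n :: "nat list" and r :: nat and t b :: "nat \<Rightarrow> nat \<Rightarrow> nat \<Rightarrow> complex"
  assumes ne: "n \<noteq> []" and pos: "\<forall>m\<in>set n. 1 \<le> m" and dim: "segre_dim n > 0"
    and free: "\<And>W. \<exists>\<delta>. derivation \<delta> \<and> (\<forall>k<r. \<forall>I<length n. \<forall>j<n ! I. \<delta> (t k I j) = W k I j)"
    and nondefective: "nondefective n r t"
    and nondegenerate: "\<And>k. k < r \<Longrightarrow> nondegenerate n (join n r t) (t k)"
    and eq: "(\<Sum>k<r. tens n (t k)) = (\<Sum>k<r. tens n (b k))"
begin

lemma derivation_sum_t:
  "derivation \<delta> \<Longrightarrow> (\<lambda>i. \<delta> ((\<Sum>k<r. tens n (t k)) i)) = (\<Sum>k<r. dtens n (t k) (\<lambda>I j. \<delta> (t k I j)))"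
  by (simp only: derivation_fun_sum derivation_tens)

lemma derivation_sum_b:
  "derivation \<delta> \<Longrightarrow> (\<lambda>i. \<delta> ((\<Sum>k<r. tens n (t k)) i)) = (\<Sum>k<r. dtens n (b k) (\<lambda>I j. \<delta> (b k I j)))"
  by (simp only: eq derivation_fun_sum derivation_tens)

text \<open>The join is the space of all derivatives of the tensor, hence does not depend on the decomposition.\<close>

lemma join_derivative:
  assumes "h \<in> join n r t"
  obtains \<delta> where "derivation \<delta>" "h = (\<Sum>k<r. dtens n (t k) (\<lambda>I j. \<delta> (t k I j)))"
    "h = (\<Sum>k<r. dtens n (b k) (\<lambda>I j. \<delta> (b k I j)))"
proof -
  obtain W where W: "h = (\<Sum>k<r. dtens n (t k) (W k))" using in_join[OF assms] .
  obtain \<delta> where \<delta>: "derivation \<delta>" "\<forall>k<r. \<forall>I<length n. \<forall>j<n ! I. \<delta> (t k I j) = W k I j"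
    using free[of W] by blast
  have "h = (\<Sum>k<r. dtens n (t k) (\<lambda>I j. \<delta> (t k I j)))"
    unfolding W using \<delta>(2) by (intro sum.cong dtens_cong) auto
  then show ?thesis using that \<delta>(1) derivation_sum_t[OF \<delta>(1)] derivation_sum_b[OF \<delta>(1)] by simp
qed

lemma join_t_subset_join_b: "join n r t \<subseteq> join n r b"
proof
  fix h assume "h \<in> join n r t"
  then obtain \<delta> where "h = (\<Sum>k<r. dtens n (b k) (\<lambda>I j. \<delta> (b k I j)))" by (rule join_derivative)
  then show "h \<in> join n r b"
    using join_sum[OF dtens_in_tspace] by simp
qed

lemmas join_b_eq = join_eq[OF pos nondefective join_t_subset_join_b]
  and dim_b = tspace_dim[OF pos nondefective join_t_subset_join_b]
  and direct_b = direct_sum[OF pos nondefective join_t_subset_join_b]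
  and direct_t = direct_sum[OF pos nondefective order_refl]

lemma t_nonzero:
  assumes "k < r" "I < length n"
  shows "\<exists>j<n ! I. t k I j \<noteq> 0"
proof -
  have "n ! I \<ge> 1" using pos assms(2) by auto
  moreover obtain \<delta> where "derivation \<delta>" "\<forall>k<r. \<forall>I<length n. \<forall>j<n ! I. \<delta> (t k I j) = 1"
    using free[of "\<lambda>k I j. 1"] by blast
  ultimately have "\<delta> (t k I 0) = 1" "derivation \<delta>" using assms by auto
  then have "t k I 0 \<noteq> 0" using derivation_0[of \<delta>] by auto
  then show ?thesis using \<open>n ! I \<ge> 1\<close> by (intro exI[of _ 0]) auto
qed

lemma tens_t_nonzero: "k < r \<Longrightarrow> tens n (t k) \<noteq> 0"
  by (intro tens_nonzero t_nonzero)

text \<open>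
  If only one factor had dimension greater than one, then the rank-one tensors would form a linear
  space, and the Hessian would vanish.
\<close>

lemma two_factors:
  assumes r: "0 < r" and I0: "I0 < length n"
  shows "\<exists>J<length n. J \<noteq> I0 \<and> 2 \<le> n ! J"
proof (rule ccontr)
  assume "\<not> ?thesis"
  then have one: "n ! J = 1" if "J < length n" "J \<noteq> I0" for J
    using pos that by (metis One_nat_def Suc_1 Suc_leI le_neq_implies_less nth_mem)
  have "segre_dim n = n ! I0 - 1"
    unfolding segre_dim_sum using one I0 by (subst sum.remove[of _ I0]) auto
  then have two: "2 \<le> n ! I0" using dim by simp
  have line: "\<exists>c. \<forall>j<n ! I0. v j = c * t 0 I0 j" for v
  proof -
    let ?w = "(\<lambda>J j. 0)(I0 := v)"
    have "(\<Sum>J\<in>{..<length n} - {I}. tens n ((t 0)(I := unit j, J := ?w J))) \<in> join n r t"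
      if I: "I < length n" and j: "j < n ! I" for I j
      unfolding join_def
    proof (rule tensor.span_sum)
      fix J assume J: "J \<in> {..<length n} - {I}"
      show "tens n ((t 0)(I := unit j, J := ?w J)) \<in> tensor.span (\<Union>k<r. tspace n (t k))"
      proof (cases "J = I0")
        case False
        then have "tens n ((t 0)(I := unit j, J := ?w J)) = 0"
          using J by (intro tens_zero[of J]) auto
        then show ?thesis by (simp add: tensor.span_zero)
      next
        case True
        then have j0: "n ! I = 1" "j = 0" using one[OF I] J j by auto
        then have nz: "t 0 I 0 \<noteq> 0" using t_nonzero[OF r I] by auto
        have "tens n ((t 0)(I := unit j, J := ?w J)) = tens n (((t 0)(J := ?w J))(I := unit j))"
          using J by (simp add: fun_upd_twist)
        also have "\<dots> = tens n (((t 0)(J := ?w J))(I := \<lambda>m. inverse (t 0 I 0) * t 0 I m))"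
          using I nz j0 by (intro tens_slot_cong) (auto simp: unit_def)
        also have "\<dots> = inverse (t 0 I 0) *\<^sub>C tens n (((t 0)(J := ?w J))(I := t 0 I))"
          by (rule tens_slot_scale[OF I])
        also have "((t 0)(J := ?w J))(I := t 0 I) = (t 0)(J := ?w J)" using J by auto
        finally show ?thesis
          using J tspace_subset_join[OF r, of n t] tens_slot_in_tspace[of J n "t 0" "?w J"]
          unfolding join_def by (auto simp del: fun_upd_apply intro!: tensor.span_scale)
      qed
    qed
    then have "\<forall>J<length n. \<exists>c. \<forall>j<n ! J. ?w J j = c * t 0 J j"
      using nondegenerate[OF r, unfolded nondegenerate_def, THEN spec[of _ ?w]] by blast
    from this[THEN spec[of _ I0]] show ?thesis using I0 by simp
  qed
  obtain c where c: "\<forall>j<n ! I0. unit 0 j = c * t 0 I0 j" using line by blast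
  obtain c' where c': "\<forall>j<n ! I0. unit 1 j = c' * t 0 I0 j" using line by blast
  have "c * t 0 I0 0 = 1" "c * t 0 I0 1 = 0" "c' * t 0 I0 1 = 1"
    using c[THEN spec[of _ 0]] c[THEN spec[of _ 1]] c'[THEN spec[of _ 1]] two by (simp_all add: unit_def)
  then show False by auto
qed

lemma b_nonzero:
  assumes k: "k < r" and I: "I < length n"
  shows "\<exists>j<n ! I. b k I j \<noteq> 0"
proof (rule ccontr)
  assume "\<not> ?thesis"
  then have z: "\<And>j. j < n ! I \<Longrightarrow> b k I j = 0" by auto
  obtain S where S: "finite S" "card S \<le> n ! I" "tspace n (b k) \<subseteq> tensor.span S"
    by (rule tspace_span_zero_factor[where b = "b k", OF I z])
  obtain J where J: "J < length n" "J \<noteq> I" "2 \<le> n ! J" using two_factors[of I] k I by auto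
  have "(n ! I - 1) + (n ! J - 1) = (\<Sum>K\<in>{I, J}. n ! K - 1)" using J by simp
  also have "\<dots> \<le> segre_dim n" unfolding segre_dim_sum using I J by (intro sum_mono2) auto
  finally have "n ! I < segre_dim n + 1" using J by simp
  then show False using dim_b[OF k S(1,3)] S(2) by simp
qed

text \<open>
  A derivation that sends the tensor to one of the summands \<open>tens n (b k0)\<close> only rescales the factors
  of all \<open>b k\<close>. Hence it maps the join to itself. Applied to the tangent vectors at \<open>t k\<close>, this says
  that the derivatives of the factors of \<open>t k\<close> lie in the kernel of the Hessian, so they are
  rescaled, too, and the derivative of the tensor is a combination of the \<open>tens n (t k)\<close>.
\<close>

lemma tens_b_in_span:
  assumes k0: "k0 < r"
  shows "\<exists>A. tens n (b k0) = (\<Sum>k<r. A k *\<^sub>C tens n (t k))"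
proof -
  have "tens n (b k0) \<in> join n r t"
    using join_b_eq tspace_subset_join[OF k0, of n b] tens_in_tspace[OF ne] by blast
  from join_derivative[OF this] obtain \<delta> where \<delta>: "derivation \<delta>"
    and dt: "tens n (b k0) = (\<Sum>k<r. dtens n (t k) (\<lambda>I j. \<delta> (t k I j)))"
    and db: "tens n (b k0) = (\<Sum>k<r. dtens n (b k) (\<lambda>I j. \<delta> (b k I j)))" .
  \<comment> \<open>The direction that rescales the first factor of \<open>b k0\<close> has the same effect on the tensor.\<close>
  define v where "v k I = (if k = k0 \<and> I = 0 then b k0 0 else (\<lambda>j. 0))" for k I :: nat
  have dv: "dtens n (b k) (v k) = (if k = k0 then tens n (b k0) else 0)" for k
  proof (cases "k = k0")
    case True
    then have "v k = (\<lambda>J. if J = 0 then b k0 0 else (\<lambda>j. 0))" by (auto simp: v_def)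
    then show ?thesis using dtens_single[of 0 n "b k0" "b k0 0"] ne True by simp
  next
    case False
    then have "v k = (\<lambda>J j. 0)" by (auto simp: v_def)
    then show ?thesis using False by (simp add: dtens_zero)
  qed
  define u where "u k = dtens n (b k) (\<lambda>I j. \<delta> (b k I j) - v k I j)" for k
  have "(\<Sum>k<r. u k) = tens n (b k0) - (\<Sum>k<r. if k = k0 then tens n (b k0) else 0)"
    unfolding u_def dtens_diff dv sum_subtractf db[symmetric] ..
  then have "(\<Sum>k<r. u k) = 0" using k0 by simp
  then have u0: "u k = 0" if "k < r" for k
    by (rule direct_b[rotated]) (use that in \<open>auto simp: u_def dtens_in_tspace\<close>)
  have b_rescaled: "\<exists>c. \<forall>j<n ! I. \<delta> (b k I j) = c * b k I j" if k: "k < r" and I: "I < length n" for k I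
  proof -
    obtain c where c: "\<forall>j<n ! I. \<delta> (b k I j) - v k I j = c * b k I j"
      using dtens_kernel[OF b_nonzero[OF k] u0[OF k, unfolded u_def] I] by blast
    show ?thesis
      by (rule exI[of _ "if k = k0 \<and> I = 0 then c + 1 else c"])
        (use c in \<open>auto simp: v_def algebra_simps\<close>)
  qed
  have stable_slot: "(\<lambda>i. \<delta> (tens n ((b k)(I := w)) i)) \<in> tspace n (b k)"
    if k: "k < r" and I: "I < length n" for k I w
    unfolding derivation_tens[OF \<delta>] dtens_def
  proof (rule tensor.subspace_sum[OF subspace_tspace])
    fix J assume "J \<in> {..<length n}"
    then have J: "J < length n" by simp
    show "tens n (((b k)(I := w))(J := \<lambda>j. \<delta> (((b k)(I := w)) J j))) \<in> tspace n (b k)"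
    proof (cases "J = I")
      case True
      then show ?thesis using tens_slot_in_tspace[OF I, of "b k" "\<lambda>j. \<delta> (w j)"] by simp
    next
      case False
      obtain c where c: "\<forall>j<n ! J. \<delta> (b k J j) = c * b k J j" using b_rescaled[OF k J] by blast
      have "tens n (((b k)(I := w))(J := \<lambda>j. \<delta> (((b k)(I := w)) J j))) =
          tens n (((b k)(I := w))(J := \<lambda>j. c * b k J j))"
        using False c J by (intro tens_slot_cong) auto
      also have "\<dots> = c *\<^sub>C tens n (((b k)(I := w))(J := b k J))" by (rule tens_slot_scale[OF J])
      also have "((b k)(I := w))(J := b k J) = (b k)(I := w)" using False by auto
      finally show ?thesis
        using tensor.subspace_scale[OF subspace_tspace tens_slot_in_tspace[OF I]] by (simp only:)
    qed
  qed
  have stable: "(\<lambda>i. \<delta> (h i)) \<in> join n r t" if h: "h \<in> join n r t" for h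
  proof -
    obtain W where W: "h = (\<Sum>k<r. dtens n (b k) (W k))"
      using in_join[of h n r b] h join_b_eq by metis
    have "(\<lambda>i. \<delta> (dtens n (b k) (W k) i)) \<in> tspace n (b k)" if "k < r" for k
      unfolding dtens_def derivation_fun_sum[OF \<delta>] using that stable_slot
      by (intro tensor.subspace_sum[OF subspace_tspace]) auto
    then show ?thesis
      unfolding W derivation_fun_sum[OF \<delta>] join_b_eq by (rule join_sum)
  qed
  have "\<exists>c. dtens n (t k) (\<lambda>I j. \<delta> (t k I j)) = c *\<^sub>C tens n (t k)" if k: "k < r" for k
  proof (rule dtens_rescale)
    have "(\<Sum>J\<in>{..<length n} - {I}. tens n ((t k)(I := unit j, J := \<lambda>j. \<delta> (t k J j)))) \<in> join n r t"
      if I: "I < length n" and j: "j < n ! I" for I j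
    proof -
      let ?z = "(t k)(I := unit j)"
      have "tens n ?z \<in> join n r t" using tspace_subset_join[OF k] tens_slot_in_tspace[OF I] by blast
      then have "(\<Sum>J<length n. tens n (?z(J := \<lambda>m. \<delta> (?z J m)))) \<in> join n r t"
        using stable[of "tens n ?z"] unfolding derivation_tens[OF \<delta>] dtens_def by simp
      moreover have "tens n (?z(I := \<lambda>m. \<delta> (?z I m))) = 0"
        using I by (intro tens_zero[of I]) (auto simp: unit_def derivation_rules[OF \<delta>])
      ultimately have "(\<Sum>J\<in>{..<length n} - {I}. tens n (?z(J := \<lambda>m. \<delta> (?z J m)))) \<in> join n r t"
        using I sum.remove[of "{..<length n}" I "\<lambda>J. tens n (?z(J := \<lambda>m. \<delta> (?z J m)))"] by simp
      moreover have "(\<Sum>J\<in>{..<length n} - {I}. tens n (?z(J := \<lambda>m. \<delta> (?z J m)))) =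
          (\<Sum>J\<in>{..<length n} - {I}. tens n (?z(J := \<lambda>j. \<delta> (t k J j))))"
        by (rule sum.cong) auto
      ultimately show ?thesis by simp
    qed
    then show "\<exists>c. \<forall>j<n ! I. \<delta> (t k I j) = c * t k I j" if "I < length n" for I
      using nondegenerate[OF k, unfolded nondegenerate_def, THEN spec[of _ "\<lambda>J j. \<delta> (t k J j)"]] that by blast
  qed
  then obtain A where "\<And>k. k < r \<Longrightarrow> dtens n (t k) (\<lambda>I j. \<delta> (t k I j)) = A k *\<^sub>C tens n (t k)"
    by metis
  then show ?thesis unfolding dt by (intro exI[of _ A] sum.cong) auto
qed

text \<open>
  If \<open>tens n (b k0)\<close> were a proper combination of \<open>tens n (t k1)\<close> and \<open>tens n (t k2)\<close> and further
  points, then moving \<open>t k1\<close> freely would show that its tangent space lies in the one of \<open>b k0\<close>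
  up to the span of the points, and the same for \<open>t k2\<close>. One tangent space cannot replace two.
\<close>

lemma coefficients_single:
  assumes k0: "k0 < r" and A: "tens n (b k0) = (\<Sum>k<r. A k *\<^sub>C tens n (t k))"
    and k12: "k1 < r" "k2 < r" "k1 \<noteq> k2"
  shows "A k1 = 0 \<or> A k2 = 0"
proof (rule ccontr)
  assume "\<not> ?thesis"
  then have nz: "A k1 \<noteq> 0" "A k2 \<noteq> 0" by auto
  let ?m = "segre_dim n + 1"
  have "\<forall>b. \<exists>S. finite S \<and> card S \<le> ?m \<and> tspace n b \<subseteq> tensor.span S"
    using tspace_span[OF pos] by metis
  then obtain S where S: "\<And>b. finite (S b)" "\<And>b. card (S b) \<le> ?m" "\<And>b. tspace n b \<subseteq> tensor.span (S b)"
    by metis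
  let ?R = "{..<r} - {k1, k2}"
  define Q where "Q = S (b k0) \<union> {tens n (t k2)} \<union> (\<Union>k\<in>?R. S (t k))"
  have "card ?R = r - 2" using k12 by (simp add: card_Diff_subset)
  moreover have "card (\<Union>k\<in>?R. S (t k)) \<le> card ?R * ?m"
    using order_trans[OF card_UN_le[of ?R "\<lambda>k. S (t k)"] sum_bounded_above[of ?R "\<lambda>k. card (S (t k))" ?m]] S(2) by simp
  moreover have "card Q \<le> card (S (b k0)) + 1 + card (\<Union>k\<in>?R. S (t k))"
    unfolding Q_def by (intro order_trans[OF card_Un_le] add_mono order_refl) simp
  ultimately have "card Q \<le> ?m + 1 + (r - 2) * ?m" using S(2)[of "b k0"] by simp
  moreover have "2 \<le> r" using k12 by auto
  then have "r * ?m = 2 * ?m + (r - 2) * ?m" by (metis add_mult_distrib le_add_diff_inverse)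
  ultimately have cQ: "card Q < r * ?m" using dim by simp
  have fQ: "finite Q" unfolding Q_def using S(1) by simp
  have S_Q: "tspace n c \<subseteq> tensor.span Q" if "S c \<subseteq> Q" for c
    using S(3)[of c] tensor.span_mono[OF that] by blast
  have rest: "tspace n (t k) \<subseteq> tensor.span Q" if "k \<in> ?R" for k
    by (rule S_Q) (use that in \<open>auto simp: Q_def\<close>)
  have b0: "tspace n (b k0) \<subseteq> tensor.span Q" by (rule S_Q) (auto simp: Q_def)
  have p': "tens n (t k) \<in> tensor.span Q" if "k < r" "k \<noteq> k1" for k
  proof (cases "k = k2")
    case True
    then show ?thesis by (auto simp: Q_def intro: tensor.span_base)
  next
    case False
    then show ?thesis using rest[of k] tens_in_tspace[OF ne] that by blast
  qed
  have "A k1 *\<^sub>C tens n (t k1) = tens n (b k0) - (\<Sum>k\<in>{..<r} - {k1}. A k *\<^sub>C tens n (t k))"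
    unfolding A using k12(1) by (subst sum.remove[of _ k1]) auto
  also have "\<dots> \<in> tensor.span Q"
    using b0 tens_in_tspace[OF ne] p' by (intro tensor.span_diff tensor.span_sum tensor.span_scale) auto
  finally have "inverse (A k1) *\<^sub>C A k1 *\<^sub>C tens n (t k1) \<in> tensor.span Q" by (rule tensor.span_scale)
  then have p: "tens n (t k) \<in> tensor.span Q" if "k < r" for k
    using p' that nz by (cases "k = k1") auto
  have moving: "tspace n (t k) \<subseteq> tensor.span Q" if k: "k < r" and Ak: "A k \<noteq> 0" for k
  proof
    fix x assume "x \<in> tspace n (t k)"
    then obtain w where x: "x = dtens n (t k) w" unfolding tspace_def by (rule rangeE)
    obtain \<delta> where \<delta>: "derivation \<delta>" and \<delta>t: "\<And>l I j. l < r \<Longrightarrow> I < length n \<Longrightarrow> j < n ! I \<Longrightarrow>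
        \<delta> (t l I j) = (if l = k then w I j else 0)"
      using free[of "\<lambda>l I j. if l = k then w I j else 0"] by blast
    have dt: "dtens n (t l) (\<lambda>I j. \<delta> (t l I j)) = (if l = k then x else 0)" if "l < r" for l
    proof -
      have "dtens n (t l) (\<lambda>I j. \<delta> (t l I j)) = dtens n (t l) (\<lambda>I j. if l = k then w I j else 0)"
        using \<delta>t that by (intro dtens_cong) auto
      then show ?thesis by (simp add: x dtens_zero)
    qed
    have "(\<lambda>i. \<delta> (A l * tens n (t l) i)) = \<delta> (A l) *\<^sub>C tens n (t l) + A l *\<^sub>C dtens n (t l) (\<lambda>I j. \<delta> (t l I j))" for l
      unfolding derivation_tens[OF \<delta>, symmetric] by (auto simp: smul_def derivation_mult[OF \<delta>])
    then have "(\<lambda>i. \<delta> (tens n (b k0) i)) =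
        (\<Sum>l<r. \<delta> (A l) *\<^sub>C tens n (t l) + A l *\<^sub>C dtens n (t l) (\<lambda>I j. \<delta> (t l I j)))"
      unfolding A derivation_fun_sum[OF \<delta>] by (simp add: smul_apply)
    also have "\<dots> = (\<Sum>l<r. \<delta> (A l) *\<^sub>C tens n (t l)) + (\<Sum>l<r. if l = k then A k *\<^sub>C x else 0)"
      unfolding sum.distrib by (intro arg_cong2[of _ _ _ _ "(+)"] sum.cong) (auto simp: dt)
    finally have "A k *\<^sub>C x = (\<lambda>i. \<delta> (tens n (b k0) i)) - (\<Sum>l<r. \<delta> (A l) *\<^sub>C tens n (t l))"
      using k by simp
    also have "\<dots> \<in> tensor.span Q"
      unfolding derivation_tens[OF \<delta>] using b0 dtens_in_tspace p
      by (intro tensor.span_diff tensor.span_sum tensor.span_scale) auto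
    finally have "inverse (A k) *\<^sub>C A k *\<^sub>C x \<in> tensor.span Q" by (rule tensor.span_scale)
    then show "x \<in> tensor.span Q" using Ak by simp
  qed
  have "tspace n (t k) \<subseteq> tensor.span Q" if "k < r" for k
    using that moving k12 nz rest by (cases "k \<in> ?R") auto
  then have "join n r t \<subseteq> tensor.span Q"
    unfolding join_def by (intro tensor.span_minimal tensor.subspace_span) auto
  then show False using nondefective_bound[OF nondefective _ fQ] cQ by simp
qed

text \<open>
  Each \<open>tens n (b k)\<close> is a multiple of some \<open>tens n (t (\<pi> k))\<close>. As the \<open>tens n (t l)\<close> are independent and
  all have coefficient \<open>1\<close> in the tensor, \<open>\<pi>\<close> is onto and the multiples are trivial.
\<close>

theorem decompositions_agree:
  "\<exists>\<pi>. \<pi> permutes {..<r} \<and> (\<forall>k<r. tens n (b k) = tens n (t (\<pi> k)))"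
proof (cases "r = 0")
  case True
  then show ?thesis by (intro exI[of _ id]) (simp add: permutes_id)
next
  case False
  have "\<exists>k' a. k' < r \<and> tens n (b k) = a *\<^sub>C tens n (t k')" if k: "k < r" for k
  proof -
    obtain A where A: "tens n (b k) = (\<Sum>k<r. A k *\<^sub>C tens n (t k))" using tens_b_in_span[OF k] by blast
    obtain k' where k': "k' < r" "\<And>l. l < r \<Longrightarrow> l \<noteq> k' \<Longrightarrow> A l = 0"
      using coefficients_single[OF k A] False by (metis neq0_conv)
    have "(\<Sum>l<r. A l *\<^sub>C tens n (t l)) = (\<Sum>l<r. if l = k' then A k' *\<^sub>C tens n (t k') else 0)"
      using k'(2) by (intro sum.cong) auto
    then show ?thesis using A k'(1) by auto
  qed
  then obtain \<pi> a where \<pi>: "\<And>k. k < r \<Longrightarrow> \<pi> k < r" "\<And>k. k < r \<Longrightarrow> tens n (b k) = a k *\<^sub>C tens n (t (\<pi> k))"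
    by metis
  define c where "c l = (\<Sum>k\<in>{k. k < r \<and> \<pi> k = l}. a k)" for l
  have "(\<Sum>k<r. tens n (b k)) = (\<Sum>k<r. a k *\<^sub>C tens n (t (\<pi> k)))" using \<pi>(2) by simp
  also have "\<dots> = (\<Sum>l<r. \<Sum>k\<in>{k. k \<in> {..<r} \<and> \<pi> k = l}. a k *\<^sub>C tens n (t (\<pi> k)))"
    by (rule sum.group[symmetric]) (use \<pi>(1) in auto)
  also have "\<dots> = (\<Sum>l<r. c l *\<^sub>C tens n (t l))"
    by (auto simp: c_def tensor.scale_sum_left intro!: sum.cong)
  finally have "(\<Sum>l<r. c l *\<^sub>C tens n (t l) - tens n (t l)) = 0" by (simp add: sum_subtractf eq)
  then have "c l *\<^sub>C tens n (t l) - tens n (t l) = 0" if "l < r" for l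
    by (rule direct_t[rotated])
      (use that ne in \<open>auto intro!: tensor.subspace_diff tensor.subspace_scale subspace_tspace tens_in_tspace\<close>)
  then have "(c l - 1) *\<^sub>C tens n (t l) = 0" if "l < r" for l
    using that by (simp add: tensor.scale_left_diff_distrib)
  then have c1: "c l = 1" if "l < r" for l using that tens_t_nonzero[of l] by force
  have "l \<in> \<pi> ` {..<r}" if "l < r" for l
  proof (rule ccontr)
    assume "l \<notin> \<pi> ` {..<r}"
    then have "c l = 0" unfolding c_def by (intro sum.neutral) auto
    then show False using c1[OF that] by simp
  qed
  then have surj: "\<pi> ` {..<r} = {..<r}" using \<pi>(1) by auto
  then have inj: "inj_on \<pi> {..<r}" by (intro eq_card_imp_inj_on) auto
  have a1: "a k = 1" if "k < r" for k
  proof -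
    have "{l. l < r \<and> \<pi> l = \<pi> k} = {k}" using inj that by (auto simp: inj_on_def)
    then show ?thesis using c1[OF \<pi>(1)[OF that]] by (simp add: c_def)
  qed
  let ?\<pi> = "\<lambda>k. if k < r then \<pi> k else k"
  have "?\<pi> permutes {..<r}"
  proof (rule bij_imp_permutes)
    have "bij_betw \<pi> {..<r} {..<r}" using inj surj by (simp add: bij_betw_def)
    then show "bij_betw ?\<pi> {..<r} {..<r}" by (rule bij_betw_cong[THEN iffD1, rotated]) auto
  qed auto
  then show ?thesis using \<pi>(2) a1 by (intro exI[of _ ?\<pi>]) auto
qed

end



section \<open>Tangent spaces of Segre varieties\<close>

lemma poly_funs_eq: "poly_funs = polys UNIV UNIV"
proof
  show "poly_funs \<subseteq> polys UNIV UNIV"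
  proof
    fix f assume "f \<in> poly_funs"
    then show "f \<in> polys UNIV UNIV" by (induct rule: poly_funs.induct) (auto intro: polys.intros)
  qed
  show "polys UNIV UNIV \<subseteq> poly_funs"
  proof
    fix f :: "tensor \<Rightarrow> complex" assume "f \<in> polys UNIV UNIV"
    then show "f \<in> poly_funs" by (induct rule: polys.induct) (auto intro: poly_funs.intros)
  qed
qed

lemma outer_eq_tens: "outer n a = tens n (\<lambda>I j. a I $ j)"
  by (simp add: outer_def tens_def fun_eq_iff)

lemma tens_in_segre:
  assumes "\<And>I. I < length n \<Longrightarrow> \<exists>j<n ! I. b I j \<noteq> 0"
  shows "tens n b \<in> segre n"
proof -
  let ?a = "\<lambda>I. vec (n ! I) (b I)"
  have "tens n b = outer n ?a"
    unfolding outer_eq_tens by (intro tens_cong) auto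
  moreover have "\<forall>I<length n. ?a I \<in> carrier_vec (n ! I) \<and> ?a I \<noteq> 0\<^sub>v (n ! I)"
    using assms by (auto simp: vec_eq_iff)
  ultimately show ?thesis unfolding segre_def by blast
qed

lemma in_segre:
  assumes "x \<in> segre n"
  obtains b where "x = tens n b" "\<And>I. I < length n \<Longrightarrow> \<exists>j<n ! I. b I j \<noteq> 0"
proof -
  obtain a where a: "x = outer n a" "\<forall>I<length n. a I \<in> carrier_vec (n ! I) \<and> a I \<noteq> 0\<^sub>v (n ! I)"
    using assms by (auto simp: segre_def)
  have "\<exists>j<n ! I. a I $ j \<noteq> 0" if "I < length n" for I
  proof (rule ccontr)
    assume "\<not> ?thesis"
    then have "a I = 0\<^sub>v (n ! I)" using a(2) that by (intro eq_vecI) auto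
    then show False using a(2) that by blast
  qed
  then show ?thesis using that[of "\<lambda>I j. a I $ j"] a(1) by (simp add: outer_eq_tens)
qed

lemma segre_nonempty: "\<forall>m\<in>set n. 1 \<le> m \<Longrightarrow> segre n \<noteq> {}"
proof -
  assume pos: "\<forall>m\<in>set n. 1 \<le> m"
  have "tens n (\<lambda>I. unit 0) \<in> segre n"
  proof (rule tens_in_segre)
    fix I assume "I < length n"
    then have "1 \<le> n ! I" using pos by simp
    then show "\<exists>j<n ! I. unit 0 j \<noteq> 0" by (intro exI[of _ 0]) (auto simp: unit_def)
  qed
  then show ?thesis by auto
qed

lemma homogeneous_zero:
  assumes "f \<in> homogeneous_polys" "f x = 0"
  shows "f 0 = 0"
proof -
  obtain k :: nat where "\<forall>c x. f (c *\<^sub>C x) = c ^ k * f x" using assms(1) by (auto simp: homogeneous_polys_def)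
  then have "f (0 *\<^sub>C x) = 0 ^ k * f x" by blast
  then show ?thesis using assms(2) by simp
qed

text \<open>Tensor products with a vanishing factor are not in the variety, but they are zero.\<close>

lemma homogeneous_vanishing_on_tens:
  assumes pos: "\<forall>m\<in>set n. 1 \<le> m" and f: "f \<in> homogeneous_polys" "\<forall>x\<in>segre n. f x = 0"
  shows "f (tens n b) = 0"
proof (cases "\<forall>I<length n. \<exists>j<n ! I. b I j \<noteq> 0")
  case True
  then show ?thesis using f(2) tens_in_segre[of n b] by blast
next
  case False
  then obtain I where "I < length n" "\<And>j. j < n ! I \<Longrightarrow> b I j = 0" by blast
  then have "tens n b = 0" by (rule tens_zero)
  moreover obtain x where "x \<in> segre n" using segre_nonempty[OF pos] by auto
  ultimately show ?thesis using homogeneous_zero[OF f(1)] f(2) by metis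
qed

text \<open>The derivative of a polynomial along a curve only depends on the curve to first order.\<close>

lemma polys_derivative_cong:
  assumes "f \<in> polys K V" "\<And>i. (u i has_field_derivative D i) (at (0::complex))"
    "\<And>i. (v i has_field_derivative D i) (at 0)" "\<And>i. u i 0 = v i 0"
  shows "f (\<lambda>i. u i 0) = f (\<lambda>i. v i 0) \<and> (\<exists>E. ((\<lambda>c. f (\<lambda>i. u i c)) has_field_derivative E) (at 0) \<and>
    ((\<lambda>c. f (\<lambda>i. v i c)) has_field_derivative E) (at 0))"
  using assms(1)
proof (induct rule: polys.induct)
  case (const c)
  then show ?case by (auto intro!: exI[of _ 0])
next
  case (var i)
  then show ?case using assms(2-4) by (auto intro!: exI[of _ "D i"])
next
  case (add f g)
  then show ?case by (auto intro: DERIV_add)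
next
  case (mult f g)
  then obtain E F where *: "((\<lambda>c. f (\<lambda>i. u i c)) has_field_derivative E) (at 0)"
    "((\<lambda>c. f (\<lambda>i. v i c)) has_field_derivative E) (at 0)"
    "((\<lambda>c. g (\<lambda>i. u i c)) has_field_derivative F) (at 0)"
    "((\<lambda>c. g (\<lambda>i. v i c)) has_field_derivative F) (at 0)"
    "f (\<lambda>i. u i 0) = f (\<lambda>i. v i 0)" "g (\<lambda>i. u i 0) = g (\<lambda>i. v i 0)" by blast
  show ?case using DERIV_mult[OF *(1,3)] DERIV_mult[OF *(2,4)] *(5,6) by auto
qed

lemma dtens_derivative:
  "((\<lambda>c. tens n (\<lambda>I j. b I j + c * w I j) i) has_field_derivative dtens n b w i) (at 0)"
proof (cases "i \<in> idx n")
  case True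
  have "((\<lambda>c. \<Prod>I<length n. b I (i ! I) + c * w I (i ! I)) has_field_derivative
      (\<Sum>I<length n. w I (i ! I) * (\<Prod>J\<in>{..<length n} - {I}. b J (i ! J) + 0 * w J (i ! J)))) (at 0)"
    by (rule has_field_derivative_prod) (auto intro!: derivative_eq_intros)
  moreover have "(\<Sum>I<length n. w I (i ! I) * (\<Prod>J\<in>{..<length n} - {I}. b J (i ! J) + 0 * w J (i ! J))) = dtens n b w i"
    using True by (simp add: dtens_def sum_fun_apply tens_slot)
  ultimately show ?thesis using True by (simp add: tens_def)
qed (simp add: tens_def dtens_def sum_fun_apply)

lemma tspace_subset_tensors: "tspace n b \<subseteq> tensors n"
  by (auto simp: tspace_def tensors_def dtens_def sum_fun_apply tens_def)

lemma tspace_subset_tangent_space: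
  assumes pos: "\<forall>m\<in>set n. 1 \<le> m"
  shows "tspace n b \<subseteq> tangent_space n (segre n) (tens n b)"
proof
  fix v assume v: "v \<in> tspace n b"
  then obtain w where w: "v = dtens n b w" unfolding tspace_def by (rule rangeE)
  have "((\<lambda>c. f (tens n b + c *\<^sub>C v)) has_field_derivative 0) (at 0)"
    if f: "f \<in> homogeneous_polys" "\<forall>x\<in>segre n. f x = 0" for f
  proof -
    have "f \<in> polys UNIV UNIV" using f(1) by (simp add: homogeneous_polys_def poly_funs_eq)
    moreover have "((\<lambda>c. tens n b i + c * v i) has_field_derivative v i) (at 0)" for i
      by (auto intro!: derivative_eq_intros)
    moreover have "((\<lambda>c. tens n (\<lambda>I j. b I j + c * w I j) i) has_field_derivative v i) (at 0)" for i
      unfolding w by (rule dtens_derivative)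
    moreover have "tens n b i + 0 * v i = tens n (\<lambda>I j. b I j + 0 * w I j) i" for i by simp
    ultimately have "\<exists>E. ((\<lambda>c. f (\<lambda>i. tens n b i + c * v i)) has_field_derivative E) (at 0) \<and>
      ((\<lambda>c. f (\<lambda>i. tens n (\<lambda>I j. b I j + c * w I j) i)) has_field_derivative E) (at 0)"
      by (rule conjunct2[OF polys_derivative_cong])
    then obtain E where E: "((\<lambda>c. f (\<lambda>i. tens n b i + c * v i)) has_field_derivative E) (at 0)"
      "((\<lambda>c. f (tens n (\<lambda>I j. b I j + c * w I j))) has_field_derivative E) (at 0)"
      by blast
    have "(\<lambda>c. f (tens n (\<lambda>I j. b I j + c * w I j))) = (\<lambda>c. 0)"
      using homogeneous_vanishing_on_tens[OF pos f] by auto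
    then have "E = 0" using E(2) DERIV_unique[OF E(2), of 0] by simp
    then show ?thesis using E(1) by (simp add: plus_fun_def smul_def)
  qed
  then show "v \<in> tangent_space n (segre n) (tens n b)"
    using v tspace_subset_tensors by (auto simp: tangent_space_def)
qed

lemma idx_update: "i \<in> idx n \<Longrightarrow> j \<in> idx n \<Longrightarrow> i[K := j ! K] \<in> idx n"
  by (cases "K < length n") (auto simp: idx_def nth_list_update)

lemma quadric_derivative:
  fixes a :: complex
  shows "((\<lambda>c. (a + c * a') * (b + c * b') + (-1) * ((d + c * d') * (e + c * e'))) has_field_derivative
    a * b' + a' * b - (d * e' + d' * e)) (at 0)"
proof -
  have "((\<lambda>c. x + c * y + c * c * z) has_field_derivative y) (at 0)" for x y z :: complex
    by (auto intro!: derivative_eq_intros)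
  note * = this[of "a * b - d * e" "a * b' + a' * b - (d * e' + d' * e)" "a' * b' - d' * e'"]
  have "(\<lambda>c. (a + c * a') * (b + c * b') + (-1) * ((d + c * d') * (e + c * e'))) =
      (\<lambda>c. (a * b - d * e) + c * (a * b' + a' * b - (d * e' + d' * e)) + c * c * (a' * b' - d' * e'))"
    by (rule ext) (simp add: algebra_simps)
  with * show ?thesis by metis
qed

text \<open>The quadrics \<open>x i * x j - x i' * x j'\<close>, where \<open>i'\<close>, \<open>j'\<close> arise by exchanging one entry.\<close>

lemma tangent_space_equation:
  assumes v: "v \<in> tangent_space n (segre n) p" and ij: "i \<in> idx n" "j \<in> idx n" and K: "K < length n"
  shows "p i * v j + v i * p j = p (i[K := j ! K]) * v (j[K := i ! K]) + v (i[K := j ! K]) * p (j[K := i ! K])"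
proof -
  let ?i = "i[K := j ! K]" and ?j = "j[K := i ! K]"
  let ?f = "\<lambda>x. x i * x j + (-1) * (x ?i * x ?j) :: complex"
  have "?f \<in> poly_funs" by (intro poly_funs.intros)
  moreover have "\<forall>c x. ?f (c *\<^sub>C x) = c ^ 2 * ?f x" by (simp add: smul_def power2_eq_square algebra_simps)
  ultimately have f: "?f \<in> homogeneous_polys" by (auto simp: homogeneous_polys_def)
  have vanish: "?f x = 0" if x: "x \<in> segre n" for x
  proof -
    obtain b where b: "x = tens n b" by (rule in_segre[OF x])
    have "x i * x j = (\<Prod>I<length n. b I (i ! I) * b I (j ! I))"
      using ij by (simp add: b tens_def prod.distrib)
    also have "\<dots> = (\<Prod>I<length n. b I (?i ! I) * b I (?j ! I))"
      using ij K by (intro prod.cong) (auto simp: nth_list_update idx_def)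
    also have "\<dots> = x ?i * x ?j"
      using idx_update ij by (simp add: b tens_def prod.distrib)
    finally show ?thesis by simp
  qed
  have tangent: "((\<lambda>c. g (p + c *\<^sub>C v)) has_field_derivative 0) (at 0)"
    if "g \<in> homogeneous_polys" "\<And>x. x \<in> segre n \<Longrightarrow> g x = 0" for g
    using v that by (simp add: tangent_space_def)
  have "((\<lambda>c. ?f (p + c *\<^sub>C v)) has_field_derivative 0) (at 0)"
    by (rule tangent[of ?f, OF f vanish])
  moreover have "((\<lambda>c. ?f (p + c *\<^sub>C v)) has_field_derivative
      p i * v j + v i * p j - (p ?i * v ?j + v ?i * p ?j)) (at 0)"
    unfolding plus_fun_apply smul_apply by (rule quadric_derivative)
  ultimately have "p i * v j + v i * p j - (p ?i * v ?j + v ?i * p ?j) = 0"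
    by (rule DERIV_unique[symmetric])
  then show ?thesis by simp
qed

text \<open>
  Around an entry \<open>e\<close> where the rank-one tensor does not vanish, these equations determine a tangent
  vector by its entries at the neighbours of \<open>e\<close>, and the differentials of the tensor product
  take arbitrary values there.
\<close>

lemma tangent_space_segre:
  assumes pos: "\<forall>m\<in>set n. 1 \<le> m" and ne: "n \<noteq> []"
    and nz: "\<And>I. I < length n \<Longrightarrow> \<exists>j<n ! I. b I j \<noteq> 0"
  shows "tangent_space n (segre n) (tens n b) = tspace n b"
proof (rule antisym[OF _ tspace_subset_tangent_space[OF pos]], rule subsetI)
  fix v assume v: "v \<in> tangent_space n (segre n) (tens n b)"
  let ?d = "length n" and ?p = "tens n b"
  obtain e' where e': "\<And>I. I < ?d \<Longrightarrow> e' I < n ! I \<and> b I (e' I) \<noteq> 0" using nz by metis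
  define e where "e = map e' [0..<?d]"
  have e: "e \<in> idx n" "length e = ?d" using e' by (auto simp: e_def idx_def)
  have eb: "e ! I < n ! I" "b I (e ! I) \<noteq> 0" if "I < ?d" for I using e' that by (auto simp: e_def)
  define P where "P K = (\<Prod>J\<in>{..<?d} - {K}. b J (e ! J))" for K
  have P: "P K \<noteq> 0" for K using eb by (simp add: P_def)
  have p_e: "?p (e[K := m]) = b K m * P K" if "K < ?d" "m < n ! K" for K m
  proof -
    have "e[K := m] \<in> idx n" using e that by (auto simp: idx_def nth_list_update)
    then have "?p (e[K := m]) = (b(K := b K)) K m * (\<Prod>J\<in>{..<?d} - {K}. b J (e[K := m] ! J))"
      using tens_slot[OF that(1), of b "b K" "e[K := m]"] e(2) that(1) by simp
    also have "(\<Prod>J\<in>{..<?d} - {K}. b J (e[K := m] ! J)) = P K"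
      unfolding P_def by (intro prod.cong) auto
    finally show ?thesis by simp
  qed
  have "?p e \<noteq> 0" using e eb by (simp add: tens_def)
  define u where "u K m = (v (e[K := m]) - v e * b K m / b K (e ! K)) / P K" for K m
  define w where "w = (v e / ?p e) *\<^sub>C ?p + dtens n b u"
  have w_T: "w \<in> tspace n b"
    unfolding w_def by (intro tensor.subspace_add[OF subspace_tspace] tensor.subspace_scale[OF subspace_tspace]
        dtens_in_tspace tens_in_tspace[OF ne])
  have u_e: "u K (e ! K) = 0" if "K < ?d" for K
    using eb[OF that] by (simp add: u_def)
  have w_e: "w (e[K := m]) = v (e[K := m])" if K: "K < ?d" and m: "m < n ! K" for K m
  proof -
    have i: "e[K := m] \<in> idx n" using e that by (auto simp: idx_def nth_list_update)
    have "tens n (b(J := u J)) (e[K := m]) = (if J = K then u K m * P K else 0)" if J: "J < ?d" for J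
    proof (cases "J = K")
      case True
      have "(\<Prod>L\<in>{..<?d} - {K}. b L (e[K := m] ! L)) = P K"
        unfolding P_def by (intro prod.cong) auto
      then show ?thesis using True i K e(2) by (simp add: tens_slot)
    next
      case False
      then show ?thesis using u_e[OF J] i J by (simp add: tens_slot)
    qed
    then have "dtens n b u (e[K := m]) = u K m * P K"
      using K by (simp add: dtens_def sum_fun_apply)
    moreover have "?p e = b K (e ! K) * P K"
      using p_e[OF K, of "e ! K"] eb[OF K] by simp
    moreover have "w (e[K := m]) = v e / ?p e * ?p (e[K := m]) + dtens n b u (e[K := m])"
      by (simp add: w_def smul_def)
    moreover have "u K m * P K = v (e[K := m]) - v e * b K m / b K (e ! K)"
      using P[of K] by (simp add: u_def)
    moreover have "v e / (b K (e ! K) * P K) * (b K m * P K) = v e * b K m / b K (e ! K)"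
      using P[of K] eb(2)[OF K] by (simp add: field_simps)
    ultimately show ?thesis using p_e[OF K m] by simp
  qed
  have w': "w \<in> tangent_space n (segre n) ?p" using w_T tspace_subset_tangent_space[OF pos] by blast
  have "v i = w i" if "i \<in> idx n" for i
    using that
  proof (induct "card {K. K < ?d \<and> i ! K \<noteq> e ! K}" arbitrary: i rule: less_induct)
    case less
    show ?case
    proof (cases "\<exists>K<?d. i ! K \<noteq> e ! K")
      case False
      then have "i = e" using less.prems e(2) by (intro nth_equalityI) (auto simp: idx_def)
      then show ?thesis using w_e[of 0 "e ! 0"] ne eb(1)[of 0] by simp
    next
      case True
      then obtain K where K: "K < ?d" "i ! K \<noteq> e ! K" by blast
      let ?i = "i[K := e ! K]"
      have iK: "i ! K < n ! K" "length i = ?d" using less.prems K(1) by (auto simp: idx_def)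
      have "{L. L < ?d \<and> ?i ! L \<noteq> e ! L} \<subset> {L. L < ?d \<and> i ! L \<noteq> e ! L}"
        using K iK(2) by (auto simp: nth_list_update)
      then have "card {L. L < ?d \<and> ?i ! L \<noteq> e ! L} < card {L. L < ?d \<and> i ! L \<noteq> e ! L}"
        by (intro psubset_card_mono) auto
      then have vw: "v ?i = w ?i" using less.hyps idx_update[OF less.prems e(1)] by blast
      have ve: "v e = w e" using w_e[of 0 "e ! 0"] ne eb(1)[of 0] by simp
      have "v (e[K := i ! K]) = w (e[K := i ! K])" using w_e[OF K(1) iK(1)] by simp
      then have "?p i * v e + v i * ?p e = ?p i * w e + w i * ?p e"
        unfolding tangent_space_equation[OF v less.prems e(1) K(1)]
          tangent_space_equation[OF w' less.prems e(1) K(1)] vw by simp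
      then show ?thesis using \<open>?p e \<noteq> 0\<close> ve by simp
    qed
  qed
  moreover have "v i = w i" if "i \<notin> idx n" for i
    using v w_T tspace_subset_tensors[of n b] that by (auto simp: tangent_space_def tensors_def)
  ultimately have "v = w" by blast
  then show "v \<in> tspace n b" using w_T by simp
qed


section \<open>Linear equations of a join\<close>

lemma idx_Cons: "idx (m # n) = (\<lambda>(a, i). a # i) ` ({..<m} \<times> idx n)"
proof
  show "idx (m # n) \<subseteq> (\<lambda>(a, i). a # i) ` ({..<m} \<times> idx n)"
  proof
    fix i assume i: "i \<in> idx (m # n)"
    then obtain a i' where i': "i = a # i'" by (cases i) (auto simp: idx_def)
    have "a < m" using i by (force simp: i' idx_def)
    moreover have "i' ! I < n ! I" if "I < length n" for I
      using i that by (auto simp: i' idx_def dest!: spec[of _ "Suc I"])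
    ultimately show "i \<in> (\<lambda>(a, i). a # i) ` ({..<m} \<times> idx n)"
      using i by (auto simp: i' idx_def intro!: image_eqI[of _ _ "(a, i')"])
  qed
  show "(\<lambda>(a, i). a # i) ` ({..<m} \<times> idx n) \<subseteq> idx (m # n)"
    by (auto simp: idx_def nth_Cons split: nat.split)
qed

lemma finite_idx: "finite (idx n)" and card_idx: "card (idx n) = prod_list n"
proof -
  have "finite (idx n) \<and> card (idx n) = prod_list n"
  proof (induct n)
    case Nil
    have "idx [] = {[]}" by (auto simp: idx_def)
    then show ?case by simp
  next
    case (Cons m n)
    then show ?case
      by (auto simp: idx_Cons card_image inj_on_def card_cartesian_product)
  qed
  then show "finite (idx n)" "card (idx n) = prod_list n" by auto
qed

lemma form_linear:
  shows form_add: "form n q (x + y) = form n q x + form n q y"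
    and form_scale: "form n q (c *\<^sub>C x) = c * form n q x"
    and form_zero: "form n q 0 = 0"
    and form_sum: "form n q (\<Sum>a\<in>A. f a) = (\<Sum>a\<in>A. form n q (f a))"
    and form_commute: "form n q x = form n x q"
proof -
  show "form n q (x + y) = form n q x + form n q y" for x y
    by (simp add: form_def algebra_simps sum.distrib)
  show "form n q (c *\<^sub>C x) = c * form n q x" "form n q 0 = 0" "form n q x = form n x q" for x
    by (simp_all add: form_def smul_def sum_distrib_left algebra_simps)
  show "form n q (\<Sum>a\<in>A. f a) = (\<Sum>a\<in>A. form n q (f a))"
    by (simp add: form_def sum_fun_apply sum_distrib_left sum.swap[of _ _ "idx n"])
qed

lemma form_vanishes_on_span:
  assumes "\<And>x. x \<in> S \<Longrightarrow> form n q x = 0" "y \<in> tensor.span S"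
  shows "form n q y = 0"
  using assms(2)
proof (induct rule: tensor.span_induct_alt)
  case base
  show ?case by (rule form_zero)
next
  case (step c x y)
  then show ?case using assms(1) by (simp only: form_add form_scale) simp
qed

lemma tensors_basis:
  obtains A where "finite A" "card A = prod_list n" "tensor.independent A" "tensor.span A = tensors n"
proof -
  define E where "E j = (\<lambda>i. if i = j then 1 else 0 :: complex)" for j :: "nat list"
  have inj: "inj E" by (rule injI) (metis E_def zero_neq_one)
  have "tensor.independent (E ` idx n)"
  proof (rule tensor.independent_if_scalars_zero)
    fix f x assume s: "(\<Sum>x\<in>E ` idx n. f x *\<^sub>C x) = 0" and "x \<in> E ` idx n"
    then obtain j where j: "j \<in> idx n" "x = E j" by blast
    have "0 = (\<Sum>i\<in>idx n. f (E i) *\<^sub>C E i) j"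
      using s inj by (simp add: sum.reindex inj_on_def inj_def)
    also have "\<dots> = (\<Sum>i\<in>idx n. if i = j then f (E j) else 0)"
      by (auto simp: sum_fun_apply smul_def E_def intro!: sum.cong)
    finally show "f x = 0" using j finite_idx by simp
  qed (simp add: finite_idx)
  moreover have "tensor.span (E ` idx n) = tensors n"
  proof (rule antisym)
    have "tensor.subspace (tensors n)" by (auto simp: tensor.subspace_def tensors_def smul_def)
    then show "tensor.span (E ` idx n) \<subseteq> tensors n"
      by (intro tensor.span_minimal) (auto simp: tensors_def E_def)
    show "tensors n \<subseteq> tensor.span (E ` idx n)"
    proof
      fix x assume x: "x \<in> tensors n"
      have "x = (\<Sum>j\<in>idx n. x j *\<^sub>C E j)"
      proof
        fix i
        have "(\<Sum>j\<in>idx n. x j *\<^sub>C E j) i = (\<Sum>j\<in>idx n. if j = i then x i else 0)"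
          by (auto simp: sum_fun_apply smul_def E_def intro!: sum.cong)
        then show "x i = (\<Sum>j\<in>idx n. x j *\<^sub>C E j) i" using x finite_idx by (auto simp: tensors_def)
      qed
      then show "x \<in> tensor.span (E ` idx n)"
        by (metis (no_types, lifting) image_eqI tensor.span_base tensor.span_scale tensor.span_sum)
    qed
  qed
  ultimately show ?thesis
    using that[of "E ` idx n"] finite_idx card_idx[of n] inj by (simp add: card_image inj_on_def inj_def)
qed

text \<open>Each equation cuts down the dimension of the space of forms by at most one.\<close>

lemma annihilator_dim:
  assumes "finite S"
  shows "\<exists>A. finite A \<and> tensor.independent A \<and> A \<subseteq> {q \<in> tensors n. \<forall>s\<in>S. form n q s = 0} \<and>
    prod_list n \<le> card A + card S"
  using assms
proof (induct S)
  case empty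
  obtain A where "finite A" "card A = prod_list n" "tensor.independent A" "tensor.span A = tensors n"
    by (rule tensors_basis)
  then show ?case using tensor.span_superset[of A] by (intro exI[of _ A]) auto
next
  case (insert s S)
  let ?V = "\<lambda>S. {q \<in> tensors n. \<forall>s\<in>S. form n q s = 0}"
  obtain A where A: "finite A" "tensor.independent A" "A \<subseteq> ?V S" "prod_list n \<le> card A + card S"
    using insert by blast
  have sub: "tensor.subspace (?V S)" for S
    unfolding tensor.subspace_def
  proof (intro conjI ballI allI)
    show "0 \<in> ?V S" by (auto simp: tensors_def form_zero form_commute[of n 0])
    fix x assume x: "x \<in> ?V S"
    have "form n (c *\<^sub>C x) s = 0" if "s \<in> S" for c s
      using x that form_scale[of n s c x] form_commute[of n s x] form_commute[of n s "c *\<^sub>C x"] by auto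
    then show "c *\<^sub>C x \<in> ?V S" for c using x by (simp add: tensors_def smul_apply)
    fix y assume y: "y \<in> ?V S"
    have "form n (x + y) s = 0" if "s \<in> S" for s
      using x y that form_add[of n s x y] form_commute[of n s x] form_commute[of n s y]
        form_commute[of n s "x + y"] by auto
    then show "x + y \<in> ?V S" using x y by (simp add: tensors_def)
  qed
  have AV: "tensor.span A \<subseteq> ?V S" using A(3) by (intro tensor.span_minimal sub)
  obtain C where C: "C \<subseteq> tensor.span A \<inter> ?V (insert s S)" "tensor.independent C"
    "tensor.span A \<inter> ?V (insert s S) \<subseteq> tensor.span C"
    by (rule tensor.maximal_independent_subset)
  have fC: "finite C" using tensor.independent_span_bound[OF A(1) C(2)] C(1) by blast
  have "card A \<le> Suc (card C)"
  proof (cases "\<forall>a\<in>A. form n a s = 0")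
    case True
    then have "A \<subseteq> ?V (insert s S)" using A(3) by auto
    then have "A \<subseteq> tensor.span C" using C(3) tensor.span_superset[of A] by blast
    then show ?thesis using tensor.independent_span_bound[OF fC A(2)] by simp
  next
    case False
    then obtain a0 where a0: "a0 \<in> A" "form n a0 s \<noteq> 0" by blast
    have "a \<in> tensor.span (insert a0 C)" if a: "a \<in> A" for a
    proof -
      let ?c = "form n a s / form n a0 s"
      let ?x = "a - ?c *\<^sub>C a0"
      have x: "?x \<in> tensor.span A"
        using a a0 by (intro tensor.span_diff tensor.span_scale tensor.span_base)
      have "form n (?x + ?c *\<^sub>C a0) s = form n a s" by simp
      then have "form n ?x s + ?c * form n a0 s = form n a s"
        by (simp only: form_commute[of n _ s] form_add form_scale)
      then have "form n ?x s = 0" using a0(2) by simp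
      then have "?x \<in> tensor.span C" using x AV C(3) by auto
      then have "?x \<in> tensor.span (insert a0 C)" using tensor.span_mono[of C "insert a0 C"] by auto
      moreover have "?c *\<^sub>C a0 \<in> tensor.span (insert a0 C)"
        by (intro tensor.span_scale tensor.span_base) auto
      ultimately have "?x + ?c *\<^sub>C a0 \<in> tensor.span (insert a0 C)"
        by (rule tensor.span_add)
      then show ?thesis by simp
    qed
    then have "card A \<le> card (insert a0 C)"
      using tensor.independent_span_bound[of "insert a0 C" A] A(2) fC by auto
    also have "\<dots> \<le> Suc (card C)" by (rule card_insert_le_m1) auto
    finally show ?thesis .
  qed
  then show ?case using C fC A(4) insert(1,2) by (intro exI[of _ C]) auto
qed

text \<open>
  The forms vanishing on the join have dimension at most \<open>l\<close>, so the join needs many vectors to cut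
  them out.
\<close>

lemma nondefective_of_equations:
  assumes q: "is_basis l q (vanishing_forms n (join n r t))"
    and l: "int l = int (prod_list n) - int r * (int (segre_dim n) + 1)"
  shows "nondefective n r t"
proof -
  obtain A where A: "finite A" "tensor.span A = tensors n"
    by (rule tensors_basis[of n])
  have jT: "join n r t \<subseteq> tensor.span A"
    unfolding join_def A(2)[symmetric]
    using tspace_subset_tensors A(2) by (intro tensor.span_minimal tensor.subspace_span) auto
  obtain S where S: "S \<subseteq> join n r t" "tensor.independent S" "join n r t \<subseteq> tensor.span S"
    using tensor.maximal_independent_subset by metis
  have fS: "finite S" using tensor.independent_span_bound[OF A(1) S(2)] S(1) jT by auto
  obtain C where C: "finite C" "tensor.independent C" "C \<subseteq> {q \<in> tensors n. \<forall>s\<in>S. form n q s = 0}"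
    "prod_list n \<le> card C + card S" using annihilator_dim[OF fS] by blast
  have "{q \<in> tensors n. \<forall>s\<in>S. form n q s = 0} \<subseteq> vanishing_forms n (join n r t)"
    using form_vanishes_on_span[of S] S(3) by (auto simp: vanishing_forms_def)
  then have "C \<subseteq> tensor.span (q ` {..<l})" using C(3) q by (auto simp: is_basis_def)
  then have "card C \<le> card (q ` {..<l})"
    using tensor.independent_span_bound[of "q ` {..<l}" C] C(2) by auto
  also have "\<dots> \<le> l" using card_image_le[of "{..<l}" q] by simp
  finally have "prod_list n \<le> l + card S" using C(4) by simp
  then have "int r * (int (segre_dim n) + 1) \<le> int (card S)" using l by simp
  then have "r * (segre_dim n + 1) \<le> card S" by (metis (no_types, lifting) of_nat_1 of_nat_add of_nat_le_iff of_nat_mult)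
  then obtain S' where "S' \<subseteq> S" "card S' = r * (segre_dim n + 1)" "finite S'"
    using obtain_subset_with_card_n by metis
  then show ?thesis unfolding nondefective_def using S tensor.independent_mono[of S S'] by (intro exI[of _ S']) auto
qed


section \<open>The stacked Hessian\<close>

text \<open>The columns span the whole space, to which \<open>y\<close> is orthogonal.\<close>

lemma full_rank_left_kernel:
  fixes M :: "complex mat"
  assumes M: "M \<in> carrier_mat m k" and rank: "vec_space.rank m M = m"
    and y: "y \<in> carrier_vec m" and yM: "\<And>j. j < k \<Longrightarrow> y \<bullet> col M j = 0"
  shows "y = 0\<^sub>v m"
proof -
  interpret vec_space "TYPE(complex)" m .
  have cols: "set (cols M) \<subseteq> carrier_vec m" using M cols_dim by blast
  obtain S where S: "finite S" "maximal S (\<lambda>T. T \<subseteq> set (cols M) \<and> lin_indpt T)"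
    using maximal_exists_superset[of "set (cols M)" "\<lambda>T. T \<subseteq> set (cols M) \<and> lin_indpt T" "{}"]
    by (auto simp: lin_dep_def)
  have Sc: "S \<subseteq> carrier_vec m" and li: "lin_indpt S" and Scol: "S \<subseteq> set (cols M)"
    using S(2) cols by (auto simp: maximal_def)
  have "card S = m" using rank_card_indpt[OF M S(2)] rank by simp
  then have "basis S" using S(1) li Sc by (intro dim_li_is_basis) (auto simp: dim_is_n)
  then have span: "span S = carrier_vec m" by (simp add: basis_def)
  have "y \<in> orthogonal_complement S"
    unfolding orthogonal_complement_def
  proof (intro CollectI conjI ballI y)
    fix s assume "s \<in> S"
    then have "s \<in> set (cols M)" using Scol by blast
    then obtain j where "j < k" "s = col M j" using M by (auto simp: cols_def)
    then show "y \<bullet> s = 0" using yM by simp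
  qed
  then have "y \<in> orthogonal_complement (span S)" using in_orthogonal_complement_span[OF Sc] by simp
  then have "y \<in> orthogonal_complement (carrier_vec m)" by (simp add: span)
  then have "y \<bullet> unit_vec m i = 0" if "i < m" for i
    by (auto simp: orthogonal_complement_def)
  then show ?thesis using y by (intro eq_vecI) auto
qed

lemma set_hessian_positions: "set (hessian_positions n) = (SIGMA I:{..<length n}. {..<n ! I - 1})"
  by (auto simp: hessian_positions_def)

lemma length_hessian_positions: "length (hessian_positions n) = segre_dim n"
  by (simp add: hessian_positions_def segre_dim_sum length_concat comp_def sum_list_sum_nth atLeast0LessThan)

lemma distinct_hessian_positions: "distinct (hessian_positions n)"
proof -
  have "card (set (hessian_positions n)) = segre_dim n"
    by (simp add: set_hessian_positions segre_dim_sum)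
  then show ?thesis by (intro card_distinct) (simp add: length_hessian_positions)
qed

lemma sum_hessian_positions:
  "(\<Sum>a<segre_dim n. f (hessian_positions n ! a)) = (\<Sum>I<length n. \<Sum>i<n ! I - 1. f (I, i))"
proof -
  have "(\<Sum>a<segre_dim n. f (hessian_positions n ! a)) = (\<Sum>x\<in>set (hessian_positions n). f x)"
    using bij_betw_nth[OF distinct_hessian_positions[of n] refl refl]
    by (intro sum.reindex_bij_betw) (simp add: length_hessian_positions)
  then show ?thesis by (simp add: set_hessian_positions sum.Sigma)
qed

text \<open>
  In coordinates with respect to \<open>B\<close>, a vector in the kernel of the form that defines
  nondegeneracy gives a vector in the left kernel of the stacked Hessian, after its components along
  the first basis vectors are dropped.
\<close>

lemma nondegenerate_of_stacked_hessian:
  assumes H: "tensor.subspace H" "tspace n (\<lambda>I j. B I $$ (j, 0)) \<subseteq> H"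
    and pos: "\<forall>m\<in>set n. 1 \<le> m"
    and q: "\<And>a x. a < l \<Longrightarrow> x \<in> H \<Longrightarrow> form n (q a) x = 0"
    and B: "\<forall>I<length n. B I \<in> carrier_mat (n ! I) (n ! I) \<and> invertible_mat (B I)"
    and rank: "vec_space.rank (segre_dim n) (stacked_hessian n B l q) = segre_dim n"
  shows "nondegenerate n H (\<lambda>I j. B I $$ (j, 0))"
  unfolding nondegenerate_def
proof (intro allI impI)
  fix w J
  assume kernel: "\<forall>I<length n. \<forall>j<n ! I. (\<Sum>J\<in>{..<length n} - {I}.
      tens n ((\<lambda>I j. B I $$ (j, 0))(I := unit j, J := w J))) \<in> H"
    and J: "J < length n"
  let ?b = "\<lambda>I j. B I $$ (j, 0)"
  let ?d = "length n" and ?c = "\<lambda>I a j. B I $$ (j, a)"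
  define y where "y I = (SOME v. v \<in> carrier_vec (n ! I) \<and> B I *\<^sub>v v = vec (n ! I) (w I))" for I
  have y: "y I \<in> carrier_vec (n ! I)" "B I *\<^sub>v y I = vec (n ! I) (w I)" if I: "I < ?d" for I
  proof -
    have BI: "B I \<in> carrier_mat (n ! I) (n ! I)" using B I by blast
    obtain C where C: "inverts_mat (B I) C" "inverts_mat C (B I)"
      using B I by (auto simp: invertible_mat_def)
    have "dim_col (B I * C) = n ! I" "dim_col (C * B I) = dim_row C"
      using C BI by (auto simp: inverts_mat_def)
    then have CI: "C \<in> carrier_mat (n ! I) (n ! I)" using BI by auto
    have "B I *\<^sub>v (C *\<^sub>v vec (n ! I) (w I)) = vec (n ! I) (w I)"
      using C(1) BI CI by (subst assoc_mult_mat_vec[symmetric, of _ "n ! I" "n ! I" _ "n ! I"])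
        (auto simp: inverts_mat_def)
    then have "\<exists>v. v \<in> carrier_vec (n ! I) \<and> B I *\<^sub>v v = vec (n ! I) (w I)"
      using CI by (intro exI[of _ "C *\<^sub>v vec (n ! I) (w I)"]) auto
    from someI_ex[OF this] show "y I \<in> carrier_vec (n ! I)" "B I *\<^sub>v y I = vec (n ! I) (w I)"
      by (simp_all add: y_def)
  qed
  have w: "w I j = (\<Sum>a<n ! I. y I $ a * ?c I a j)" if I: "I < ?d" and j: "j < n ! I" for I j
  proof -
    have "w I j = (B I *\<^sub>v y I) $ j" using y(2)[OF I] j by simp
    also have "\<dots> = (\<Sum>a<n ! I. B I $$ (j, a) * y I $ a)"
      using y(1)[OF I] B I j by (auto simp: scalar_prod_def atLeast0LessThan intro!: sum.cong)
    finally show ?thesis by (simp add: mult.commute)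
  qed
  have kernel': "(\<Sum>J\<in>{..<?d} - {I}. tens n (?b(I := u, J := w J))) \<in> H" if I: "I < ?d" for I u
  proof -
    have "tens n (?b(I := u, J := w J)) = (\<Sum>j<n ! I. u j *\<^sub>C tens n (?b(I := unit j, J := w J)))"
      if "J \<in> {..<?d} - {I}" for J
      using tens_slot_expand[OF I, of "?b(J := w J)" u] that by (simp add: fun_upd_twist)
    then have "(\<Sum>J\<in>{..<?d} - {I}. tens n (?b(I := u, J := w J))) =
        (\<Sum>j<n ! I. u j *\<^sub>C (\<Sum>J\<in>{..<?d} - {I}. tens n (?b(I := unit j, J := w J))))"
      by (simp add: tensor.scale_sum_right sum.swap[of _ "{..<n ! I}"])
    also have "\<dots> \<in> H"
      by (rule tensor.subspace_sum[OF H(1)], rule tensor.subspace_scale[OF H(1)]) (use kernel I in auto)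
    finally show ?thesis .
  qed
  define k where "k a I i J j = coeff_wrt n B (q a) ((replicate ?d 0)[I := i + 1, J := j + 1])" for a I i J j
  have k: "k a I i J j = form n (q a) (tens n (?b(I := ?c I (i + 1), J := ?c J (j + 1))))"
    if "I < ?d" "J < ?d" "J \<noteq> I" "i + 1 < n ! I" "j + 1 < n ! J" for a I i J j
  proof -
    have "basis_tensor n B ((replicate ?d 0)[I := i + 1, J := j + 1]) =
        tens n (?b(I := ?c I (i + 1), J := ?c J (j + 1)))"
      unfolding basis_tensor_def outer_eq_tens
    proof (rule tens_cong)
      fix K m assume K: "K < ?d" and m: "m < n ! K"
      have "0 < n ! K" using m by simp
      then show "col (B K) ((replicate ?d 0)[I := i + 1, J := j + 1] ! K) $ m =
          (?b(I := ?c I (i + 1), J := ?c J (j + 1))) K m"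
        using that K m B[rule_format, OF K] by (auto simp: nth_list_update)
    qed
    then show ?thesis by (simp add: k_def coeff_wrt_def)
  qed
  have eqs: "(\<Sum>J\<in>{..<?d} - {I}. \<Sum>j<n ! J - 1. y J $ (j + 1) * k a I i J j) = 0"
    if a: "a < l" and I: "I < ?d" and i: "i < n ! I - 1" for a I i
  proof -
    let ?u = "?c I (i + 1)"
    have slot: "form n (q a) (tens n (?b(I := ?u, J := w J))) = (\<Sum>j<n ! J - 1. y J $ (j + 1) * k a I i J j)"
      if J: "J \<in> {..<?d} - {I}" for J
    proof -
      have "n ! J \<in> set n" using J by simp
      then have nJ: "n ! J = Suc (n ! J - 1)" using pos by fastforce
      have "tens n (?b(I := ?u, J := w J)) = tens n (?b(I := ?u, J := \<lambda>j. \<Sum>a<n ! J. y J $ a * ?c J a j))"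
        using J w by (intro tens_slot_cong) auto
      also have "\<dots> = (\<Sum>a<n ! J. y J $ a *\<^sub>C tens n (?b(I := ?u, J := ?c J a)))"
        using J by (intro tens_slot_sum) auto
      finally have "form n (q a) (tens n (?b(I := ?u, J := w J))) =
          (\<Sum>m<n ! J. y J $ m * form n (q a) (tens n (?b(I := ?u, J := ?c J m))))"
        by (simp only: form_sum form_scale)
      also have "\<dots> = (\<Sum>m<Suc (n ! J - 1). y J $ m * form n (q a) (tens n (?b(I := ?u, J := ?c J m))))"
        using nJ by simp
      also have "\<dots> = y J $ 0 * form n (q a) (tens n (?b(I := ?u, J := ?c J 0))) +
          (\<Sum>j<n ! J - 1. y J $ Suc j * form n (q a) (tens n (?b(I := ?u, J := ?c J (Suc j)))))"
        by (rule sum.lessThan_Suc_shift)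
      also have "?b(I := ?u, J := ?c J 0) = ?b(I := ?u)" using J by auto
      also have "form n (q a) (tens n (?b(I := ?u))) = 0"
        using H(2) tens_slot_in_tspace[OF I] by (intro q[OF a]) blast
      also have "(\<Sum>j<n ! J - 1. y J $ Suc j * form n (q a) (tens n (?b(I := ?u, J := ?c J (Suc j))))) =
          (\<Sum>j<n ! J - 1. y J $ (j + 1) * k a I i J j)"
        using J I i by (intro sum.cong) (auto simp: k)
      finally show ?thesis by (simp only: mult_zero_right add_0)
    qed
    have "0 = form n (q a) (\<Sum>J\<in>{..<?d} - {I}. tens n (?b(I := ?u, J := w J)))"
      using q[OF a kernel'[OF I]] by simp
    then show ?thesis by (simp only: form_sum slot cong: sum.cong)
  qed
  define Y where "Y = vec (segre_dim n) (\<lambda>a. case hessian_positions n ! a of (J, j) \<Rightarrow> y J $ (j + 1))"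
  let ?S = "stacked_hessian n B l q"
  have S: "?S \<in> carrier_mat (segre_dim n) (l * segre_dim n)" by (simp add: stacked_hessian_def)
  have "Y \<bullet> col ?S e = 0" if e: "e < l * segre_dim n" for e
  proof -
    let ?a = "e div segre_dim n"
    have m: "0 < segre_dim n" using e by (cases "segre_dim n") auto
    have a: "?a < l" using e by (simp add: less_mult_imp_div_less)
    have e': "e mod segre_dim n < segre_dim n" using m by simp
    obtain I i where Ii: "hessian_positions n ! (e mod segre_dim n) = (I, i)" by (cases "hessian_positions n ! (e mod segre_dim n)")
    then have "(I, i) \<in> set (hessian_positions n)" using e' length_hessian_positions[of n] by (metis nth_mem)
    then have I: "I < ?d" "i < n ! I - 1" by (auto simp: set_hessian_positions)
    let ?g = "\<lambda>(J, j). y J $ (j + 1) * hessian_entry n (coeff_wrt n B (q ?a)) (J, j) (I, i)"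
    have "Y \<bullet> col ?S e = (\<Sum>b<segre_dim n. ?g (hessian_positions n ! b))"
      using e e' by (auto simp: scalar_prod_def stacked_hessian_def hessian_def Y_def Ii atLeast0LessThan
          split: prod.split intro!: sum.cong)
    also have "\<dots> = (\<Sum>J<?d. \<Sum>j<n ! J - 1. ?g (J, j))" by (rule sum_hessian_positions)
    also have "\<dots> = (\<Sum>J\<in>{..<?d} - {I}. \<Sum>j<n ! J - 1. ?g (J, j))"
      by (rule sum.mono_neutral_right) auto
    also have "\<dots> = (\<Sum>J\<in>{..<?d} - {I}. \<Sum>j<n ! J - 1. y J $ (j + 1) * k ?a I i J j)"
      by (intro sum.cong refl) (auto simp: k_def list_update_swap)
    also have "\<dots> = 0" by (rule eqs[OF a I])
    finally show ?thesis .
  qed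
  then have Y0: "Y = 0\<^sub>v (segre_dim n)"
    by (intro full_rank_left_kernel[OF S rank]) (auto simp: Y_def)
  have y0: "y J $ (j + 1) = 0" if "j < n ! J - 1" for j
  proof -
    have "(J, j) \<in> set (hessian_positions n)" using J that by (simp add: set_hessian_positions)
    then obtain a where a: "a < segre_dim n" "hessian_positions n ! a = (J, j)"
      by (metis in_set_conv_nth length_hessian_positions)
    then show ?thesis using arg_cong[OF Y0, of "\<lambda>v. v $ a"] by (simp add: Y_def)
  qed
  have "n ! J \<in> set n" using J by simp
  then have nJ: "n ! J = Suc (n ! J - 1)" using pos by fastforce
  show "\<exists>c. \<forall>j<n ! J. w J j = c * B J $$ (j, 0)"
  proof (intro exI allI impI)
    fix j assume j: "j < n ! J"
    have "w J j = (\<Sum>a<Suc (n ! J - 1). y J $ a * ?c J a j)" using w[OF J j] nJ by simp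
    also have "\<dots> = y J $ 0 * ?c J 0 j + (\<Sum>a<n ! J - 1. y J $ Suc a * ?c J (Suc a) j)"
      by (rule sum.lessThan_Suc_shift)
    also have "(\<Sum>a<n ! J - 1. y J $ Suc a * ?c J (Suc a) j) = 0"
      using y0 by (intro sum.neutral) auto
    finally show "w J j = y J $ 0 * B J $$ (j, 0)" by simp
  qed
qed



section \<open>From one point to a generic point\<close>

definition independent_family :: "'q set \<Rightarrow> ('q \<Rightarrow> 'e \<Rightarrow> complex) \<Rightarrow> bool" where
  "independent_family Q x \<longleftrightarrow> (\<forall>c. (\<forall>e. (\<Sum>q\<in>Q. c q * x q e) = 0) \<longrightarrow> (\<forall>q\<in>Q. c q = 0))"

lemma independent_familyD:
  "independent_family Q x \<Longrightarrow> (\<And>e. (\<Sum>q\<in>Q. c q * x q e) = 0) \<Longrightarrow> q \<in> Q \<Longrightarrow> c q = 0"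
  by (auto simp: independent_family_def)

text \<open>
  Linear independence of vectors with polynomial entries is an open condition: eliminating a
  coordinate in which the first vector does not vanish keeps the entries polynomial.
\<close>

lemma independent_family_open:
  assumes K: "subring K" and Q: "finite Q"
    and u: "\<And>q e. q \<in> Q \<Longrightarrow> u q e \<in> polys K V"
    and ind: "independent_family Q (\<lambda>q e. u q e s0)"
  shows "\<exists>G\<in>polys K V. G s0 \<noteq> 0 \<and> (\<forall>s. G s \<noteq> 0 \<longrightarrow> independent_family Q (\<lambda>q e. u q e s))"
  using Q u ind
proof (induct Q arbitrary: u)
  case empty
  then show ?case
    using polys.const[OF subring_one[OF K], of V] by (intro bexI[of _ "\<lambda>s. 1"]) (auto simp: independent_family_def)
next
  case (insert p Q)
  have "\<exists>e0. u p e0 s0 \<noteq> 0"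
  proof (rule ccontr)
    assume "\<not> ?thesis"
    then have "(\<Sum>q\<in>insert p Q. (if q = p then 1 else 0) * u q e s0) = 0" for e
      by (intro sum.neutral) auto
    from independent_familyD[OF insert.prems(2) this, of p] show False by simp
  qed
  then obtain e0 where e0: "u p e0 s0 \<noteq> 0" by blast
  define v where "v q e = (\<lambda>s. u p e0 s * u q e s - u q e0 s * u p e s)" for q e
  have v: "v q e \<in> polys K V" if "q \<in> Q" for q e
    unfolding v_def using insert.prems(1) that by (intro polys_diff[OF K] polys.mult) auto
  have "independent_family Q (\<lambda>q e. v q e s0)"
    unfolding independent_family_def
  proof (intro allI impI ballI)
    fix c q assume c: "\<forall>e. (\<Sum>q\<in>Q. c q * v q e s0) = 0" and q: "q \<in> Q"
    define c' where "c' q = (if q = p then - (\<Sum>q\<in>Q. c q * u q e0 s0) else u p e0 s0 * c q)" for q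
    have "(\<Sum>q\<in>insert p Q. c' q * u q e s0) = 0" for e
    proof -
      have "(\<Sum>q\<in>insert p Q. c' q * u q e s0) = c' p * u p e s0 + (\<Sum>q\<in>Q. u p e0 s0 * c q * u q e s0)"
        using insert.hyps by (auto simp: c'_def intro!: sum.cong)
      also have "\<dots> = (\<Sum>q\<in>Q. c q * v q e s0)"
        by (simp add: c'_def v_def algebra_simps sum_subtractf sum_distrib_left)
      finally show ?thesis using c by simp
    qed
    from independent_familyD[OF insert.prems(2) this, of q] show "c q = 0"
      using q insert.hyps(2) e0 by (auto simp: c'_def split: if_splits)
  qed
  from insert.hyps(3)[OF v this] obtain G where G: "G \<in> polys K V" "G s0 \<noteq> 0"
    "\<And>s. G s \<noteq> 0 \<Longrightarrow> independent_family Q (\<lambda>q e. v q e s)" by blast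
  have "independent_family (insert p Q) (\<lambda>q e. u q e s)" if s: "u p e0 s * G s \<noteq> 0" for s
    unfolding independent_family_def
  proof (intro allI impI)
    fix c assume "\<forall>e. (\<Sum>q\<in>insert p Q. c q * u q e s) = 0"
    then have c: "c p * u p e s + (\<Sum>q\<in>Q. c q * u q e s) = 0" for e using insert.hyps by simp
    have "(\<Sum>q\<in>Q. c q * v q e s) = 0" for e
    proof -
      have "(\<Sum>q\<in>Q. c q * v q e s) = u p e0 s * (\<Sum>q\<in>Q. c q * u q e s) - (\<Sum>q\<in>Q. c q * u q e0 s) * u p e s"
        by (simp add: v_def algebra_simps sum_subtractf sum_distrib_left)
      also have "(\<Sum>q\<in>Q. c q * u q e s) = - (c p * u p e s)" using c[of e] by (simp add: eq_neg_iff_add_eq_0 add.commute)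
      also have "(\<Sum>q\<in>Q. c q * u q e0 s) = - (c p * u p e0 s)" using c[of e0] by (simp add: eq_neg_iff_add_eq_0 add.commute)
      finally show ?thesis by simp
    qed
    then have cQ: "c q = 0" if "q \<in> Q" for q
      using independent_familyD[OF G(3), of s c q] s that by auto
    then have "(\<Sum>q\<in>Q. c q * u q e0 s) = 0" by (intro sum.neutral) auto
    then have "c p = 0" using c[of e0] s by auto
    then show "\<forall>q\<in>insert p Q. c q = 0" using cQ by auto
  qed
  moreover have "(\<lambda>s. u p e0 s * G s) \<in> polys K V" using insert.prems(1) G(1) by (intro polys.mult) auto
  ultimately show ?case using e0 G(2) by (intro bexI[of _ "\<lambda>s. u p e0 s * G s"]) auto
qed

lemma independent_family_tensors:
  fixes x :: "'q \<Rightarrow> tensor"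
  assumes "finite Q" "independent_family Q x"
  shows "inj_on x Q" "tensor.independent (x ` Q)"
proof -
  show inj: "inj_on x Q"
  proof (rule inj_onI, rule ccontr)
    fix p q assume pq: "p \<in> Q" "q \<in> Q" "x p = x q" "p \<noteq> q"
    define c where "c a = (if a = p then 1 else if a = q then - 1 else 0 :: complex)" for a
    have "(\<Sum>a\<in>Q. c a * x a e) = 0" for e
    proof -
      have "(\<Sum>a\<in>Q. c a * x a e) = (\<Sum>a\<in>{p, q}. c a * x a e)"
        using pq assms(1) by (intro sum.mono_neutral_right) (auto simp: c_def)
      also have "\<dots> = c p * x p e + c q * x q e" using pq(4) by simp
      also have "\<dots> = 0" using pq(4) unfolding pq(3) by (simp add: c_def)
      finally show ?thesis .
    qed
    from independent_familyD[OF assms(2) this pq(1)] show False by (simp add: c_def)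
  qed
  show "tensor.independent (x ` Q)"
  proof (rule tensor.independent_if_scalars_zero)
    fix f a assume s: "(\<Sum>a\<in>x ` Q. f a *\<^sub>C a) = 0" and "a \<in> x ` Q"
    then obtain q where q: "q \<in> Q" "a = x q" by blast
    have "(\<Sum>q\<in>Q. f (x q) * x q e) = 0" for e
      using fun_cong[OF s, of e] by (simp add: sum.reindex[OF inj] sum_fun_apply smul_apply)
    from independent_familyD[OF assms(2) this q(1)] show "f a = 0" using q by simp
  qed (use assms(1) in simp)
qed

lemma independent_family_id:
  fixes A :: "tensor set"
  assumes "finite A" "tensor.independent A"
  shows "independent_family A (\<lambda>a. a)"
  unfolding independent_family_def
proof (intro allI impI ballI)
  fix c a assume c: "\<forall>e. (\<Sum>a\<in>A. c a * a e) = 0" and a: "a \<in> A"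
  have s: "(\<Sum>a\<in>A. c a *\<^sub>C a) = 0"
    by (rule ext) (simp add: c sum_fun_apply smul_apply)
  show "c a = 0"
  proof (rule ccontr)
    assume "c a \<noteq> 0"
    then have "tensor.dependent A"
      unfolding tensor.dependent_finite[OF assms(1)] using s a by (intro exI[of _ c] conjI bexI[of _ a])
    then show False using assms(2) by simp
  qed
qed

text \<open>A family of \<open>r\<close> rank-one tensors is given by the coordinates \<open>s (k, I, j)\<close> of all factors.\<close>

definition params :: "nat list \<Rightarrow> nat \<Rightarrow> (nat \<times> nat \<times> nat) set" where
  "params n r = (SIGMA k:{..<r}. SIGMA I:{..<length n}. {..<n ! I})"

definition factors :: "(nat \<times> nat \<times> nat \<Rightarrow> complex) \<Rightarrow> nat \<Rightarrow> nat \<Rightarrow> nat \<Rightarrow> complex" where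
  "factors s k I j = s (k, I, j)"

lemma finite_params: "finite (params n r)"
  by (simp add: params_def)

lemma tens_polys:
  assumes K: "subring K" and b: "\<And>I j. I < length n \<Longrightarrow> j < n ! I \<Longrightarrow> (\<lambda>s. b s I j) \<in> polys K V"
  shows "(\<lambda>s. tens n (b s) i) \<in> polys K V"
proof (cases "i \<in> idx n")
  case True
  then show ?thesis
    using polys_prod[OF K, of "{..<length n}" "\<lambda>I s. b s I (i ! I)" V] b by (simp add: tens_def idx_def)
next
  case False
  then show ?thesis using polys.const[OF subring_zero[OF K], of V] by (simp add: tens_def)
qed


lemma tens_unit_polys:
  assumes K: "subring K" and k: "k < r"
  shows "(\<lambda>s. tens n ((factors s k)(I := unit i)) e) \<in> polys K (params n r)"
    and "(\<lambda>s. tens n ((factors s k)(I := unit i, J := unit j)) e) \<in> polys K (params n r)"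
proof -
  have unit: "(\<lambda>s. unit j m) \<in> polys K (params n r)" for j m
    using polys.const[OF subring_zero[OF K]] polys.const[OF subring_one[OF K]]
    by (cases "m = j") (simp_all add: unit_def)
  have factor: "(\<lambda>s. factors s k L m) \<in> polys K (params n r)" if "L < length n" "m < n ! L" for L m
    unfolding factors_def using k that by (intro polys.var) (simp add: params_def)
  show "(\<lambda>s. tens n ((factors s k)(I := unit i)) e) \<in> polys K (params n r)"
  proof (rule tens_polys[OF K])
    fix L m assume "L < length n" "m < n ! L"
    then show "(\<lambda>s. ((factors s k)(I := unit i)) L m) \<in> polys K (params n r)"
      by (cases "L = I") (simp_all add: factor unit)
  qed
  show "(\<lambda>s. tens n ((factors s k)(I := unit i, J := unit j)) e) \<in> polys K (params n r)"
  proof (rule tens_polys[OF K])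
    fix L m assume "L < length n" "m < n ! L"
    then show "(\<lambda>s. ((factors s k)(I := unit i, J := unit j)) L m) \<in> polys K (params n r)"
      by (cases "L = I"; cases "L = J") (simp_all add: factor unit)
  qed
qed

lemma join_unit_span:
  "join n r t = tensor.span ((\<lambda>(k, I, j). tens n ((t k)(I := unit j))) ` params n r)" (is "_ = tensor.span ?X")
proof (rule antisym)
  have "dtens n (t k) w \<in> tensor.span ?X" if k: "k < r" for k w
    unfolding dtens_def
  proof (rule tensor.span_sum)
    fix I assume I: "I \<in> {..<length n}"
    have "tens n ((t k)(I := unit j)) \<in> tensor.span ?X" if "j < n ! I" for j
      using k I that by (intro tensor.span_base image_eqI[of _ _ "(k, I, j)"]) (auto simp: params_def)
    then show "tens n ((t k)(I := w I)) \<in> tensor.span ?X"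
      using I by (subst tens_slot_expand) (auto intro!: tensor.span_sum tensor.span_scale)
  qed
  then show "join n r t \<subseteq> tensor.span ?X"
    unfolding join_def by (intro tensor.span_minimal tensor.subspace_span) (auto simp: tspace_def)
  have "?X \<subseteq> join n r t"
    using tspace_subset_join tens_slot_in_tspace by (fastforce simp: params_def)
  then show "tensor.span ?X \<subseteq> join n r t"
    unfolding join_def by (intro tensor.span_minimal tensor.subspace_span)
qed

text \<open>
  The basis is given by an index set, so that the same choice of tangent vectors makes sense at
  other points.
\<close>

lemma nondefective_basis:
  assumes nd: "nondefective n r (factors s0)" and pos: "\<forall>m\<in>set n. 1 \<le> m"
  obtains Q where "Q \<subseteq> params n r" "card Q = r * (segre_dim n + 1)"
    "independent_family Q (\<lambda>(k, I, j). tens n ((factors s0 k)(I := unit j)))"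
proof -
  let ?x = "\<lambda>(k, I, j). tens n ((factors s0 k)(I := unit j))"
  obtain A where A: "A \<subseteq> join n r (factors s0)" "tensor.independent A" "finite A"
    "card A = r * (segre_dim n + 1)" using nd by (auto simp: nondefective_def)
  obtain C where C: "C \<subseteq> ?x ` params n r" "tensor.independent C" "?x ` params n r \<subseteq> tensor.span C"
    by (rule tensor.maximal_independent_subset)
  have fC: "finite C" using C(1) finite_params by (rule finite_subset[OF _ finite_imageI])
  have "A \<subseteq> tensor.span C"
    using A(1) tensor.span_minimal[OF C(3) tensor.subspace_span] unfolding join_unit_span by blast
  then have "r * (segre_dim n + 1) \<le> card C" using tensor.independent_span_bound[OF fC A(2)] A(4) by simp
  then obtain C' where C': "C' \<subseteq> C" "card C' = r * (segre_dim n + 1)" "finite C'"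
    by (rule obtain_subset_with_card_n)
  have ind: "tensor.independent C'" using C(2) C'(1) by (rule tensor.independent_mono)
  define g where "g = inv_into (params n r) ?x"
  have g: "g a \<in> params n r \<and> ?x (g a) = a" if "a \<in> C'" for a
  proof -
    have "a \<in> ?x ` params n r" using C(1) C'(1) that by blast
    then show ?thesis unfolding g_def by (intro conjI inv_into_into f_inv_into_f)
  qed
  have inj: "inj_on g C'" by (rule inj_on_inverseI[of _ ?x]) (simp only: g)
  have "independent_family (g ` C') ?x"
    unfolding independent_family_def
  proof (intro allI impI ballI)
    fix c q assume c: "\<forall>e. (\<Sum>q\<in>g ` C'. c q * ?x q e) = 0" and "q \<in> g ` C'"
    then obtain a where a: "a \<in> C'" "q = g a" by blast
    have "(\<Sum>a\<in>C'. c (g a) * a e) = 0" for e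
    proof -
      have "(\<Sum>a\<in>C'. c (g a) * a e) = (\<Sum>a\<in>C'. c (g a) * ?x (g a) e)"
        by (rule sum.cong) (simp_all only: g)
      then show ?thesis using c by (simp add: sum.reindex[OF inj])
    qed
    from independent_familyD[OF independent_family_id[OF C'(3) ind] this a(1)] show "c q = 0" using a by simp
  qed
  moreover have "g ` C' \<subseteq> params n r" using g by blast
  moreover have "card (g ` C') = r * (segre_dim n + 1)" using C'(2) inj by (simp add: card_image)
  ultimately show ?thesis by (rule that[rotated 2])
qed

lemma basis_spans_join:
  assumes pos: "\<forall>m\<in>set n. 1 \<le> m" and Q: "Q \<subseteq> params n r" "card Q = r * (segre_dim n + 1)"
    and ind: "independent_family Q (\<lambda>(k, I, j). tens n ((t k)(I := unit j)))"
  shows "nondefective n r t"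
    and "h \<in> join n r t \<Longrightarrow> \<exists>c. h = (\<Sum>q\<in>Q. c q *\<^sub>C (case q of (k, I, j) \<Rightarrow> tens n ((t k)(I := unit j))))"
proof -
  let ?x = "\<lambda>(k, I, j). tens n ((t k)(I := unit j))"
  have fQ: "finite Q" using Q(1) finite_params by (rule finite_subset)
  note I = independent_family_tensors[OF fQ ind]
  have sub: "?x ` Q \<subseteq> join n r t"
    unfolding join_unit_span using Q(1) tensor.span_superset by blast
  have card: "card (?x ` Q) = r * (segre_dim n + 1)" using I(1) Q(2) by (simp add: card_image)
  show nd: "nondefective n r t"
    unfolding nondefective_def using sub I(2) fQ card by (intro exI[of _ "?x ` Q"]) auto
  assume h: "h \<in> join n r t"
  have "h \<in> tensor.span (?x ` Q)"
  proof (rule ccontr)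
    assume n: "h \<notin> tensor.span (?x ` Q)"
    have "\<forall>k. \<exists>S. finite S \<and> card S \<le> segre_dim n + 1 \<and> tspace n (t k) \<subseteq> tensor.span S"
      using tspace_span[OF pos] by metis
    then obtain S where S: "\<And>k. finite (S k)" "\<And>k. card (S k) \<le> segre_dim n + 1"
      "\<And>k. tspace n (t k) \<subseteq> tensor.span (S k)" by metis
    have "tspace n (t k) \<subseteq> tensor.span (\<Union>k<r. S k)" if "k < r" for k
      using S(3)[of k] tensor.span_mono[of "S k" "\<Union>k<r. S k"] that by blast
    then have "join n r t \<subseteq> tensor.span (\<Union>k<r. S k)"
      unfolding join_def by (intro tensor.span_minimal tensor.subspace_span) auto
    then have "insert h (?x ` Q) \<subseteq> tensor.span (\<Union>k<r. S k)" using sub h by blast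
    moreover have "tensor.independent (insert h (?x ` Q))" using n I(2) by (rule tensor.independent_insertI)
    ultimately have "card (insert h (?x ` Q)) \<le> card (\<Union>k<r. S k)"
      using tensor.independent_span_bound[of "\<Union>k<r. S k" "insert h (?x ` Q)"] S(1) by auto
    also have "\<dots> \<le> r * (segre_dim n + 1)"
      using order_trans[OF card_UN_le[of "{..<r}" S] sum_bounded_above[of "{..<r}" "\<lambda>k. card (S k)" "segre_dim n + 1"]] S(2)
      by simp
    finally have le: "card (insert h (?x ` Q)) \<le> r * (segre_dim n + 1)" .
    have "h \<notin> ?x ` Q" using n tensor.span_base by blast
    then have "card (insert h (?x ` Q)) = Suc (r * (segre_dim n + 1))"
      using card_insert_disjoint[OF finite_imageI[OF fQ]] card by metis
    then show False using le by simp
  qed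
  then obtain f where "h = (\<Sum>a\<in>?x ` Q. f a *\<^sub>C a)"
    unfolding tensor.span_finite[OF finite_imageI[OF fQ]] by (rule rangeE)
  then have "h = (\<Sum>q\<in>Q. f (?x q) *\<^sub>C ?x q)" by (simp add: sum.reindex[OF I(1)])
  then show "\<exists>c. h = (\<Sum>q\<in>Q. c q *\<^sub>C ?x q)" by (intro exI[of _ "\<lambda>q. f (?x q)"])
qed

text \<open>
  The kernel of the Hessian at \<open>t k\<close> modulo the rescalings is the space of relations between a
  family of vectors: the rows of the Hessian in the directions \<open>unit j\<close> with \<open>j \<noteq> e J\<close>, where the
  \<open>e J\<close>-th entry of the factor does not vanish, together with a copy of a basis of the join for
  every row index.
\<close>

definition hessian_family ::
  "nat list \<Rightarrow> (nat \<Rightarrow> nat \<Rightarrow> nat \<Rightarrow> complex) \<Rightarrow> nat \<Rightarrow>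
   (nat \<times> nat) + ((nat \<times> nat \<times> nat) \<times> (nat \<times> nat)) \<Rightarrow> (nat \<times> nat) \<times> nat list \<Rightarrow> complex" where
  "hessian_family n t k x = (\<lambda>((I, i), e). if I < length n \<and> i < n ! I then (case x of
     Inl (J, j) \<Rightarrow> if J = I then 0 else tens n ((t k)(I := unit i, J := unit j)) e
   | Inr ((l, L, m), (I', i')) \<Rightarrow> if I' = I \<and> i' = i then tens n ((t l)(L := unit m)) e else 0) else 0)"

definition hessian_indices ::
  "nat list \<Rightarrow> (nat \<Rightarrow> nat) \<Rightarrow> (nat \<times> nat \<times> nat) set \<Rightarrow> ((nat \<times> nat) + ((nat \<times> nat \<times> nat) \<times> (nat \<times> nat))) set" where
  "hessian_indices n e Q = Inl ` (SIGMA J:{..<length n}. {..<n ! J} - {e J}) \<union>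
     Inr ` (Q \<times> (SIGMA I:{..<length n}. {..<n ! I}))"

lemma finite_hessian_indices: "finite Q \<Longrightarrow> finite (hessian_indices n e Q)"
  by (auto simp: hessian_indices_def)

lemma hessian_family_sum:
  assumes fQ: "finite Q" and I: "I < length n" "i < n ! I"
  shows "(\<Sum>x\<in>hessian_indices n e Q. c x * hessian_family n t k x ((I, i), a)) =
    ((\<Sum>J\<in>{..<length n} - {I}. tens n ((t k)(I := unit i, J := \<lambda>j. if j = e J then 0 else c (Inl (J, j))))) +
    (\<Sum>q\<in>Q. c (Inr (q, (I, i))) *\<^sub>C (case q of (l, L, m) \<Rightarrow> tens n ((t l)(L := unit m))))) a"
proof -
  let ?M = "SIGMA I:{..<length n}. {..<n ! I}" and ?N = "SIGMA J:{..<length n}. {..<n ! J} - {e J}"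
  let ?f = "\<lambda>x. c x * hessian_family n t k x ((I, i), a)"
  have "sum ?f (hessian_indices n e Q) = sum ?f (Inl ` ?N) + sum ?f (Inr ` (Q \<times> ?M))"
    unfolding hessian_indices_def using fQ by (intro sum.union_disjoint) auto
  also have "sum ?f (Inl ` ?N) = (\<Sum>(J, j)\<in>?N. ?f (Inl (J, j)))"
    by (subst sum.reindex) (auto simp: split_def)
  also have "\<dots> = (\<Sum>J<length n. \<Sum>j\<in>{..<n ! J} - {e J}. ?f (Inl (J, j)))"
    by (subst sum.Sigma) auto
  also have "\<dots> = (\<Sum>J\<in>{..<length n} - {I}. \<Sum>j\<in>{..<n ! J} - {e J}. ?f (Inl (J, j)))"
    using I by (intro sum.mono_neutral_right) (auto simp: hessian_family_def)
  also have "\<dots> = (\<Sum>J\<in>{..<length n} - {I}. tens n ((t k)(I := unit i, J := \<lambda>j. if j = e J then 0 else c (Inl (J, j)))) a)"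
  proof (rule sum.cong[OF refl])
    fix J assume J: "J \<in> {..<length n} - {I}"
    then have J': "J < length n" by simp
    have "tens n ((t k)(I := unit i, J := \<lambda>j. if j = e J then 0 else c (Inl (J, j)))) a =
        (\<Sum>j<n ! J. (if j = e J then 0 else c (Inl (J, j))) * tens n ((t k)(I := unit i, J := unit j)) a)"
      by (subst tens_slot_expand[OF J']) (simp add: sum_fun_apply smul_apply)
    also have "\<dots> = (\<Sum>j\<in>{..<n ! J} - {e J}. ?f (Inl (J, j)))"
      using J I by (intro sum.mono_neutral_cong_right) (auto simp: hessian_family_def)
    finally show "(\<Sum>j\<in>{..<n ! J} - {e J}. ?f (Inl (J, j))) =
        tens n ((t k)(I := unit i, J := \<lambda>j. if j = e J then 0 else c (Inl (J, j)))) a" ..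
  qed
  also have "sum ?f (Inr ` (Q \<times> ?M)) = (\<Sum>(q, p)\<in>Q \<times> ?M. ?f (Inr (q, p)))"
    by (subst sum.reindex) (auto simp: split_def)
  also have "\<dots> = (\<Sum>q\<in>Q. \<Sum>p\<in>?M. ?f (Inr (q, p)))"
    by (rule sum.cartesian_product[symmetric])
  also have "\<dots> = (\<Sum>q\<in>Q. ?f (Inr (q, (I, i))))"
  proof (rule sum.cong[OF refl])
    fix q
    have "(\<Sum>p\<in>?M. ?f (Inr (q, p))) = (\<Sum>p\<in>{(I, i)}. ?f (Inr (q, p)))"
      using I by (intro sum.mono_neutral_right) (auto simp: hessian_family_def split: prod.split)
    then show "(\<Sum>p\<in>?M. ?f (Inr (q, p))) = ?f (Inr (q, (I, i)))" by simp
  qed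
  also have "\<dots> = (\<Sum>q\<in>Q. c (Inr (q, (I, i))) * (case q of (l, L, m) \<Rightarrow> tens n ((t l)(L := unit m))) a)"
    using I by (intro sum.cong refl) (auto simp: hessian_family_def)
  finally show ?thesis by (simp only: plus_fun_apply sum_fun_apply smul_apply)
qed

lemma hessian_family_independent_iff:
  assumes pos: "\<forall>m\<in>set n. 1 \<le> m" and Q: "Q \<subseteq> params n r" "card Q = r * (segre_dim n + 1)"
    and ind: "independent_family Q (\<lambda>(k, I, j). tens n ((t k)(I := unit j)))"
    and k: "k < r" and e: "\<And>J. J < length n \<Longrightarrow> e J < n ! J \<and> t k J (e J) \<noteq> 0"
  shows "independent_family (hessian_indices n e Q) (hessian_family n t k) \<longleftrightarrow> nondegenerate n (join n r t) (t k)"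
    (is "?ind \<longleftrightarrow> ?nondeg")
proof
  let ?x = "\<lambda>(k, I, j). tens n ((t k)(I := unit j))"
  let ?H = "join n r t"
  have fQ: "finite Q" using Q(1) finite_params by (rule finite_subset)
  have H: "tensor.subspace ?H" by (simp add: join_def tensor.subspace_span)
  have Q_H: "?x q \<in> ?H" if "q \<in> Q" for q
    unfolding join_unit_span using Q(1) that by (intro tensor.span_base imageI) auto
  {
    assume ?nondeg
    show ?ind
      unfolding independent_family_def
    proof (intro allI impI)
      fix c assume c: "\<forall>a. (\<Sum>x\<in>hessian_indices n e Q. c x * hessian_family n t k x a) = 0"
      let ?w = "\<lambda>J j. if j = e J then 0 else c (Inl (J, j))"
      let ?s = "\<lambda>I i. \<Sum>J\<in>{..<length n} - {I}. tens n ((t k)(I := unit i, J := ?w J))"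
      let ?r = "\<lambda>I i. \<Sum>q\<in>Q. c (Inr (q, (I, i))) *\<^sub>C ?x q"
      have rel: "?s I i + ?r I i = 0" if "I < length n" "i < n ! I" for I i
      proof
        fix a
        show "(?s I i + ?r I i) a = 0 a"
          unfolding hessian_family_sum[OF fQ that, symmetric] using c by simp
      qed
      have "?s I i \<in> ?H" if "I < length n" "i < n ! I" for I i
      proof -
        have "?s I i = - ?r I i" using rel[OF that] by (simp add: eq_neg_iff_add_eq_0)
        also have "\<dots> \<in> ?H"
          using Q_H by (intro tensor.subspace_neg[OF H] tensor.subspace_sum[OF H] tensor.subspace_scale[OF H])
        finally show ?thesis .
      qed
      then have rescaled: "\<forall>J<length n. \<exists>d. \<forall>j<n ! J. ?w J j = d * t k J j"
        using \<open>?nondeg\<close>[unfolded nondegenerate_def, THEN spec[of _ ?w]] by blast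
      have w0: "?w J j = 0" if J: "J < length n" and j: "j < n ! J" for J j
      proof -
        obtain d where d: "\<forall>j<n ! J. ?w J j = d * t k J j" using rescaled J by blast
        from d[THEN spec[of _ "e J"]] have "d = 0" using e[OF J] by simp
        then show ?thesis using d j by simp
      qed
      have "c x = 0" if x: "x \<in> hessian_indices n e Q" for x
      proof (cases x)
        case (Inl p)
        then obtain J j where "x = Inl (J, j)" "J < length n" "j < n ! J" "j \<noteq> e J"
          using x by (auto simp: hessian_indices_def)
        then show ?thesis using w0[of J j] by simp
      next
        case (Inr p)
        then obtain q I i where qIi: "x = Inr (q, (I, i))" "q \<in> Q" "I < length n" "i < n ! I"
          using x by (auto simp: hessian_indices_def)
        have "?s I i = 0"
        proof (rule sum.neutral, rule ballI)
          fix J assume "J \<in> {..<length n} - {I}"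
          then show "tens n ((t k)(I := unit i, J := ?w J)) = 0"
            using w0 by (intro tens_zero[of J]) auto
        qed
        then have "?r I i = 0" using rel[OF qIi(3,4)] by simp
        then have "?r I i a = 0" for a by (simp only: zero_fun_apply)
        then have "(\<Sum>q\<in>Q. c (Inr (q, (I, i))) * ?x q a) = 0" for a
          by (simp only: sum_fun_apply smul_apply)
        from independent_familyD[OF ind this qIi(2)] show ?thesis using qIi(1) by simp
      qed
      then show "\<forall>x\<in>hessian_indices n e Q. c x = 0" by blast
    qed
  }
  {
    assume ?ind
    show ?nondeg
      unfolding nondegenerate_def
    proof (intro allI impI)
      fix w J0
      assume w: "\<forall>I<length n. \<forall>j<n ! I. (\<Sum>J\<in>{..<length n} - {I}. tens n ((t k)(I := unit j, J := w J))) \<in> ?H"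
        and J0: "J0 < length n"
      define d where "d J = w J (e J) / t k J (e J)" for J
      define w' where "w' J j = w J j - d J * t k J j" for J j
      have w'e: "w' J (e J) = 0" if "J < length n" for J using e[OF that] by (simp add: w'_def d_def)
      let ?s = "\<lambda>I i. \<Sum>J\<in>{..<length n} - {I}. tens n ((t k)(I := unit i, J := w' J))"
      have "?s I i \<in> ?H" if I: "I < length n" and i: "i < n ! I" for I i
      proof -
        have "?s I i = (\<Sum>J\<in>{..<length n} - {I}. tens n ((t k)(I := unit i, J := w J)) - d J *\<^sub>C tens n ((t k)(I := unit i)))"
        proof (rule sum.cong[OF refl])
          fix J assume J: "J \<in> {..<length n} - {I}"
          then have J': "J < length n" by simp
          have "(t k)(I := unit i, J := t k J) = (t k)(I := unit i)" using J by auto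
          then show "tens n ((t k)(I := unit i, J := w' J)) =
              tens n ((t k)(I := unit i, J := w J)) - d J *\<^sub>C tens n ((t k)(I := unit i))"
            unfolding w'_def using tens_slot_diff[OF J', of "(t k)(I := unit i)" "w J" "\<lambda>j. d J * t k J j"]
              tens_slot_scale[OF J', of "(t k)(I := unit i)" "d J" "t k J"] by simp
        qed
        also have "\<dots> = (\<Sum>J\<in>{..<length n} - {I}. tens n ((t k)(I := unit i, J := w J))) -
            (\<Sum>J\<in>{..<length n} - {I}. d J *\<^sub>C tens n ((t k)(I := unit i)))"
          by (rule sum_subtractf)
        also have "\<dots> \<in> ?H"
        proof (rule tensor.subspace_diff[OF H])
          show "(\<Sum>J\<in>{..<length n} - {I}. tens n ((t k)(I := unit i, J := w J))) \<in> ?H" using w I i by blast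
          have "tens n ((t k)(I := unit i)) \<in> ?H"
            using tspace_subset_join[OF k, of n t] tens_slot_in_tspace[OF I] by blast
          then show "(\<Sum>J\<in>{..<length n} - {I}. d J *\<^sub>C tens n ((t k)(I := unit i))) \<in> ?H"
            by (intro tensor.subspace_sum[OF H] tensor.subspace_scale[OF H])
        qed
        finally show ?thesis .
      qed
      then have ex: "\<exists>c. ?s I i = (\<Sum>q\<in>Q. c q *\<^sub>C ?x q)" if "I < length n" "i < n ! I" for I i
        using basis_spans_join(2)[OF pos Q ind] that by blast
      define c where "c I i = (SOME c. ?s I i = (\<Sum>q\<in>Q. c q *\<^sub>C ?x q))" for I i
      have c: "?s I i = (\<Sum>q\<in>Q. c I i q *\<^sub>C ?x q)" if "I < length n" "i < n ! I" for I i
        unfolding c_def by (rule someI_ex[OF ex[OF that]])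
      define f where "f x = (case x of Inl (J, j) \<Rightarrow> w' J j | Inr (q, (I, i)) \<Rightarrow> - c I i q)" for x
      have "(\<Sum>x\<in>hessian_indices n e Q. f x * hessian_family n t k x a) = 0" for a
      proof -
        obtain I i e' where a: "a = ((I, i), e')" by (metis prod.exhaust)
        show ?thesis
        proof (cases "I < length n \<and> i < n ! I")
          case True
          then have I: "I < length n" "i < n ! I" by auto
          have "(\<Sum>J\<in>{..<length n} - {I}. tens n ((t k)(I := unit i, J := \<lambda>j. if j = e J then 0 else f (Inl (J, j))))) = ?s I i"
          proof (rule sum.cong[OF refl])
            fix J assume "J \<in> {..<length n} - {I}"
            then have "(\<lambda>j. if j = e J then 0 else f (Inl (J, j))) = w' J"
              using w'e by (auto simp: f_def fun_eq_iff)
            then show "tens n ((t k)(I := unit i, J := \<lambda>j. if j = e J then 0 else f (Inl (J, j)))) =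
                tens n ((t k)(I := unit i, J := w' J))" by simp
          qed
          moreover have "(\<Sum>q\<in>Q. f (Inr (q, (I, i))) *\<^sub>C ?x q) = - ?s I i"
            unfolding c[OF I] by (simp add: f_def tensor.scale_minus_left sum_negf)
          ultimately show ?thesis unfolding a hessian_family_sum[OF fQ I] by simp
        next
          case False
          then show ?thesis by (intro sum.neutral) (auto simp: a hessian_family_def)
        qed
      qed
      then have f0: "f x = 0" if "x \<in> hessian_indices n e Q" for x
        using independent_familyD[OF \<open>?ind\<close>, of f x] that by blast
      have "w' J0 j = 0" if j: "j < n ! J0" for j
      proof (cases "j = e J0")
        case True
        then show ?thesis using w'e[OF J0] by simp
      next
        case False
        then have "Inl (J0, j) \<in> hessian_indices n e Q" using J0 j by (auto simp: hessian_indices_def)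
        from f0[OF this] show ?thesis by (simp add: f_def)
      qed
      then show "\<exists>c. \<forall>j<n ! J0. w J0 j = c * t k J0 j"
        by (intro exI[of _ "d J0"]) (auto simp: w'_def)
    qed
  }
qed

lemma generic_nonzero:
  "generic K V t \<Longrightarrow> G \<in> polys K V \<Longrightarrow> G s0 \<noteq> 0 \<Longrightarrow> G t \<noteq> 0"
  by (auto simp: generic_def)

text \<open>
  Both conditions say that families of vectors are independent whose entries are polynomials in the
  parameters with coefficients \<open>0\<close> and \<open>1\<close>. The polynomials that witness this at \<open>s0\<close> are not zero, so
  they do not vanish at \<open>t\<close>.
\<close>

lemma generic_nondegenerate:
  assumes K: "subring K" and t: "generic K (params n r) t"
    and pos: "\<forall>m\<in>set n. 1 \<le> m" and k: "k < r"
    and nd: "nondefective n r (factors s0)"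
    and nz: "\<And>J. J < length n \<Longrightarrow> \<exists>j<n ! J. factors s0 k J j \<noteq> 0"
    and nondeg: "nondegenerate n (join n r (factors s0)) (factors s0 k)"
  shows "nondefective n r (factors t)" "nondegenerate n (join n r (factors t)) (factors t k)"
proof -
  obtain Q where Q: "Q \<subseteq> params n r" "card Q = r * (segre_dim n + 1)"
    "independent_family Q (\<lambda>(k, I, j). tens n ((factors s0 k)(I := unit j)))"
    by (rule nondefective_basis[OF nd pos])
  have fQ: "finite Q" using Q(1) finite_params by (rule finite_subset)
  obtain e where e: "\<And>J. J < length n \<Longrightarrow> e J < n ! J \<and> factors s0 k J (e J) \<noteq> 0" using nz by metis
  define u where "u q a s = (case q of (k, I, j) \<Rightarrow> tens n ((factors s k)(I := unit j))) a" for q a s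
  have "u q a \<in> polys K (params n r)" if "q \<in> Q" for q a
  proof -
    obtain l L m where q: "q = (l, L, m)" by (metis prod.exhaust)
    then have "l < r" using that Q(1) by (auto simp: params_def)
    then show ?thesis unfolding q u_def prod.case by (rule tens_unit_polys(1)[OF K])
  qed
  moreover have "independent_family Q (\<lambda>q a. u q a s0)" unfolding u_def by (rule Q(3))
  ultimately have "\<exists>G\<in>polys K (params n r). G s0 \<noteq> 0 \<and> (\<forall>s. G s \<noteq> 0 \<longrightarrow> independent_family Q (\<lambda>q a. u q a s))"
    by (rule independent_family_open[OF K fQ])
  then obtain G where G: "G \<in> polys K (params n r)" "G s0 \<noteq> 0"
    "\<And>s. G s \<noteq> 0 \<Longrightarrow> independent_family Q (\<lambda>q a. u q a s)" by blast
  have indt: "independent_family Q (\<lambda>(k, I, j). tens n ((factors t k)(I := unit j)))"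
    using G(3)[OF generic_nonzero[OF t G(1,2)]] unfolding u_def .
  show "nondefective n r (factors t)" by (rule basis_spans_join(1)[OF pos Q(1,2) indt])
  have et: "e J < n ! J \<and> factors t k J (e J) \<noteq> 0" if J: "J < length n" for J
  proof -
    have "(\<lambda>s. s (k, J, e J)) \<in> polys K (params n r)"
      using e[OF J] J k by (intro polys.var) (auto simp: params_def)
    from generic_nonzero[OF t this, of s0] show ?thesis using e[OF J] by (simp add: factors_def)
  qed
  let ?N = "hessian_indices n e Q"
  define v where "v x a s = hessian_family n (factors s) k x a" for x a s
  have "v x a \<in> polys K (params n r)" if x: "x \<in> ?N" for x a
  proof -
    obtain I i a' where a: "a = ((I, i), a')" by (metis prod.exhaust)
    have zero: "(\<lambda>s. 0) \<in> polys K (params n r)" by (rule polys.const[OF subring_zero[OF K]])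
    have "(\<lambda>s. hessian_family n (factors s) k x a) \<in> polys K (params n r)"
    proof (cases x)
      case (Inl p)
      then obtain J j where "x = Inl (J, j)" by (metis prod.exhaust)
      then show ?thesis using zero tens_unit_polys(2)[OF K k]
        by (cases "I < length n"; cases "i < n ! I"; cases "J = I")
          (simp_all add: hessian_family_def a del: fun_upd_apply)
    next
      case (Inr p)
      then obtain l L m I' i' where p: "x = Inr ((l, L, m), (I', i'))" by (metis prod.exhaust)
      then have "l < r" using x Q(1) by (auto simp: hessian_indices_def params_def)
      then show ?thesis using p zero tens_unit_polys(1)[OF K]
        by (cases "I < length n"; cases "i < n ! I"; cases "I' = I"; cases "i' = i")
          (simp_all add: hessian_family_def a del: fun_upd_apply)
    qed
    then show ?thesis unfolding v_def .
  qed
  moreover have "independent_family ?N (\<lambda>x a. v x a s0)"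
    unfolding v_def by (rule iffD2[OF hessian_family_independent_iff[OF pos Q k e] nondeg])
  ultimately have "\<exists>F\<in>polys K (params n r). F s0 \<noteq> 0 \<and> (\<forall>s. F s \<noteq> 0 \<longrightarrow> independent_family ?N (\<lambda>x a. v x a s))"
    by (rule independent_family_open[OF K finite_hessian_indices[OF fQ]])
  then obtain F where F: "F \<in> polys K (params n r)" "F s0 \<noteq> 0"
    "\<And>s. F s \<noteq> 0 \<Longrightarrow> independent_family ?N (\<lambda>x a. v x a s)" by blast
  show "nondegenerate n (join n r (factors t)) (factors t k)"
    by (rule iffD1[OF hessian_family_independent_iff[OF pos Q(1,2) indt k et]
          F(3)[OF generic_nonzero[OF t F(1,2)], unfolded v_def]])
qed



section \<open>Secant varieties\<close>

definition decomp :: "nat list \<Rightarrow> nat \<Rightarrow> (nat \<times> nat \<times> nat \<Rightarrow> complex) \<Rightarrow> tensor" where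
  "decomp n r s = (\<Sum>k<r. tens n (factors s k))"

lemma factor_tens_polys:
  assumes "subring K" "k < r"
  shows "(\<lambda>s. tens n (factors s k) i) \<in> polys K (params n r)"
  using assms by (intro tens_polys) (auto simp: factors_def params_def intro!: polys.var)

lemma decomp_polys: "subring K \<Longrightarrow> (\<lambda>s. decomp n r s i) \<in> polys K (params n r)"
  unfolding decomp_def sum_fun_apply by (intro polys_sum factor_tens_polys) auto

lemma decomp_tensors: "decomp n r s \<in> tensors n"
  by (auto simp: decomp_def tensors_def sum_fun_apply tens_def)

lemma decomp_cong: "(\<And>v. v \<in> params n r \<Longrightarrow> s v = s' v) \<Longrightarrow> decomp n r s = decomp n r s'"
  by (auto simp: fun_eq_iff intro!: polys_cong[OF decomp_polys[OF subring_UNIV]])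

text \<open>Coefficients are absorbed into the first factors.\<close>

lemma combination_decomp:
  assumes ne: "n \<noteq> []" and p: "\<And>k. k < r \<Longrightarrow> p k \<in> segre n"
  shows "\<exists>s. \<forall>k<r. c k *\<^sub>C p k = tens n (factors s k)"
proof -
  have "\<exists>b. p k = tens n b" if "k < r" for k using in_segre[OF p[OF that]] by metis
  then obtain b where b: "\<And>k. k < r \<Longrightarrow> p k = tens n (b k)" by metis
  have "c k *\<^sub>C p k = tens n ((b k)(0 := \<lambda>j. c k * b k 0 j))" if "k < r" for k
    using tens_slot_scale[of 0 n "b k" "c k" "b k 0"] ne b[OF that] by simp
  moreover define s where "s = (\<lambda>(k, I, j). ((b k)(0 := \<lambda>j. c k * b k 0 j)) I j)"
  have "factors s k = (b k)(0 := \<lambda>j. c k * b k 0 j)" for k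
    by (simp add: fun_eq_iff factors_def s_def)
  ultimately show ?thesis by (intro exI[of _ s]) simp
qed

lemma scale_decomp:
  assumes ne: "n \<noteq> []"
  obtains s' where "c *\<^sub>C decomp n r s = decomp n r s'"
proof -
  let ?b = "\<lambda>k. (factors s k)(0 := \<lambda>j. c * factors s k 0 j)"
  let ?s = "\<lambda>(k, I, j). ?b k I j"
  have "factors ?s k = ?b k" for k by (simp add: fun_eq_iff factors_def)
  moreover have "tens n (?b k) = c *\<^sub>C tens n (factors s k)" for k
    using tens_slot_scale[of 0 n "factors s k" c "factors s k 0"] ne by simp
  ultimately have "c *\<^sub>C decomp n r s = decomp n r ?s"
    by (simp add: decomp_def tensor.scale_sum_right)
  then show ?thesis by (rule that)
qed

abbreviation secant_points :: "nat list \<Rightarrow> nat \<Rightarrow> tensor set" where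
  "secant_points n r \<equiv> {x. x \<noteq> 0 \<and> (\<exists>p. (\<forall>k<r. p k \<in> segre n) \<and> x \<in> tensor.span (p ` {..<r}))}"

lemma secant_point_decomp:
  assumes ne: "n \<noteq> []" and x: "x \<in> secant_points n r"
  obtains s where "x = decomp n r s"
proof -
  obtain p where p: "\<And>k. k < r \<Longrightarrow> p k \<in> segre n" and xp: "x \<in> tensor.span (p ` {..<r})" using x by blast
  let ?S = "{\<Sum>k<r. c k *\<^sub>C p k | c. True}"
  have sub: "tensor.subspace ?S"
    unfolding tensor.subspace_def
  proof (intro conjI ballI allI)
    show "0 \<in> ?S" by (intro CollectI exI[of _ "\<lambda>k. 0"]) simp
    fix x assume "x \<in> ?S"
    then obtain c where x: "x = (\<Sum>k<r. c k *\<^sub>C p k)" by blast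
    show "a *\<^sub>C x \<in> ?S" for a
      by (intro CollectI exI[of _ "\<lambda>k. a * c k"]) (simp add: x tensor.scale_sum_right)
    fix y assume "y \<in> ?S"
    then obtain c' where y: "y = (\<Sum>k<r. c' k *\<^sub>C p k)" by blast
    show "x + y \<in> ?S"
      by (intro CollectI exI[of _ "\<lambda>k. c k + c' k"]) (simp add: x y tensor.scale_left_distrib sum.distrib)
  qed
  have "p k \<in> ?S" if "k < r" for k
  proof (intro CollectI exI conjI TrueI)
    have "(\<Sum>l<r. (if l = k then 1 else 0) *\<^sub>C p l) = (\<Sum>l<r. if l = k then p k else 0)"
      by (intro sum.cong) auto
    then show "p k = (\<Sum>l<r. (if l = k then 1 else 0) *\<^sub>C p l)" using that by simp
  qed
  then have "tensor.span (p ` {..<r}) \<subseteq> ?S" by (intro tensor.span_minimal sub) auto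
  then obtain c where c: "x = (\<Sum>k<r. c k *\<^sub>C p k)" using xp by blast
  have "\<exists>s. \<forall>k<r. c k *\<^sub>C p k = tens n (factors s k)" by (rule combination_decomp[OF ne p])
  then obtain s where s: "\<forall>k<r. c k *\<^sub>C p k = tens n (factors s k)" ..
  then have "x = decomp n r s" unfolding c decomp_def by (intro sum.cong) auto
  then show ?thesis by (rule that)
qed

text \<open>
  Summands that vanish have to be replaced by points of the Segre variety; their coefficients are
  zero.
\<close>

lemma decomp_secant_point:
  assumes pos: "\<forall>m\<in>set n. 1 \<le> m" and nz: "decomp n r s \<noteq> 0"
  shows "decomp n r s \<in> secant_points n r"
proof -
  obtain x0 where x0: "x0 \<in> segre n" using segre_nonempty[OF pos] by auto
  let ?p = "\<lambda>k. if tens n (factors s k) = 0 then x0 else tens n (factors s k)"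
  have "?p k \<in> segre n" if "k < r" for k
  proof (cases "tens n (factors s k) = 0")
    case False
    then have "\<exists>j<n ! I. factors s k I j \<noteq> 0" if "I < length n" for I
      using tens_zero[OF that, of "factors s k"] by blast
    then show ?thesis using False tens_in_segre by simp
  qed (simp add: x0)
  moreover have "decomp n r s \<in> tensor.span (?p ` {..<r})"
    unfolding decomp_def
  proof (rule tensor.span_sum)
    fix k assume k: "k \<in> {..<r}"
    show "tens n (factors s k) \<in> tensor.span (?p ` {..<r})"
    proof (cases "tens n (factors s k) = 0")
      case True
      then show ?thesis by (simp add: tensor.span_zero)
    next
      case False
      then show ?thesis using k by (intro tensor.span_base image_eqI[of _ _ k]) auto
    qed
  qed
  ultimately show ?thesis using nz by (intro CollectI conjI exI[of _ ?p]) auto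
qed

lemma secant_points_subset:
  assumes "n \<noteq> []"
  shows "secant_points n r \<subseteq> proj_space n"
proof
  fix x assume x: "x \<in> secant_points n r"
  then obtain s where "x = decomp n r s" by (rule secant_point_decomp[OF assms])
  then show "x \<in> proj_space n" using decomp_tensors x by (auto simp: proj_space_def)
qed

lemma secant_points_nonempty:
  assumes pos: "\<forall>m\<in>set n. 1 \<le> m" and r: "1 \<le> r"
  shows "secant_points n r \<noteq> {}"
proof -
  obtain x where x: "x \<in> segre n" using segre_nonempty[OF pos] by auto
  then obtain b where "x = tens n b" "\<And>I. I < length n \<Longrightarrow> \<exists>j<n ! I. b I j \<noteq> 0"
    by (rule in_segre) blast
  then have "x \<noteq> 0" using tens_nonzero by metis
  moreover have "x \<in> tensor.span ((\<lambda>k. x) ` {..<r})" using r by (intro tensor.span_base image_eqI[of _ _ 0]) auto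
  ultimately show ?thesis using x by (auto intro!: exI[of _ x] exI[of _ "\<lambda>k. x"])
qed

lemma zariski_closed_zeros: "f \<in> homogeneous_polys \<Longrightarrow> zariski_closed n {x \<in> proj_space n. f x = 0}"
  unfolding zariski_closed_def by (intro exI[of _ "{f}"]) auto

text \<open>
  Homogeneous polynomials on the secant variety are controlled by the parametrization \<open>decomp\<close>,
  although this may take the value zero, which is not a point, and need not be onto.
\<close>

lemma vanishing_on_secant_variety:
  assumes ne: "n \<noteq> []" and pos: "\<forall>m\<in>set n. 1 \<le> m" and r: "1 \<le> r" and f: "f \<in> homogeneous_polys"
  shows "(\<forall>x\<in>secant_variety n r. f x = 0) \<longleftrightarrow> (\<forall>s. f (decomp n r s) = 0)"
proof
  assume v: "\<forall>x\<in>secant_variety n r. f x = 0"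
  have sub: "secant_points n r \<subseteq> secant_variety n r"
    unfolding secant_variety_def zariski_closure_def by (rule hull_subset)
  show "\<forall>s. f (decomp n r s) = 0"
  proof
    fix s
    show "f (decomp n r s) = 0"
    proof (cases "decomp n r s = 0")
      case True
      obtain x where "x \<in> secant_points n r" using secant_points_nonempty[OF pos r] by blast
      then have "f x = 0" using v sub by blast
      then show ?thesis using homogeneous_zero[OF f] True by simp
    next
      case False
      then show ?thesis using decomp_secant_point[OF pos] v sub by blast
    qed
  qed
next
  assume v: "\<forall>s. f (decomp n r s) = 0"
  have "secant_points n r \<subseteq> {x \<in> proj_space n. f x = 0}"
  proof
    fix x assume x: "x \<in> secant_points n r"
    then obtain s where "x = decomp n r s" by (rule secant_point_decomp[OF ne])
    then show "x \<in> {x \<in> proj_space n. f x = 0}" using v x secant_points_subset[OF ne] by blast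
  qed
  then have "secant_variety n r \<subseteq> {x \<in> proj_space n. f x = 0}"
    unfolding secant_variety_def zariski_closure_def by (intro hull_minimal zariski_closed_zeros f)
  then show "\<forall>x\<in>secant_variety n r. f x = 0" by blast
qed

lemma secant_variety_subset: "n \<noteq> [] \<Longrightarrow> secant_variety n r \<subseteq> proj_space n"
  unfolding secant_variety_def zariski_closure_def
proof (rule hull_minimal)
  show "zariski_closed n (proj_space n)" unfolding zariski_closed_def by (intro exI[of _ "{}"]) auto
qed (rule secant_points_subset)

lemma homogeneous_compose_decomp:
  "f \<in> homogeneous_polys \<Longrightarrow> (\<lambda>s. f (decomp n r s)) \<in> polys UNIV (params n r)"
  using polys_compose[where g = f and V = UNIV and h = "\<lambda>i s. decomp n r s i", OF _ decomp_polys[OF subring_UNIV]]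
  by (simp add: homogeneous_polys_def poly_funs_eq)

lemma homogeneous_mult:
  assumes "f \<in> homogeneous_polys" "g \<in> homogeneous_polys"
  shows "(\<lambda>x. f x * g x) \<in> homogeneous_polys"
proof -
  obtain k l :: nat where "\<forall>c x. f (c *\<^sub>C x) = c ^ k * f x" "\<forall>c x. g (c *\<^sub>C x) = c ^ l * g x"
    using assms by (auto simp: homogeneous_polys_def)
  then have "\<forall>c x. f (c *\<^sub>C x) * g (c *\<^sub>C x) = c ^ (k + l) * (f x * g x)" by (simp add: power_add)
  then show ?thesis using assms by (auto simp: homogeneous_polys_def intro: poly_funs.mult)
qed

lemma homogeneous_prod:
  "(\<And>i. i \<in> A \<Longrightarrow> f i \<in> homogeneous_polys) \<Longrightarrow> (\<lambda>x. \<Prod>i\<in>A. f i x) \<in> homogeneous_polys"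
proof (induct A rule: infinite_finite_induct)
  case (insert i A)
  then show ?case using homogeneous_mult[of "f i" "\<lambda>x. \<Prod>i\<in>A. f i x"] by simp
qed (auto simp: homogeneous_polys_def intro: poly_funs.const exI[of _ 0])

text \<open>The secant variety is irreducible, being the closure of the image of an affine space.\<close>

lemma secant_variety_dense:
  assumes ne: "n \<noteq> []" and pos: "\<forall>m\<in>set n. 1 \<le> m" and r: "1 \<le> r"
    and F: "F \<in> homogeneous_polys" "F (decomp n r s0) \<noteq> 0"
  shows "zariski_closure n (secant_variety n r - {x \<in> proj_space n. F x = 0}) = secant_variety n r"
proof
  have idem: "zariski_closure n (secant_variety n r) = secant_variety n r"
    by (simp add: secant_variety_def zariski_closure_def hull_hull)
  have "zariski_closure n (secant_variety n r - {x \<in> proj_space n. F x = 0}) \<subseteq> zariski_closure n (secant_variety n r)"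
    unfolding zariski_closure_def by (rule hull_mono) blast
  then show "zariski_closure n (secant_variety n r - {x \<in> proj_space n. F x = 0}) \<subseteq> secant_variety n r"
    by (simp only: idem)
  show "secant_variety n r \<subseteq> zariski_closure n (secant_variety n r - {x \<in> proj_space n. F x = 0})"
    unfolding zariski_closure_def hull_def
  proof (rule Inter_greatest, clarify)
    fix C x assume C: "zariski_closed n C" "secant_variety n r - {x \<in> proj_space n. F x = 0} \<subseteq> C"
      and x: "x \<in> secant_variety n r"
    obtain S where S: "S \<subseteq> homogeneous_polys" "C = {x \<in> proj_space n. \<forall>f\<in>S. f x = 0}"
      using C(1) by (auto simp: zariski_closed_def)
    have "f x = 0" if f: "f \<in> S" for f
    proof -
      have fh: "f \<in> homogeneous_polys" using f S(1) by blast
      have "\<forall>x\<in>secant_variety n r. F x * f x = 0"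
        using C(2) S(2) f secant_variety_subset[OF ne] by fastforce
      then have zero: "F (decomp n r s) * f (decomp n r s) = 0" for s
        using vanishing_on_secant_variety[OF ne pos r homogeneous_mult[OF F(1) fh]] by simp
      have "f (decomp n r s) = 0" for s
      proof (rule ccontr)
        assume "f (decomp n r s) \<noteq> 0"
        from polys_no_zero_divisors[OF homogeneous_compose_decomp[OF F(1)] F(2) homogeneous_compose_decomp[OF fh] this]
        show False using zero by simp
      qed
      then show ?thesis using vanishing_on_secant_variety[OF ne pos r fh] x by blast
    qed
    then show "x \<in> C" using S(2) x secant_variety_subset[OF ne] by blast
  qed
qed

text \<open>
  Closed sets are defined by homogeneous polynomials, whereas a generic point avoids inhomogeneous
  ones, too. Outside of the hypersurface given by a suitable homogeneous component, almost all
  multiples of a point avoid \<open>g\<close>.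
\<close>

lemma homogeneous_component:
  assumes K: "subring K" and g: "g \<in> polys K V" "g (decomp n r s) \<noteq> 0"
  obtains h where "h \<in> homogeneous_polys" "h (decomp n r s) \<noteq> 0"
    "\<And>x. h x \<noteq> 0 \<Longrightarrow> finite {c. g (c *\<^sub>C x) = 0}"
proof -
  obtain m h where h: "\<And>j. h j \<in> polys K V" "\<And>j c s. h j (\<lambda>v. c * s v) = c ^ j * h j s"
    "\<And>c s. g (\<lambda>v. c * s v) = (\<Sum>j\<le>m. h j s * c ^ j)"
    by (rule homogeneous_components[OF K g(1)]) blast
  have "g (decomp n r s) = (\<Sum>j\<le>m. h j (decomp n r s))" using h(3)[of 1 "decomp n r s"] by simp
  then have "(\<Sum>j\<le>m. h j (decomp n r s)) \<noteq> 0" using g(2) by simp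
  then obtain j where j: "j \<le> m" "h j (decomp n r s) \<noteq> 0" by (metis atMost_iff sum.neutral)
  have "h j \<in> homogeneous_polys"
    using h(1)[of j] h(2)[of j] polys_mono[of "h j" K V UNIV UNIV]
    by (auto simp: homogeneous_polys_def poly_funs_eq smul_def)
  moreover have "finite {c. g (c *\<^sub>C x) = 0}" if x: "h j x \<noteq> 0" for x
  proof -
    let ?p = "\<Sum>j\<le>m. monom (h j x) j"
    have "coeff ?p j = h j x" using j(1) by (simp add: coeff_sum sum.delta)
    then have "?p \<noteq> 0" using x by auto
    moreover have "g (c *\<^sub>C x) = poly ?p c" for c
      using h(3)[of c x] by (simp add: smul_def poly_sum poly_monom)
    ultimately show ?thesis using poly_roots_finite[of ?p] by simp
  qed
  ultimately show ?thesis using that j(2) by blast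
qed

lemma vanishing_on_cone:
  assumes ne: "n \<noteq> []" and pos: "\<forall>m\<in>set n. 1 \<le> m" and r: "1 \<le> r"
    and K: "subring K" and g: "g \<in> polys K V" "\<And>s. g (decomp n r s) = 0" and x: "x \<in> secant_variety n r"
  shows "g (c *\<^sub>C x) = 0"
proof -
  obtain m h where h: "\<And>j. h j \<in> polys K V" "\<And>j c s. h j (\<lambda>v. c * s v) = c ^ j * h j s"
    "\<And>c s. g (\<lambda>v. c * s v) = (\<Sum>j\<le>m. h j s * c ^ j)"
    by (rule homogeneous_components[OF K g(1)]) blast
  have "h j x = 0" if j: "j \<le> m" for j
  proof -
    have hj: "h j \<in> homogeneous_polys"
      using h(1)[of j] h(2)[of j] polys_mono[of "h j" K V UNIV UNIV]
      by (auto simp: homogeneous_polys_def poly_funs_eq smul_def)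
    have "h j (decomp n r s) = 0" for s
    proof -
      let ?p = "\<Sum>j\<le>m. monom (h j (decomp n r s)) j"
      have "poly ?p c = 0" for c
      proof -
        obtain s' where "c *\<^sub>C decomp n r s = decomp n r s'" by (rule scale_decomp[OF ne])
        then have "g (c *\<^sub>C decomp n r s) = 0" using g(2) by simp
        then show ?thesis using h(3)[of c "decomp n r s"] by (simp add: smul_def poly_sum poly_monom)
      qed
      then have "?p = 0" by (intro iffD1[OF poly_eq_poly_eq_iff] ext) simp
      then have "coeff ?p j = 0" by simp
      then show ?thesis using j by (simp add: coeff_sum sum.delta)
    qed
    then show ?thesis using vanishing_on_secant_variety[OF ne pos r hj] x by blast
  qed
  then show ?thesis using h(3)[of c x] by (simp add: smul_def)
qed


section \<open>Representations\<close>

text \<open>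
  In terms of tensors with absorbed coefficients. Since they do not vanish, equal tensors give equal
  points.
\<close>

lemma unique_representationI:
  assumes ne: "n \<noteq> []" and x: "x = decomp n r s" "\<And>k. k < r \<Longrightarrow> tens n (factors s k) \<noteq> 0"
    and unique: "\<And>s s'. x = decomp n r s \<Longrightarrow> x = decomp n r s' \<Longrightarrow> \<exists>\<pi>. \<pi> permutes {..<r} \<and>
      (\<forall>k<r. tens n (factors s' k) = tens n (factors s (\<pi> k)) \<and> tens n (factors s' k) \<noteq> 0)"
  shows "has_unique_representation n r x"
  unfolding has_unique_representation_def
proof (intro conjI allI impI)
  have "tens n (factors s k) \<in> segre n" if "k < r" for k
  proof (rule tens_in_segre)
    show "\<exists>j<n ! I. factors s k I j \<noteq> 0" if "I < length n" for I
      using tens_zero[OF that, of "factors s k"] x(2)[OF \<open>k < r\<close>] by blast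
  qed
  then have "is_representation n r x (\<lambda>k. 1) (\<lambda>k. tens n (factors s k))"
    by (simp add: is_representation_def x(1) decomp_def)
  then show "\<exists>c p. is_representation n r x c p" by blast
next
  fix c p c' p' assume "is_representation n r x c p \<and> is_representation n r x c' p'"
  then have p: "\<And>k. k < r \<Longrightarrow> p k \<in> segre n" "x = (\<Sum>k<r. c k *\<^sub>C p k)"
    and p': "\<And>k. k < r \<Longrightarrow> p' k \<in> segre n" "x = (\<Sum>k<r. c' k *\<^sub>C p' k)"
    by (auto simp: is_representation_def)
  have "\<exists>s. \<forall>k<r. c k *\<^sub>C p k = tens n (factors s k)" by (rule combination_decomp[OF ne p(1)])
  then obtain s where s: "\<forall>k<r. c k *\<^sub>C p k = tens n (factors s k)" ..
  have "\<exists>s'. \<forall>k<r. c' k *\<^sub>C p' k = tens n (factors s' k)" by (rule combination_decomp[OF ne p'(1)])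
  then obtain s' where s': "\<forall>k<r. c' k *\<^sub>C p' k = tens n (factors s' k)" ..
  have "x = decomp n r s" "x = decomp n r s'"
    using p(2) p'(2) s s' by (simp_all add: decomp_def)
  from unique[OF this] obtain \<pi> where \<pi>: "\<pi> permutes {..<r}"
    "\<And>k. k < r \<Longrightarrow> tens n (factors s' k) = tens n (factors s (\<pi> k)) \<and> tens n (factors s' k) \<noteq> 0" by blast
  have "same_point (p' k) (p (\<pi> k)) \<and> c' k *\<^sub>C p' k = c (\<pi> k) *\<^sub>C p (\<pi> k)" if k: "k < r" for k
  proof
    have \<pi>k: "\<pi> k < r" using permutes_in_image[OF \<pi>(1)] k by simp
    show eq: "c' k *\<^sub>C p' k = c (\<pi> k) *\<^sub>C p (\<pi> k)" using \<pi>(2)[OF k] s \<pi>k s' k by simp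
    have "c' k *\<^sub>C p' k \<noteq> 0" using \<pi>(2)[OF k] s' k by metis
    then have nz: "c' k \<noteq> 0" "c (\<pi> k) \<noteq> 0" using eq by auto
    have "p' k = inverse (c' k) *\<^sub>C c' k *\<^sub>C p' k" using nz by simp
    also have "\<dots> = (inverse (c' k) * c (\<pi> k)) *\<^sub>C p (\<pi> k)" by (simp add: eq)
    finally show "same_point (p' k) (p (\<pi> k))"
      unfolding same_point_def using nz by (intro exI[of _ "inverse (c' k) * c (\<pi> k)"]) simp
  qed
  then show "\<exists>\<pi>. \<pi> permutes {..<r} \<and> (\<forall>k<r. same_point (p' k) (p (\<pi> k)) \<and> c' k *\<^sub>C p' k = c (\<pi> k) *\<^sub>C p (\<pi> k))"
    using \<pi>(1) by blast
qed

lemma unique_representation_scale: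
  assumes a: "a \<noteq> 0" and u: "has_unique_representation n r (a *\<^sub>C x)"
  shows "has_unique_representation n r x"
proof -
  have rep: "is_representation n r (a *\<^sub>C x) (\<lambda>k. a * c k) p" if "is_representation n r x c p" for c p
    using that by (simp add: is_representation_def tensor.scale_sum_right)
  obtain c p where "is_representation n r (a *\<^sub>C x) c p" using u by (auto simp: has_unique_representation_def)
  then have cp: "\<forall>k<r. p k \<in> segre n" "a *\<^sub>C x = (\<Sum>k<r. c k *\<^sub>C p k)" by (auto simp: is_representation_def)
  have "x = inverse a *\<^sub>C a *\<^sub>C x" using a by simp
  also have "\<dots> = (\<Sum>k<r. (inverse a * c k) *\<^sub>C p k)" unfolding cp(2) by (simp add: tensor.scale_sum_right)
  finally have ex: "is_representation n r x (\<lambda>k. inverse a * c k) p" using cp(1) by (simp add: is_representation_def)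
  show ?thesis
    unfolding has_unique_representation_def
  proof (intro conjI allI impI)
    show "\<exists>c p. is_representation n r x c p" using ex by blast
    fix c p c' p' assume "is_representation n r x c p \<and> is_representation n r x c' p'"
    then have "is_representation n r (a *\<^sub>C x) (\<lambda>k. a * c k) p \<and> is_representation n r (a *\<^sub>C x) (\<lambda>k. a * c' k) p'"
      using rep by blast
    then obtain \<pi> where \<pi>: "\<pi> permutes {..<r}" "\<And>k. k < r \<Longrightarrow> same_point (p' k) (p (\<pi> k)) \<and>
        (a * c' k) *\<^sub>C p' k = (a * c (\<pi> k)) *\<^sub>C p (\<pi> k)"
      using u unfolding has_unique_representation_def by meson
    have "c' k *\<^sub>C p' k = c (\<pi> k) *\<^sub>C p (\<pi> k)" if "k < r" for k
    proof -
      have "a *\<^sub>C (c' k *\<^sub>C p' k) = a *\<^sub>C (c (\<pi> k) *\<^sub>C p (\<pi> k))" using \<pi>(2)[OF that] by simp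
      then show ?thesis using a by (simp only: tensor.scale_cancel_left) simp
    qed
    then show "\<exists>\<pi>. \<pi> permutes {..<r} \<and> (\<forall>k<r. same_point (p' k) (p (\<pi> k)) \<and> c' k *\<^sub>C p' k = c (\<pi> k) *\<^sub>C p (\<pi> k))"
      using \<pi> by blast
  qed
qed

lemma polys_sequence:
  assumes "g \<in> polys K V" "subring S" "\<And>c. c \<in> K \<Longrightarrow> (\<lambda>N. c) \<in> S" "\<And>v. v \<in> V \<Longrightarrow> (\<lambda>N. X N v) \<in> S"
  shows "(\<lambda>N. g (X N)) \<in> S"
  using assms(1)
proof (induct rule: polys.induct)
  case (add f g)
  then show ?case using subring_add[OF assms(2), of "\<lambda>N. f (X N)" "\<lambda>N. g (X N)"] by (simp add: plus_fun_def)
next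
  case (mult f g)
  then show ?case using subring_mult[OF assms(2), of "\<lambda>N. f (X N)" "\<lambda>N. g (X N)"] by (simp add: times_fun_def)
qed (use assms in auto)

lemma matchedD:
  assumes "matched S" "s \<in> S"
  shows "s 0 = 0 \<longleftrightarrow> eventually (\<lambda>N. s N = 0) ultra"
  using assms by (auto simp: matched_def)

text \<open>
  If a generic point has only one decomposition, so has a general point. Otherwise there would be a
  sequence of bad points, outside more and more hypersurfaces, that has the generic point as a
  limit in the sense of matched rings. Lifting the decomposition of the limit decomposes almost all
  of its members, and two different decompositions of them have two different decompositions of the
  generic point as limits.
\<close>

lemma generically_identifiable_of_generic_point:
  assumes ne: "n \<noteq> []" and pos: "\<forall>m\<in>set n. 1 \<le> m" and r: "1 \<le> r"
    and K: "subring K" "countable K" and t: "generic K (params n r) t"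
    and unique: "\<And>s. decomp n r t = decomp n r s \<Longrightarrow>
      \<exists>\<pi>. \<pi> permutes {..<r} \<and> (\<forall>k<r. tens n (factors s k) = tens n (factors t (\<pi> k)))"
  shows "generically_identifiable n r"
proof (rule ccontr)
  assume not_id: "\<not> generically_identifiable n r"
  have bad: "\<exists>x\<in>secant_variety n r. F x \<noteq> 0 \<and> \<not> has_unique_representation n r x"
    if F: "F \<in> homogeneous_polys" "F (decomp n r s) \<noteq> 0" for F s
  proof (rule ccontr)
    let ?Z = "{x \<in> proj_space n. F x = 0}"
    assume "\<not> ?thesis"
    then have "\<forall>x\<in>secant_variety n r - ?Z. has_unique_representation n r x"
      using secant_variety_subset[OF ne] by blast
    then have "generically_identifiable n r"
      unfolding generically_identifiable_def
      using zariski_closed_zeros[OF F(1), of n] secant_variety_dense[OF ne pos r F] by (intro exI[of _ ?Z] conjI)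
    then show False using not_id by simp
  qed
  define G where "G = {g \<in> polys K (idx n). \<exists>s. g (decomp n r s) \<noteq> 0}"
  have "K \<noteq> {}" using subring_one[OF K(1)] by blast
  then have cG: "countable G"
    using countable_polys[OF K(2)] by (auto simp: G_def intro: countable_subset[of _ "polys K (idx n)"])
  have one: "(\<lambda>x. 1) \<in> G" by (auto simp: G_def intro: polys.const[OF subring_one[OF K(1)]])
  define g where "g = from_nat_into G"
  have g: "g i \<in> G" for i unfolding g_def using one by (intro from_nat_into) auto
  have "\<exists>h. h \<in> homogeneous_polys \<and> (\<exists>s. h (decomp n r s) \<noteq> 0) \<and>
      (\<forall>x. h x \<noteq> 0 \<longrightarrow> finite {c. g i (c *\<^sub>C x) = 0})" for i
  proof -
    obtain s where s: "g i \<in> polys K (idx n)" "g i (decomp n r s) \<noteq> 0" using g[of i] by (auto simp: G_def)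
    obtain h where "h \<in> homogeneous_polys" "h (decomp n r s) \<noteq> 0"
      "\<And>x. h x \<noteq> 0 \<Longrightarrow> finite {c. g i (c *\<^sub>C x) = 0}" by (rule homogeneous_component[OF K(1) s]) blast
    then show ?thesis by blast
  qed
  then obtain h where h: "\<And>i. h i \<in> homogeneous_polys" "\<And>i. \<exists>s. h i (decomp n r s) \<noteq> 0"
    "\<And>i x. h i x \<noteq> 0 \<Longrightarrow> finite {c. g i (c *\<^sub>C x) = 0}" by metis
  \<comment> \<open>The \<open>N\<close>-th bad point avoids the first \<open>N\<close> hypersurfaces, and a suitable multiple avoids the polynomials.\<close>
  have "\<exists>x. x \<in> secant_variety n r \<and> \<not> has_unique_representation n r x \<and> (\<forall>i\<le>N. h i x \<noteq> 0)" for N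
  proof -
    have "\<exists>s. (\<Prod>i\<le>N. h i (decomp n r s)) \<noteq> 0"
      by (rule prod_polys_nonzero[of _ _ UNIV "params n r"]) (use homogeneous_compose_decomp h in auto)
    then obtain s where "(\<Prod>i\<le>N. h i (decomp n r s)) \<noteq> 0" ..
    from bad[OF homogeneous_prod[of "{..N}" h] this] h(1) show ?thesis by auto
  qed
  then obtain x where x: "\<And>N. x N \<in> secant_variety n r" "\<And>N. \<not> has_unique_representation n r (x N)"
    "\<And>N i. i \<le> N \<Longrightarrow> h i (x N) \<noteq> 0" by metis
  have "\<exists>c. c \<noteq> 0 \<and> (\<forall>i\<le>N. g i (c *\<^sub>C x N) \<noteq> 0)" for N
  proof -
    let ?B = "insert 0 (\<Union>i\<le>N. {c. g i (c *\<^sub>C x N) = 0})"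
    have "finite ?B" using h(3) x(3) by auto
    then have "?B \<noteq> UNIV" using infinite_UNIV_char_0[where 'a = complex] by metis
    then obtain c where "c \<notin> ?B" by blast
    then show ?thesis by (intro exI[of _ c]) auto
  qed
  then obtain a where a: "\<And>N. a N \<noteq> 0" "\<And>N i. i \<le> N \<Longrightarrow> g i (a N *\<^sub>C x N) \<noteq> 0" by metis
  define X where "X N = (if N = 0 then decomp n r t else a N *\<^sub>C x N)" for N :: nat
  have XN: "X N = a N *\<^sub>C x N" if "N > 0" for N using that by (simp add: X_def)
  have X_tensors: "X N \<in> tensors n" for N
    using x(1)[of N] secant_variety_subset[OF ne] decomp_tensors[of n r t]
    by (auto simp: X_def proj_space_def tensors_def smul_def)

  \<comment> \<open>The generic point is a limit of the bad points.\<close>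
  define R where "R = (\<lambda>f N. f (X N)) ` polys K (idx n)"
  have PK: "subring (polys K (idx n))" by (rule subring_polys[OF K(1)])
  have "matched R"
    unfolding matched_def
  proof (intro conjI ballI)
    show "countable R" unfolding R_def using countable_polys[OF K(2) \<open>K \<noteq> {}\<close>] by (rule countable_image)
    show "subring R"
      unfolding subring_def
    proof (intro conjI ballI)
      show "1 \<in> R" unfolding R_def using subring_one[OF PK] by (intro image_eqI[of _ _ 1]) (auto simp: one_fun_def)
      fix u v assume "u \<in> R" "v \<in> R"
      then obtain f f' where f: "f \<in> polys K (idx n)" "u = (\<lambda>N. f (X N))"
        and f': "f' \<in> polys K (idx n)" "v = (\<lambda>N. f' (X N))" by (auto simp: R_def)
      show "u - v \<in> R" unfolding R_def
        using subring_diff[OF PK f(1) f'(1)] by (intro image_eqI[of _ _ "f - f'"]) (auto simp: f f' fun_eq_iff)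
      show "u * v \<in> R" unfolding R_def
        using subring_mult[OF PK f(1) f'(1)] by (intro image_eqI[of _ _ "f * f'"]) (auto simp: f f' fun_eq_iff)
    qed
    fix u assume "u \<in> R"
    then obtain f where f: "f \<in> polys K (idx n)" and u: "u = (\<lambda>N. f (X N))" by (auto simp: R_def)
    show "u 0 = 0 \<longleftrightarrow> eventually (\<lambda>N. u N = 0) ultra"
    proof (cases "f (decomp n r t) = 0")
      case True
      have comp: "(\<lambda>s. f (decomp n r s)) \<in> polys K (params n r)"
        using polys_compose[where h = "\<lambda>i s. decomp n r s i", OF f decomp_polys[OF K(1)]] by simp
      have zero: "f (decomp n r s) = 0" for s using bspec[OF t[unfolded generic_def] comp] True by simp
      have "u N = 0" for N
        using vanishing_on_cone[OF ne pos r K(1) f zero x(1)[of N], of "a N"] True by (simp add: u X_def)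
      then show ?thesis by simp
    next
      case False
      then have "f \<in> G" using f by (auto simp: G_def)
      then obtain i where i: "g i = f" unfolding g_def using from_nat_into_to_nat_on[OF cG] by blast
      have "eventually (\<lambda>N. u N \<noteq> 0) ultra"
        using eventually_ultra_ge[of "Suc i"]
      proof eventually_elim
        case (elim N)
        then show ?case using a(2)[of i N] XN[of N] by (simp add: u i)
      qed
      then have "\<not> eventually (\<lambda>N. u N = 0) ultra" unfolding not_eventually_ultra .
      then show ?thesis using False by (simp add: u X_def)
    qed
  qed
  have X_R: "(\<lambda>N. X N i) \<in> R" if "i \<in> idx n" for i
    unfolding R_def using polys.var[OF that, of K] by (rule image_eqI[rotated]) simp
  have K_R: "(\<lambda>N. c) \<in> R" if "c \<in> K" for c
    unfolding R_def using polys.const[OF that, of "idx n"] by (rule image_eqI[rotated]) simp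

  \<comment> \<open>Decompositions pass from the limit to the sequence, and back.\<close>
  have decomp_matched: "(\<forall>i\<in>idx n. decomp n r (Y 0) i = X 0 i) \<longleftrightarrow> eventually (\<lambda>N. decomp n r (Y N) = X N) ultra"
    if S: "matched S" "R \<subseteq> S" and Y: "\<And>v. v \<in> params n r \<Longrightarrow> (\<lambda>N. Y N v) \<in> S" for Y S
  proof -
    have S': "subring S" using S(1) by (simp add: matched_def)
    have "decomp n r (Y 0) i = X 0 i \<longleftrightarrow> eventually (\<lambda>N. decomp n r (Y N) i = X N i) ultra" if i: "i \<in> idx n" for i
    proof -
      have "(\<lambda>N. decomp n r (Y N) i) \<in> S"
        by (rule polys_sequence[OF decomp_polys[OF K(1)] S' _ Y]) (use K_R S(2) in auto)
      then have "(\<lambda>N. decomp n r (Y N) i) - (\<lambda>N. X N i) \<in> S"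
        using X_R[OF i] S(2) by (intro subring_diff[OF S']) auto
      from matchedD[OF S(1) this] show ?thesis by simp
    qed
    then have "(\<forall>i\<in>idx n. decomp n r (Y 0) i = X 0 i) \<longleftrightarrow>
        eventually (\<lambda>N. \<forall>i\<in>idx n. decomp n r (Y N) i = X N i) ultra"
      by (simp add: eventually_ball_finite_distrib finite_idx)
    moreover have "(\<forall>i\<in>idx n. decomp n r (Y N) i = X N i) \<longleftrightarrow> decomp n r (Y N) = X N" for N
      using X_tensors[of N] decomp_tensors[of n r "Y N"] by (auto simp: tensors_def fun_eq_iff)
    ultimately show ?thesis by simp
  qed
  have tens_matched: "tens n (factors (Y 0) k) = tens n (factors (Y' 0) l) \<longleftrightarrow>
      eventually (\<lambda>N. tens n (factors (Y N) k) = tens n (factors (Y' N) l)) ultra"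
    if S: "matched S" "R \<subseteq> S" and Y: "\<And>v. v \<in> params n r \<Longrightarrow> (\<lambda>N. Y N v) \<in> S"
      "\<And>v. v \<in> params n r \<Longrightarrow> (\<lambda>N. Y' N v) \<in> S" and kl: "k < r" "l < r" for Y Y' S k l
  proof -
    have S': "subring S" using S(1) by (simp add: matched_def)
    have "tens n (factors (Y 0) k) i = tens n (factors (Y' 0) l) i \<longleftrightarrow>
        eventually (\<lambda>N. tens n (factors (Y N) k) i = tens n (factors (Y' N) l) i) ultra" for i
    proof -
      have "(\<lambda>N. tens n (factors (Y N) k) i) \<in> S" "(\<lambda>N. tens n (factors (Y' N) l) i) \<in> S"
        using K_R S(2) by (auto intro!: polys_sequence[OF factor_tens_polys[OF K(1) kl(1)] S' _ Y(1)]
            polys_sequence[OF factor_tens_polys[OF K(1) kl(2)] S' _ Y(2)])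
      from matchedD[OF S(1) subring_diff[OF S' this]] show ?thesis by simp
    qed
    then have "(\<forall>i\<in>idx n. tens n (factors (Y 0) k) i = tens n (factors (Y' 0) l) i) \<longleftrightarrow>
        eventually (\<lambda>N. \<forall>i\<in>idx n. tens n (factors (Y N) k) i = tens n (factors (Y' N) l) i) ultra"
      by (simp add: eventually_ball_finite_distrib finite_idx)
    moreover have "(\<forall>i\<in>idx n. tens n b i = tens n b' i) \<longleftrightarrow> tens n b = tens n b'" for b b'
      by (auto simp: tens_def fun_eq_iff)
    ultimately show ?thesis by simp
  qed

  have t_nz: "tens n (factors t k) \<noteq> 0" if k: "k < r" for k
  proof (rule tens_nonzero)
    fix I assume I: "I < length n"
    then have nI: "1 \<le> n ! I" using pos by simp
    have "(\<lambda>s. s (k, I, 0)) \<in> polys K (params n r)"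
      using k I nI by (intro polys.var) (auto simp: params_def)
    from generic_nonzero[OF t this, of "\<lambda>_. 1"] show "\<exists>j<n ! I. factors t k I j \<noteq> 0"
      using nI by (intro exI[of _ 0]) (auto simp: factors_def)
  qed

  obtain T S1 where T: "\<forall>v\<in>params n r. T v 0 = t v \<and> T v \<in> S1" and S1: "R \<subseteq> S1" "matched S1"
    using matched_lift[OF finite_params \<open>matched R\<close>, of n r t] by blast
  define T' where "T' N v = T v N" for N v
  have T'S: "(\<lambda>N. T' N v) \<in> S1" if "v \<in> params n r" for v using T that by (simp add: T'_def)
  have "decomp n r (T' 0) = decomp n r t" using T by (intro decomp_cong) (simp add: T'_def)
  then have evT: "eventually (\<lambda>N. decomp n r (T' N) = X N) ultra"
    using decomp_matched[where Y = T', OF S1(2,1) T'S] by (simp add: X_def)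

  have ex: "\<exists>s s'. X N = decomp n r s \<and> X N = decomp n r s' \<and> \<not> (\<exists>\<pi>. \<pi> permutes {..<r} \<and>
      (\<forall>k<r. tens n (factors s' k) = tens n (factors s (\<pi> k)) \<and> tens n (factors s' k) \<noteq> 0))"
    if N: "N > 0" "decomp n r (T' N) = X N" "\<And>k. k < r \<Longrightarrow> tens n (factors (T' N) k) \<noteq> 0" for N
  proof (rule ccontr)
    assume "\<not> ?thesis"
    then have "has_unique_representation n r (X N)"
      by (intro unique_representationI[OF ne N(2)[symmetric] N(3)]) blast+
    then have "has_unique_representation n r (x N)"
      using unique_representation_scale[OF a(1)[of N]] XN[OF N(1)] by simp
    then show False using x(2) by blast
  qed
  \<comment> \<open>Almost all members of the sequence have two different decompositions; these have limits.\<close>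
  define bad_pair where "bad_pair N s s' \<longleftrightarrow> X N = decomp n r s \<and> X N = decomp n r s' \<and> \<not> (\<exists>\<pi>. \<pi> permutes {..<r} \<and>
      (\<forall>k<r. tens n (factors s' k) = tens n (factors s (\<pi> k)) \<and> tens n (factors s' k) \<noteq> 0))" for N s s'
  have "eventually (\<lambda>N. \<forall>k\<in>{..<r}. tens n (factors (T' N) k) \<noteq> 0) ultra"
  proof (rule eventually_ball_finite, simp, rule ballI)
    fix k assume k: "k \<in> {..<r}"
    then have k': "k < r" by simp
    have S': "subring S1" using S1(2) by (simp add: matched_def)
    have "tens n (factors (T' 0) k) = tens n (factors t k)"
      using k T by (intro tens_cong) (auto simp: factors_def T'_def params_def)
    then obtain i where i: "tens n (factors (T' 0) k) i \<noteq> 0" using t_nz[OF k'] by (metis zero_fun_apply ext)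
    have "(\<lambda>N. tens n (factors (T' N) k) i) \<in> S1"
      by (rule polys_sequence[OF factor_tens_polys[OF K(1) k'] S' _ T'S]) (use K_R S1(1) in auto)
    from matchedD[OF S1(2) this] have "\<not> eventually (\<lambda>N. tens n (factors (T' N) k) i = 0) ultra" using i by simp
    then have "eventually (\<lambda>N. tens n (factors (T' N) k) i \<noteq> 0) ultra" by (simp only: not_eventually_ultra)
    then show "eventually (\<lambda>N. tens n (factors (T' N) k) \<noteq> 0) ultra"
      by eventually_elim auto
  qed
  with evT eventually_ultra_ge[of 1] have ev_bad: "eventually (\<lambda>N. \<exists>s s'. bad_pair N s s') ultra"
  proof eventually_elim
    case (elim N)
    then show ?case unfolding bad_pair_def by (intro ex[of N]) auto
  qed
  define Y0 where "Y0 N = (SOME s. \<exists>s'. bad_pair N s s')" for N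
  define Y0' where "Y0' N = (SOME s'. bad_pair N (Y0 N) s')" for N
  have bad_Y0: "bad_pair N (Y0 N) (Y0' N)" if "\<exists>s s'. bad_pair N s s'" for N
    using someI_ex[OF someI_ex[OF that], folded Y0_def, folded Y0'_def] .

  obtain Z S2 where Z: "\<forall>v\<in>params n r. (\<forall>N>0. Z v N = Y0 N v) \<and> Z v \<in> S2" and S2: "S1 \<subseteq> S2" "matched S2"
    using matched_limit[OF finite_params S1(2), of n r "\<lambda>v N. Y0 N v"] by blast
  obtain Z' S3 where Z': "\<forall>v\<in>params n r. (\<forall>N>0. Z' v N = Y0' N v) \<and> Z' v \<in> S3" and S3: "S2 \<subseteq> S3" "matched S3"
    using matched_limit[OF finite_params S2(2), of n r "\<lambda>v N. Y0' N v"] by blast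
  define Y where "Y N v = Z v N" for N v
  define Y' where "Y' N v = Z' v N" for N v
  have YS: "(\<lambda>N. Y N v) \<in> S3" "(\<lambda>N. Y' N v) \<in> S3" if "v \<in> params n r" for v
    using Z Z' S3(1) that by (auto simp: Y_def Y'_def)
  have RS: "R \<subseteq> S3" using S1(1) S2(1) S3(1) by blast
  have Y_eq: "decomp n r (Y N) = decomp n r (Y0 N)" "decomp n r (Y' N) = decomp n r (Y0' N)"
    "tens n (factors (Y N) k) = tens n (factors (Y0 N) k)" "tens n (factors (Y' N) k) = tens n (factors (Y0' N) k)"
    if "N > 0" "k < r" for N k
    using that Z Z' by (auto intro!: decomp_cong tens_cong simp: Y_def Y'_def factors_def params_def)
  have r0: "0 < r" using r by simp
  have "eventually (\<lambda>N. decomp n r (Y N) = X N \<and> decomp n r (Y' N) = X N) ultra"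
    using ev_bad eventually_ultra_ge[of 1]
  proof eventually_elim
    case (elim N)
    note b = bad_Y0[OF elim(1), unfolded bad_pair_def]
    show ?case
      using conjunct1[OF b, symmetric] conjunct1[OF conjunct2[OF b], symmetric] Y_eq(1,2)[of N 0] r0 elim(2)
      by simp
  qed
  then have "eventually (\<lambda>N. decomp n r (Y N) = X N) ultra" "eventually (\<lambda>N. decomp n r (Y' N) = X N) ultra"
    by (auto elim: eventually_mono)
  then have "\<forall>i\<in>idx n. decomp n r (Y 0) i = X 0 i" "\<forall>i\<in>idx n. decomp n r (Y' 0) i = X 0 i"
    using decomp_matched[where Y = Y, OF S3(2) RS YS(1)] decomp_matched[where Y = Y', OF S3(2) RS YS(2)] by simp_all
  then have lim: "decomp n r t = decomp n r (Y 0)" "decomp n r t = decomp n r (Y' 0)"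
    using decomp_tensors[of n r] by (auto simp: X_def tensors_def fun_eq_iff) metis+
  obtain \<pi> where \<pi>: "\<pi> permutes {..<r}" "\<And>k. k < r \<Longrightarrow> tens n (factors (Y 0) k) = tens n (factors t (\<pi> k))"
    using unique[OF lim(1)] by blast
  obtain \<pi>' where \<pi>': "\<pi>' permutes {..<r}" "\<And>k. k < r \<Longrightarrow> tens n (factors (Y' 0) k) = tens n (factors t (\<pi>' k))"
    using unique[OF lim(2)] by blast
  define \<rho> where "\<rho> = inv_into UNIV \<pi> \<circ> \<pi>'"
  have \<rho>: "\<rho> permutes {..<r}" unfolding \<rho>_def using permutes_compose[OF \<pi>'(1) permutes_inv[OF \<pi>(1)]] .
  have \<rho>r: "\<rho> k < r" if "k < r" for k using permutes_in_image[OF \<rho>] that by simp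
  have "tens n (factors (Y' 0) k) = tens n (factors (Y 0) (\<rho> k))" if k: "k < r" for k
    using \<pi>'(2)[OF k] \<pi>(2)[OF \<rho>r[OF k]] permutes_inverses(1)[OF \<pi>(1)] by (simp add: \<rho>_def)
  then have ev1: "eventually (\<lambda>N. tens n (factors (Y' N) k) = tens n (factors (Y N) (\<rho> k))) ultra" if "k < r" for k
    using tens_matched[where Y = Y' and Y' = Y, OF S3(2) RS YS(2) YS(1) that \<rho>r[OF that]] that by blast
  have ev2: "eventually (\<lambda>N. tens n (factors (Y' N) k) \<noteq> 0) ultra" if k: "k < r" for k
  proof -
    have S': "subring S3" using S3(2) by (simp add: matched_def)
    have "\<pi>' k < r" using permutes_in_image[OF \<pi>'(1)] k by simp
    then have "tens n (factors (Y' 0) k) \<noteq> 0" using \<pi>'(2)[OF k] t_nz by simp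
    then obtain i where i: "tens n (factors (Y' 0) k) i \<noteq> 0" by (metis zero_fun_apply ext)
    have "(\<lambda>N. tens n (factors (Y' N) k) i) \<in> S3"
      by (rule polys_sequence[OF factor_tens_polys[OF K(1) k] S' _ YS(2)]) (use K_R RS in auto)
    from matchedD[OF S3(2) this] have "\<not> eventually (\<lambda>N. tens n (factors (Y' N) k) i = 0) ultra" using i by simp
    then have "eventually (\<lambda>N. tens n (factors (Y' N) k) i \<noteq> 0) ultra" by (simp only: not_eventually_ultra)
    then show ?thesis by eventually_elim auto
  qed
  have "eventually (\<lambda>N. \<forall>k\<in>{..<r}. tens n (factors (Y' N) k) = tens n (factors (Y N) (\<rho> k)) \<and> tens n (factors (Y' N) k) \<noteq> 0) ultra"
    using ev1 ev2 by (intro eventually_ball_finite) (auto intro: eventually_conj)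
  with ev_bad eventually_ultra_ge[of 1] have "eventually (\<lambda>N. False) ultra"
  proof eventually_elim
    case (elim N)
    have "tens n (factors (Y0' N) k) = tens n (factors (Y0 N) (\<rho> k)) \<and> tens n (factors (Y0' N) k) \<noteq> 0"
      if k: "k < r" for k
    proof -
      have N: "0 < N" using elim(2) by simp
      have "tens n (factors (Y' N) k) = tens n (factors (Y N) (\<rho> k)) \<and> tens n (factors (Y' N) k) \<noteq> 0"
        using elim(3) k by blast
      then show ?thesis unfolding Y_eq(4)[OF N k] Y_eq(3)[OF N \<rho>r[OF k]] .
    qed
    then have "\<exists>\<pi>. \<pi> permutes {..<r} \<and> (\<forall>k<r. tens n (factors (Y0' N) k) = tens n (factors (Y0 N) (\<pi> k)) \<and> tens n (factors (Y0' N) k) \<noteq> 0)"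
      using \<rho> by blast
    then show ?case using bad_Y0[OF elim(1)] by (auto simp: bad_pair_def)
  qed
  then show False using ultra(1) by simp
qed


theorem proposition2p4:
  fixes n :: "nat list" and r l :: nat
    and p :: "nat \<Rightarrow> tensor" and B :: "nat \<Rightarrow> complex mat" and q :: "nat \<Rightarrow> tensor"
  assumes format: "n \<noteq> []" "\<forall>m\<in>set n. 1 \<le> m"
    and r: "1 \<le> r"
    and points: "\<forall>k<r. p k \<in> segre n"
    and l: "int l = int (prod_list n) - int r * (int (segre_dim n) + 1)"
    and equations: "is_basis l q (vanishing_forms n (tangent_join n r p))"
    and bases: "\<forall>I<length n. B I \<in> carrier_mat (n ! I) (n ! I) \<and> invertible_mat (B I)"
    and adapted: "same_point (p 0) (basis_tensor n B (replicate (length n) 0))"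
    and rank: "vec_space.rank (segre_dim n) (stacked_hessian n B l q) = segre_dim n"
  shows "generically_identifiable n r"
proof -
  \<comment> \<open>For the first point, the factors are the first basis vectors; their product may differ from it by a scalar.\<close>
  define b where "b k = (if k = 0 then \<lambda>I j. B I $$ (j, 0) else (SOME b. p k = tens n b))" for k
  have r0: "0 < r" using r by simp
  have pos: "\<forall>m\<in>set n. 1 \<le> m" and ne: "n \<noteq> []" using format by auto
  let ?col = "\<lambda>I j. B I $$ (j, 0)"
  have slots: "\<exists>j<n ! I. c I j \<noteq> 0" if "k < r" "p k = a *\<^sub>C tens n c" "I < length n" for k a c I
  proof (rule ccontr)
    assume "\<not> ?thesis"
    then have "tens n c = 0" using that(3) by (intro tens_zero[of I]) auto
    then have "p k = 0" using that(2) by simp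
    have "p k \<in> segre n" using points that(1) by blast
    then show False using \<open>p k = 0\<close> tens_nonzero by (metis in_segre)
  qed
  have "basis_tensor n B (replicate (length n) 0) = tens n ?col"
    unfolding basis_tensor_def outer_eq_tens
  proof (rule tens_cong)
    fix I j assume "I < length n" "j < n ! I"
    then show "col (B I) (replicate (length n) 0 ! I) $ j = B I $$ (j, 0)"
      using bases by (cases "n ! I") auto
  qed
  then obtain a where a: "a \<noteq> 0" "p 0 = a *\<^sub>C tens n ?col" using adapted by (auto simp: same_point_def)
  have T: "tangent_space n (segre n) (p k) = tspace n (b k)" if k: "k < r" for k
  proof (cases "k = 0")
    case False
    have "p k \<in> segre n" using points k by blast
    then have "\<exists>b. p k = tens n b" using in_segre by metis
    then have "p k = tens n (SOME b. p k = tens n b)" by (rule someI_ex)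
    then have "p k = tens n (b k)" using False by (simp add: b_def)
    moreover have "\<exists>j<n ! I. b k I j \<noteq> 0" if "I < length n" for I
      using slots[OF k, of 1 "b k"] that calculation by simp
    ultimately show ?thesis using tangent_space_segre[OF pos ne] by simp
  next
    case True
    let ?b = "?col(0 := \<lambda>j. a * ?col 0 j)"
    have p0: "p 0 = tens n ?b" unfolding a(2) by (rule tens_rescale[symmetric]) (use ne in simp)
    have "\<exists>j<n ! I. ?b I j \<noteq> 0" if "I < length n" for I
      using slots[OF r0, of 1 ?b] that p0 by simp
    then have "tangent_space n (segre n) (p 0) = tspace n ?b"
      unfolding p0 by (rule tangent_space_segre[OF pos ne])
    also have "\<dots> = tspace n ?col" using tspace_rescale[of 0 n a ?col] ne a(1) by simp
    finally have "tangent_space n (segre n) (p 0) = tspace n ?col" .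
    moreover have "b 0 = ?col" by (simp add: b_def)
    ultimately show ?thesis using True by (simp only:)
  qed
  define s0 where "s0 = (\<lambda>(k, I, j). b k I j)"
  have s0: "factors s0 = b" by (simp add: fun_eq_iff factors_def s0_def)
  have join: "tangent_join n r p = join n r (factors s0)"
    unfolding tangent_join_def join_def s0 using T by (intro arg_cong[of _ _ tensor.span] SUP_cong) auto
  note eqs = equations[unfolded join]
  have nd: "nondefective n r (factors s0)" by (rule nondefective_of_equations[OF eqs l])
  have hess: "nondegenerate n (join n r (factors s0)) (factors s0 0)"
  proof -
    have "nondegenerate n (join n r (factors s0)) ?col"
    proof (rule nondegenerate_of_stacked_hessian[OF _ _ pos _ bases rank])
      show "tensor.subspace (join n r (factors s0))" by (simp add: join_def tensor.subspace_span)
      show "tspace n ?col \<subseteq> join n r (factors s0)"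
        using tspace_subset_join[OF r0, of n "factors s0"] by (simp add: s0 b_def)
      show "form n (q c) x = 0" if "c < l" "x \<in> join n r (factors s0)" for c x
      proof -
        have "q c \<in> tensor.span (q ` {..<l})" using that(1) by (intro tensor.span_base imageI) auto
        then have "q c \<in> vanishing_forms n (join n r (factors s0))" using eqs by (simp add: is_basis_def)
        then show ?thesis using that(2) by (simp add: vanishing_forms_def)
      qed
    qed
    then show ?thesis by (simp add: s0 b_def)
  qed
  have K: "subring (\<int> :: complex set)" by (simp add: subring_def)
  have K': "countable (\<int> :: complex set)" by (simp add: Ints_def)
  have "(\<int> :: complex set) \<noteq> {}" using Ints_0 by blast
  then obtain t where t: "generic \<int> (params n r) t" by (rule generic_exists[OF finite_params K'])
  \<comment> \<open>After exchanging the first point with another one, the Hessian is nondegenerate there.\<close>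
  have both: "nondefective n r (factors t)" "nondegenerate n (join n r (factors t)) (factors t k)" if k: "k < r" for k
  proof -
    let ?\<tau> = "Transposition.transpose 0 k"
    define s where "s = (\<lambda>(l, I, j). s0 (?\<tau> l, I, j))"
    have s: "factors s l = factors s0 (?\<tau> l)" for l by (simp add: fun_eq_iff factors_def s_def)
    have "?\<tau> ` {..<r} = {..<r}" using k r0 by (intro permutes_image permutes_swap_id) auto
    then have "(\<Union>l<r. tspace n (factors s l)) = (\<Union>l<r. tspace n (factors s0 l))"
      unfolding s by (metis (no_types, lifting) SUP_image comp_apply SUP_cong)
    then have j: "join n r (factors s) = join n r (factors s0)" by (simp add: join_def)
    have "nondefective n r (factors s)" using nd by (simp add: nondefective_def j)
    moreover have "\<exists>j<n ! I. factors s k I j \<noteq> 0" if "I < length n" for I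
      using slots[OF r0 a(2) that] by (simp add: s s0 b_def)
    moreover have "nondegenerate n (join n r (factors s)) (factors s k)"
      using hess by (simp add: j s)
    ultimately show "nondefective n r (factors t)" "nondegenerate n (join n r (factors t)) (factors t k)"
      using generic_nondegenerate[OF K t pos k, of s] by blast+
  qed
  have "\<exists>\<pi>. \<pi> permutes {..<r} \<and> (\<forall>k<r. tens n (factors s k) = tens n (factors t (\<pi> k)))"
    if eq: "decomp n r t = decomp n r s" for s
  proof (cases "segre_dim n = 0")
    case True
    \<comment> \<open>The projective space is a point, so that the number of equations forces \<open>r = 1\<close>.\<close>
    have "n ! I = 1" if "I < length n" for I
    proof -
      have "n ! I - 1 = 0" using True that by (simp add: segre_dim_sum)
      then show ?thesis using pos that by (metis One_nat_def diff_is_0_eq le_antisym nth_mem)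
    qed
    then have "m = 1" if "m \<in> set n" for m using that by (auto simp: in_set_conv_nth)
    then have "prod_list n = 1" by (induct n) auto
    then have "r = 1" using l True r by simp
    then show ?thesis using eq by (intro exI[of _ id]) (simp add: decomp_def permutes_id)
  next
    case False
    have "two_decompositions n r (factors t) (factors s)"
    proof
      show "n \<noteq> []" "\<forall>m\<in>set n. 1 \<le> m" "segre_dim n > 0" using ne pos False by auto
      show "nondefective n r (factors t)" by (rule both(1)[OF r0])
      show "nondegenerate n (join n r (factors t)) (factors t k)" if "k < r" for k by (rule both(2)[OF that])
      show "(\<Sum>k<r. tens n (factors t k)) = (\<Sum>k<r. tens n (factors s k))" using eq by (simp add: decomp_def)
      show "\<exists>\<delta>. derivation \<delta> \<and> (\<forall>k<r. \<forall>I<length n. \<forall>j<n ! I. \<delta> (factors t k I j) = W k I j)" for W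
      proof -
        obtain \<delta> where "derivation \<delta>" "\<And>v. v \<in> params n r \<Longrightarrow> \<delta> (t v) = (case v of (k, I, j) \<Rightarrow> W k I j)"
          using generic_derivation[OF K t, of "\<lambda>(k, I, j). W k I j"] by metis
        then show ?thesis by (intro exI[of _ \<delta>]) (auto simp: factors_def params_def)
      qed
    qed
    then show ?thesis by (rule two_decompositions.decompositions_agree)
  qed
  then show ?thesis by (rule generically_identifiable_of_generic_point[OF ne pos r K K' t])
qed

end
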